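(* There are equivalences, of 1-categories and of 2-categories respectively, $$\mathbf{NatMod}^{\mathrm{str1}}\simeq\mathbf{CwF}^{\mathrm{str1}},\qquad \mathbf{NatMod}^{\mathrm{ps}}\simeq\mathbf{CwF}^{\mathrm{wk}},$$ between structured natural models and categories with families with strict maps, and between natural models with pseudo maps and transformations and categories with families with weak maps and transformations.
   Context: **Natural models.** A natural model is a category $\mathcal C$ together with a map $p:\mathrm{Tm}\to\mathrm{Ty}$ in the presheaf category $\hat{\mathcal C}$ that is representable: the pullback of any representable along it is representable. It is *structured* if equipped with a choice of such pullbacks, i.e. for each $\Gamma\in\mathcal C$ and $A\in\mathrm{Ty}(\Gamma)$ a chosen object $\Gamma.A$, map $p_A:\Gamma.A\to\Gamma$ and element $q_A\in\mathrm{Tm}(\Gamma.A)$ exhibiting $\Gamma.A$ as the pullback of $A:y\Gamma\to\mathrm{Ty}$ along $p$. A *pseudo map* $(\mathcal C,p)\to(\mathcal C',p')$ is a functor $F:\mathcal C\to\mathcal C'$ and a commutative square from $p$ to $F^*p'$ in $\hat{\mathcal C}$ (i.e. natural maps $\mathrm{Ty}\to F^*\mathrm{Ty}'$, $\mathrm{Tm}\to F^*\mathrm{Tm}'$ commuting with $p,F^*p'$), such that $F$ sends representing pullbacks of $p$ to representing pullbacks of $p'$. A *transformation* between $F$ and $G$ is a natural transformation $\alpha:F\to G$ commuting with the given squares to $F^*p'$ and $G^*p'$ (i.e. restriction along $\alpha_\Gamma$ carries the $G$-image of each type and each term over $\Gamma$ to its $F$-image). A map of structured natural models is *strict* if it preserves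 the chosen representations on the nose. $\mathbf{NatMod}^{\mathrm{ps}}$ is the 2-category of natural models, pseudo maps, and transformations; $\mathbf{NatMod}^{\mathrm{str1}}$ is the 1-category of structured natural models and strict maps. **Categories with families.** A category with families (CwF) consists of a category $\mathcal C$ (no terminal object is assumed); a presheaf $\mathrm{Ty}$ on $\mathcal C$; a presheaf $\mathrm{Tm}$ on $\int_{\mathcal C}\mathrm{Ty}$; and for each $\Gamma\in\mathcal C$, $A\in\mathrm{Ty}(\Gamma)$ an object $\Gamma.A$, a map $p_A:\Gamma.A\to\Gamma$ and an element $q_A\in\mathrm{Tm}(\Gamma.A,p_A^*A)$, such that for every $f:\Delta\to\Gamma$ and $a\in\mathrm{Tm}(\Delta,f^*A)$ there is a unique $g:\Delta\to\Gamma.A$ with $p_A g=f$ and $g^*q_A=a$. A *strict map* of CwF's consists of a functor $F$ and natural transformations on $\mathrm{Ty}$ and $\mathrm{Tm}$ (over $F$), preserving the chosen extensions $\Gamma.A$, $p_A$ (and $q_A$) on the nose. A *weak map* consists of the same functor and natural transformations, but required only to preserve context extensions in the sense that their images satisfy the same universal property in the target CwF. A *transformation* of weak maps $F\to G$ is a natural transformation $\alpha:F\to G$ of the underlying functors such that for each $A\in\mathrm{Ty}(\Gamma)$ and $a\in\mathrm{Tm}(\Gamma,A)$, restriction along $\alpha_\Gamma$ carries $GA$ to $FA$ and $Ga$ to $Fa$. $\mathbf{CwF}^{\mathrm{str1}}$ is the 1-category of CwF's and strict maps; $\mathbf{CwF}^{\mathrm{wk}}$ the 2-category of CwF's, weak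 maps and transformations. **Conventions.** 2-categories are strict; an equivalence of 2-categories is a 2-functor inducing equivalences on hom-categories and surjective on objects up to internal equivalence. Existence versus choice of structure is disregarded (choice is assumed where needed). *)

theory Defs
  imports "HOL-Library.FuncSet"
begin

section \<open>Categories, functors and natural transformations\<close>

text \<open>
  Hom-sets are indexed by pairs of objects and need not be disjoint, so composition and the
  action of a functor on arrows take the objects involved as arguments:
  \<open>Comp C x y z g f\<close> is the composite of \<open>f : x \<rightarrow> y\<close> and \<open>g : y \<rightarrow> z\<close>, and \<open>FMap F x y f\<close> is
  the image of \<open>f : x \<rightarrow> y\<close>. Whatever can occur as a morphism (a functor, a natural
  transformation) is required to be \<open>undefined\<close> outside its domain, so that equality of morphisms
  is the intended one. Structures that occur only as objects are, as in HOL-Algebra, not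
  normalised outside their carriers; copies that differ only there are isomorphic by an identity.
\<close>

record ('o, 'a) cat =
  Ob :: "'o set"
  Hom :: "'o \<Rightarrow> 'o \<Rightarrow> 'a set"
  Ide :: "'o \<Rightarrow> 'a"
  Comp :: "'o \<Rightarrow> 'o \<Rightarrow> 'o \<Rightarrow> 'a \<Rightarrow> 'a \<Rightarrow> 'a"

definition category :: "('o, 'a) cat \<Rightarrow> bool" where
  "category C \<longleftrightarrow>
     (\<forall>x\<in>Ob C. Ide C x \<in> Hom C x x) \<and>
     (\<forall>x\<in>Ob C. \<forall>y\<in>Ob C. \<forall>z\<in>Ob C. \<forall>f\<in>Hom C x y. \<forall>g\<in>Hom C y z.
        Comp C x y z g f \<in> Hom C x z) \<and>
     (\<forall>x\<in>Ob C. \<forall>y\<in>Ob C. \<forall>f\<in>Hom C x y.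
        Comp C x x y f (Ide C x) = f \<and> Comp C x y y (Ide C y) f = f) \<and>
     (\<forall>w\<in>Ob C. \<forall>x\<in>Ob C. \<forall>y\<in>Ob C. \<forall>z\<in>Ob C.
        \<forall>f\<in>Hom C w x. \<forall>g\<in>Hom C x y. \<forall>h\<in>Hom C y z.
          Comp C w x z (Comp C x y z h g) f = Comp C w y z h (Comp C w x y g f))"

definition is_iso :: "('o, 'a) cat \<Rightarrow> 'o \<Rightarrow> 'o \<Rightarrow> 'a \<Rightarrow> bool" where
  "is_iso C x y f \<longleftrightarrow> f \<in> Hom C x y \<and>
     (\<exists>g\<in>Hom C y x. Comp C x y x g f = Ide C x \<and> Comp C y x y f g = Ide C y)"

definition isomorphic :: "('o, 'a) cat \<Rightarrow> 'o \<Rightarrow> 'o \<Rightarrow> bool" where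
  "isomorphic C x y \<longleftrightarrow> x \<in> Ob C \<and> y \<in> Ob C \<and> (\<exists>f. is_iso C x y f)"

text \<open>\<open>is_pullback C w x y z u v f g\<close>: the square \<open>f \<circ> u = g \<circ> v\<close> with
  \<open>u : w \<rightarrow> x\<close>, \<open>v : w \<rightarrow> y\<close>, \<open>f : x \<rightarrow> z\<close>, \<open>g : y \<rightarrow> z\<close> is a pullback.\<close>

definition is_pullback ::
  "('o, 'a) cat \<Rightarrow> 'o \<Rightarrow> 'o \<Rightarrow> 'o \<Rightarrow> 'o \<Rightarrow> 'a \<Rightarrow> 'a \<Rightarrow> 'a \<Rightarrow> 'a \<Rightarrow> bool" where
  "is_pullback C w x y z u v f g \<longleftrightarrow>
     w \<in> Ob C \<and> x \<in> Ob C \<and> y \<in> Ob C \<and> z \<in> Ob C \<and>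
     u \<in> Hom C w x \<and> v \<in> Hom C w y \<and> f \<in> Hom C x z \<and> g \<in> Hom C y z \<and>
     Comp C w x z f u = Comp C w y z g v \<and>
     (\<forall>t\<in>Ob C. \<forall>h\<in>Hom C t x. \<forall>k\<in>Hom C t y. Comp C t x z f h = Comp C t y z g k \<longrightarrow>
        (\<exists>!m. m \<in> Hom C t w \<and> Comp C t w x u m = h \<and> Comp C t w y v m = k))"

record ('o, 'p, 'a, 'b) funct =
  FOb :: "'o \<Rightarrow> 'p"
  FMap :: "'o \<Rightarrow> 'o \<Rightarrow> 'a \<Rightarrow> 'b"

definition mk_functor ::
  "('o, 'a) cat \<Rightarrow> ('o \<Rightarrow> 'p) \<Rightarrow> ('o \<Rightarrow> 'o \<Rightarrow> 'a \<Rightarrow> 'b) \<Rightarrow> ('o, 'p, 'a, 'b) funct" where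
  "mk_functor C F0 F1 =
     \<lparr>FOb = (\<lambda>x\<in>Ob C. F0 x),
      FMap = (\<lambda>x y f. if x \<in> Ob C \<and> y \<in> Ob C \<and> f \<in> Hom C x y then F1 x y f else undefined)\<rparr>"

definition is_functor ::
  "('o, 'a) cat \<Rightarrow> ('p, 'b) cat \<Rightarrow> ('o, 'p, 'a, 'b) funct \<Rightarrow> bool" where
  "is_functor C D F \<longleftrightarrow> category C \<and> category D \<and> F = mk_functor C (FOb F) (FMap F) \<and>
     (\<forall>x\<in>Ob C. FOb F x \<in> Ob D) \<and>
     (\<forall>x\<in>Ob C. \<forall>y\<in>Ob C. \<forall>f\<in>Hom C x y. FMap F x y f \<in> Hom D (FOb F x) (FOb F y)) \<and>
     (\<forall>x\<in>Ob C. FMap F x x (Ide C x) = Ide D (FOb F x)) \<and>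
     (\<forall>x\<in>Ob C. \<forall>y\<in>Ob C. \<forall>z\<in>Ob C. \<forall>f\<in>Hom C x y. \<forall>g\<in>Hom C y z.
        FMap F x z (Comp C x y z g f)
          = Comp D (FOb F x) (FOb F y) (FOb F z) (FMap F y z g) (FMap F x y f))"

definition id_fun :: "('o, 'a) cat \<Rightarrow> ('o, 'o, 'a, 'a) funct" where
  "id_fun C = mk_functor C (\<lambda>x. x) (\<lambda>x y f. f)"

text \<open>\<open>comp_fun C G F\<close> is \<open>G \<circ> F\<close>, where \<open>C\<close> is the domain of \<open>F\<close>.\<close>

definition comp_fun ::
  "('o, 'a) cat \<Rightarrow> ('p, 'q, 'b, 'c) funct \<Rightarrow> ('o, 'p, 'a, 'b) funct \<Rightarrow> ('o, 'q, 'a, 'c) funct" where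
  "comp_fun C G F = mk_functor C (\<lambda>x. FOb G (FOb F x))
     (\<lambda>x y f. FMap G (FOb F x) (FOb F y) (FMap F x y f))"

definition nat_trans ::
  "('o, 'a) cat \<Rightarrow> ('p, 'b) cat \<Rightarrow> ('o, 'p, 'a, 'b) funct \<Rightarrow> ('o, 'p, 'a, 'b) funct \<Rightarrow> ('o \<Rightarrow> 'b) set"
  where
  "nat_trans C D F G = {\<alpha> \<in> extensional (Ob C).
     (\<forall>x\<in>Ob C. \<alpha> x \<in> Hom D (FOb F x) (FOb G x)) \<and>
     (\<forall>x\<in>Ob C. \<forall>y\<in>Ob C. \<forall>f\<in>Hom C x y.
        Comp D (FOb F x) (FOb F y) (FOb G y) (\<alpha> y) (FMap F x y f)
          = Comp D (FOb F x) (FOb G x) (FOb G y) (FMap G x y f) (\<alpha> x))}"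

definition fun_cat ::
  "('o, 'a) cat \<Rightarrow> ('p, 'b) cat \<Rightarrow> (('o, 'p, 'a, 'b) funct, 'o \<Rightarrow> 'b) cat" where
  "fun_cat C D =
     \<lparr>Ob = {F. is_functor C D F},
      Hom = nat_trans C D,
      Ide = (\<lambda>F. \<lambda>x\<in>Ob C. Ide D (FOb F x)),
      Comp = (\<lambda>F G H \<beta> \<alpha>. \<lambda>x\<in>Ob C. Comp D (FOb F x) (FOb G x) (FOb H x) (\<beta> x) (\<alpha> x))\<rparr>"

text \<open>Horizontal composition of \<open>\<alpha> : F \<rightarrow> F' : C \<rightarrow> D\<close> and \<open>\<beta> : G \<rightarrow> G' : D \<rightarrow> E\<close>, with components
  \<open>\<beta>\<^bsub>F' x\<^esub> \<circ> G \<alpha>\<^sub>x\<close>.\<close>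

definition hcomp ::
  "('o, 'a) cat \<Rightarrow> ('q, 'c) cat \<Rightarrow> ('p, 'q, 'b, 'c) funct \<Rightarrow> ('p, 'q, 'b, 'c) funct \<Rightarrow>
   ('o, 'p, 'a, 'b) funct \<Rightarrow> ('o, 'p, 'a, 'b) funct \<Rightarrow> ('p \<Rightarrow> 'c) \<Rightarrow> ('o \<Rightarrow> 'b) \<Rightarrow> ('o \<Rightarrow> 'c)" where
  "hcomp C E G G' F F' \<beta> \<alpha> = (\<lambda>x\<in>Ob C.
     Comp E (FOb G (FOb F x)) (FOb G (FOb F' x)) (FOb G' (FOb F' x))
       (\<beta> (FOb F' x)) (FMap G (FOb F x) (FOb F' x) (\<alpha> x)))"

definition op_cat :: "('o, 'a) cat \<Rightarrow> ('o, 'a) cat" where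
  "op_cat C = \<lparr>Ob = Ob C, Hom = (\<lambda>x y. Hom C y x), Ide = Ide C,
     Comp = (\<lambda>x y z g f. Comp C z y x f g)\<rparr>"

definition op_fun :: "('o, 'p, 'a, 'b) funct \<Rightarrow> ('o, 'p, 'a, 'b) funct" where
  "op_fun F = \<lparr>FOb = FOb F, FMap = (\<lambda>x y. FMap F y x)\<rparr>"

definition prod_cat :: "('o, 'a) cat \<Rightarrow> ('p, 'b) cat \<Rightarrow> ('o \<times> 'p, 'a \<times> 'b) cat" where
  "prod_cat C D =
     \<lparr>Ob = Ob C \<times> Ob D,
      Hom = (\<lambda>(x, x') (y, y'). Hom C x y \<times> Hom D x' y'),
      Ide = (\<lambda>(x, x'). (Ide C x, Ide D x')),
      Comp = (\<lambda>(x, x') (y, y') (z, z') (g, g') (f, f'). (Comp C x y z g f, Comp D x' y' z' g' f'))\<rparr>"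

definition is_equivalence ::
  "('o, 'a) cat \<Rightarrow> ('p, 'b) cat \<Rightarrow> ('o, 'p, 'a, 'b) funct \<Rightarrow> bool" where
  "is_equivalence C D F \<longleftrightarrow> is_functor C D F \<and>
     (\<exists>G. is_functor D C G \<and>
        isomorphic (fun_cat C C) (id_fun C) (comp_fun C G F) \<and>
        isomorphic (fun_cat D D) (comp_fun D F G) (id_fun D))"

definition equivalent_cats :: "('o, 'a) cat \<Rightarrow> ('p, 'b) cat \<Rightarrow> bool" where
  "equivalent_cats C D \<longleftrightarrow> (\<exists>F. is_equivalence C D F)"


section \<open>Strict 2-categories\<close>

record ('x, 'm, 'c) cat2 =
  Ob2 :: "'x set"
  Hom2 :: "'x \<Rightarrow> 'x \<Rightarrow> ('m, 'c) cat"
  Id1 :: "'x \<Rightarrow> 'm"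
  Comp2 :: "'x \<Rightarrow> 'x \<Rightarrow> 'x \<Rightarrow> ('m \<times> 'm, 'm, 'c \<times> 'c, 'c) funct"

abbreviation comp1 :: "('x, 'm, 'c) cat2 \<Rightarrow> 'x \<Rightarrow> 'x \<Rightarrow> 'x \<Rightarrow> 'm \<Rightarrow> 'm \<Rightarrow> 'm" where
  "comp1 K x y z g f \<equiv> FOb (Comp2 K x y z) (g, f)"

text \<open>\<open>comp2 K x y z g g' f f' \<beta> \<alpha>\<close> is the horizontal composite \<open>g \<circ> f \<rightarrow> g' \<circ> f'\<close> of
  \<open>\<alpha> : f \<rightarrow> f' : x \<rightarrow> y\<close> and \<open>\<beta> : g \<rightarrow> g' : y \<rightarrow> z\<close>.\<close>

abbreviation comp2 ::
  "('x, 'm, 'c) cat2 \<Rightarrow> 'x \<Rightarrow> 'x \<Rightarrow> 'x \<Rightarrow> 'm \<Rightarrow> 'm \<Rightarrow> 'm \<Rightarrow> 'm \<Rightarrow> 'c \<Rightarrow> 'c \<Rightarrow> 'c" where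
  "comp2 K x y z g g' f f' \<beta> \<alpha> \<equiv> FMap (Comp2 K x y z) (g, f) (g', f') (\<beta>, \<alpha>)"

definition two_category :: "('x, 'm, 'c) cat2 \<Rightarrow> bool" where
  "two_category K \<longleftrightarrow>
     (\<forall>x\<in>Ob2 K. \<forall>y\<in>Ob2 K. category (Hom2 K x y)) \<and>
     (\<forall>x\<in>Ob2 K. Id1 K x \<in> Ob (Hom2 K x x)) \<and>
     (\<forall>x\<in>Ob2 K. \<forall>y\<in>Ob2 K. \<forall>z\<in>Ob2 K.
        is_functor (prod_cat (Hom2 K y z) (Hom2 K x y)) (Hom2 K x z) (Comp2 K x y z)) \<and>
     (\<forall>x\<in>Ob2 K. \<forall>y\<in>Ob2 K. \<forall>f\<in>Ob (Hom2 K x y).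
        comp1 K x x y f (Id1 K x) = f \<and> comp1 K x y y (Id1 K y) f = f) \<and>
     (\<forall>x\<in>Ob2 K. \<forall>y\<in>Ob2 K. \<forall>f\<in>Ob (Hom2 K x y). \<forall>f'\<in>Ob (Hom2 K x y).
        \<forall>\<alpha>\<in>Hom (Hom2 K x y) f f'.
          comp2 K x x y f f' (Id1 K x) (Id1 K x) \<alpha> (Ide (Hom2 K x x) (Id1 K x)) = \<alpha> \<and>
          comp2 K x y y (Id1 K y) (Id1 K y) f f' (Ide (Hom2 K y y) (Id1 K y)) \<alpha> = \<alpha>) \<and>
     (\<forall>w\<in>Ob2 K. \<forall>x\<in>Ob2 K. \<forall>y\<in>Ob2 K. \<forall>z\<in>Ob2 K.
        \<forall>f\<in>Ob (Hom2 K w x). \<forall>g\<in>Ob (Hom2 K x y). \<forall>h\<in>Ob (Hom2 K y z).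
          comp1 K w x z (comp1 K x y z h g) f = comp1 K w y z h (comp1 K w x y g f)) \<and>
     (\<forall>w\<in>Ob2 K. \<forall>x\<in>Ob2 K. \<forall>y\<in>Ob2 K. \<forall>z\<in>Ob2 K.
        \<forall>f\<in>Ob (Hom2 K w x). \<forall>f'\<in>Ob (Hom2 K w x). \<forall>g\<in>Ob (Hom2 K x y). \<forall>g'\<in>Ob (Hom2 K x y).
        \<forall>h\<in>Ob (Hom2 K y z). \<forall>h'\<in>Ob (Hom2 K y z).
        \<forall>\<alpha>\<in>Hom (Hom2 K w x) f f'. \<forall>\<beta>\<in>Hom (Hom2 K x y) g g'. \<forall>\<gamma>\<in>Hom (Hom2 K y z) h h'.
          comp2 K w x z (comp1 K x y z h g) (comp1 K x y z h' g') f f'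
              (comp2 K x y z h h' g g' \<gamma> \<beta>) \<alpha>
            = comp2 K w y z h h' (comp1 K w x y g f) (comp1 K w x y g' f')
                \<gamma> (comp2 K w x y g g' f f' \<beta> \<alpha>))"

definition internally_equivalent :: "('x, 'm, 'c) cat2 \<Rightarrow> 'x \<Rightarrow> 'x \<Rightarrow> bool" where
  "internally_equivalent K x y \<longleftrightarrow> x \<in> Ob2 K \<and> y \<in> Ob2 K \<and>
     (\<exists>f\<in>Ob (Hom2 K x y). \<exists>g\<in>Ob (Hom2 K y x).
        isomorphic (Hom2 K x x) (Id1 K x) (comp1 K x y x g f) \<and>
        isomorphic (Hom2 K y y) (comp1 K y x y f g) (Id1 K y))"

record ('x, 'y, 'm, 'n, 'c, 'd) funct2 =
  F2Ob :: "'x \<Rightarrow> 'y"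
  F2Hom :: "'x \<Rightarrow> 'x \<Rightarrow> ('m, 'n, 'c, 'd) funct"

definition is_2functor ::
  "('x, 'm, 'c) cat2 \<Rightarrow> ('y, 'n, 'd) cat2 \<Rightarrow> ('x, 'y, 'm, 'n, 'c, 'd) funct2 \<Rightarrow> bool" where
  "is_2functor K L F \<longleftrightarrow> two_category K \<and> two_category L \<and>
     (\<forall>x\<in>Ob2 K. F2Ob F x \<in> Ob2 L) \<and>
     (\<forall>x\<in>Ob2 K. \<forall>y\<in>Ob2 K.
        is_functor (Hom2 K x y) (Hom2 L (F2Ob F x) (F2Ob F y)) (F2Hom F x y)) \<and>
     (\<forall>x\<in>Ob2 K. FOb (F2Hom F x x) (Id1 K x) = Id1 L (F2Ob F x)) \<and>
     (\<forall>x\<in>Ob2 K. \<forall>y\<in>Ob2 K. \<forall>z\<in>Ob2 K. \<forall>f\<in>Ob (Hom2 K x y). \<forall>g\<in>Ob (Hom2 K y z).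
        FOb (F2Hom F x z) (comp1 K x y z g f)
          = comp1 L (F2Ob F x) (F2Ob F y) (F2Ob F z)
              (FOb (F2Hom F y z) g) (FOb (F2Hom F x y) f)) \<and>
     (\<forall>x\<in>Ob2 K. \<forall>y\<in>Ob2 K. \<forall>z\<in>Ob2 K.
        \<forall>f\<in>Ob (Hom2 K x y). \<forall>f'\<in>Ob (Hom2 K x y). \<forall>g\<in>Ob (Hom2 K y z). \<forall>g'\<in>Ob (Hom2 K y z).
        \<forall>\<alpha>\<in>Hom (Hom2 K x y) f f'. \<forall>\<beta>\<in>Hom (Hom2 K y z) g g'.
          FMap (F2Hom F x z) (comp1 K x y z g f) (comp1 K x y z g' f')
              (comp2 K x y z g g' f f' \<beta> \<alpha>)
            = comp2 L (F2Ob F x) (F2Ob F y) (F2Ob F z)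
                (FOb (F2Hom F y z) g) (FOb (F2Hom F y z) g')
                (FOb (F2Hom F x y) f) (FOb (F2Hom F x y) f')
                (FMap (F2Hom F y z) g g' \<beta>) (FMap (F2Hom F x y) f f' \<alpha>))"

definition is_2equivalence ::
  "('x, 'm, 'c) cat2 \<Rightarrow> ('y, 'n, 'd) cat2 \<Rightarrow> ('x, 'y, 'm, 'n, 'c, 'd) funct2 \<Rightarrow> bool" where
  "is_2equivalence K L F \<longleftrightarrow> is_2functor K L F \<and>
     (\<forall>x\<in>Ob2 K. \<forall>y\<in>Ob2 K.
        is_equivalence (Hom2 K x y) (Hom2 L (F2Ob F x) (F2Ob F y)) (F2Hom F x y)) \<and>
     (\<forall>y\<in>Ob2 L. \<exists>x\<in>Ob2 K. internally_equivalent L (F2Ob F x) y)"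

definition equivalent_2cats :: "('x, 'm, 'c) cat2 \<Rightarrow> ('y, 'n, 'd) cat2 \<Rightarrow> bool" where
  "equivalent_2cats K L \<longleftrightarrow> (\<exists>F. is_2equivalence K L F)"


section \<open>Presheaves\<close>

text \<open>
  A type \<open>'u\<close> plays the role of the universe: a small set is a set of elements of \<open>'u\<close>, and a small
  category has its objects and arrows in \<open>'u\<close>. If \<open>'u\<close> is infinite, small sets are closed under
  binary products and dependent sums, up to bijection. Restriction of \<open>x \<in> P \<Gamma>\<close> along \<open>f : \<Delta> \<rightarrow> \<Gamma>\<close> is
  \<open>FMap P \<Gamma> \<Delta> f x\<close>.
\<close>

definition set_cat :: "('u set, 'u \<Rightarrow> 'u) cat" where
  "set_cat = \<lparr>Ob = UNIV, Hom = (\<lambda>A B. A \<rightarrow>\<^sub>E B), Ide = (\<lambda>A. \<lambda>x\<in>A. x),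
     Comp = (\<lambda>A B D g f. compose A g f)\<rparr>"

type_synonym ('o, 'a, 'u) presheaf = "('o, 'u set, 'a, 'u \<Rightarrow> 'u) funct"

definition psh :: "('o, 'a) cat \<Rightarrow> (('o, 'a, 'u) presheaf, 'o \<Rightarrow> 'u \<Rightarrow> 'u) cat" where
  "psh C = fun_cat (op_cat C) set_cat"

definition yoneda :: "('o, 'u) cat \<Rightarrow> 'o \<Rightarrow> ('o, 'u, 'u) presheaf" where
  "yoneda C \<Gamma> = mk_functor (op_cat C) (\<lambda>\<Delta>. Hom C \<Delta> \<Gamma>)
     (\<lambda>\<Delta> \<Delta>' f. \<lambda>g\<in>Hom C \<Delta> \<Gamma>. Comp C \<Delta>' \<Delta> \<Gamma> g f)"

definition yoneda_map :: "('o, 'u) cat \<Rightarrow> 'o \<Rightarrow> 'o \<Rightarrow> 'u \<Rightarrow> 'o \<Rightarrow> 'u \<Rightarrow> 'u" where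
  "yoneda_map C \<Gamma>' \<Gamma> f = (\<lambda>\<Delta>\<in>Ob C. \<lambda>g\<in>Hom C \<Delta> \<Gamma>'. Comp C \<Delta> \<Gamma>' \<Gamma> f g)"

text \<open>The map \<open>y\<Gamma> \<rightarrow> P\<close> corresponding to \<open>x \<in> P \<Gamma>\<close> under the Yoneda lemma.\<close>

definition yoneda_elem ::
  "('o, 'u) cat \<Rightarrow> ('o, 'u, 'u) presheaf \<Rightarrow> 'o \<Rightarrow> 'u \<Rightarrow> 'o \<Rightarrow> 'u \<Rightarrow> 'u" where
  "yoneda_elem C P \<Gamma> x = (\<lambda>\<Delta>\<in>Ob C. \<lambda>g\<in>Hom C \<Delta> \<Gamma>. FMap P \<Gamma> \<Delta> g x)"

text \<open>\<open>F\<^sup>*P = P \<circ> F\<^sup>o\<^sup>p\<close> and its action on maps of presheaves, for a functor \<open>F\<close> with domain \<open>C\<close>.\<close>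

definition pull_psh ::
  "('o, 'a) cat \<Rightarrow> ('o, 'p, 'a, 'b) funct \<Rightarrow> ('p, 'b, 'u) presheaf \<Rightarrow> ('o, 'a, 'u) presheaf" where
  "pull_psh C F P = comp_fun (op_cat C) P (op_fun F)"

definition pull_psh_map ::
  "('o, 'a) cat \<Rightarrow> ('o, 'p, 'a, 'b) funct \<Rightarrow> ('p \<Rightarrow> 'u \<Rightarrow> 'u) \<Rightarrow> 'o \<Rightarrow> 'u \<Rightarrow> 'u" where
  "pull_psh_map C F \<tau> = (\<lambda>\<Gamma>\<in>Ob C. \<tau> (FOb F \<Gamma>))"

text \<open>The category of elements \<open>\<integral>\<^sub>C P\<close>.\<close>

definition elements :: "('o, 'a) cat \<Rightarrow> ('o, 'a, 'u) presheaf \<Rightarrow> ('o \<times> 'u, 'a) cat" where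
  "elements C P =
     \<lparr>Ob = (SIGMA \<Gamma>:Ob C. FOb P \<Gamma>),
      Hom = (\<lambda>(\<Delta>, B) (\<Gamma>, A). {f \<in> Hom C \<Delta> \<Gamma>. FMap P \<Gamma> \<Delta> f A = B}),
      Ide = (\<lambda>(\<Gamma>, A). Ide C \<Gamma>),
      Comp = (\<lambda>(\<Theta>, _) (\<Delta>, _) (\<Gamma>, _) g f. Comp C \<Theta> \<Delta> \<Gamma> g f)\<rparr>"

text \<open>The functor \<open>\<integral>\<^sub>C P \<rightarrow> \<integral>\<^sub>D P'\<close> induced by \<open>F : C \<rightarrow> D\<close> and \<open>\<phi> : P \<rightarrow> F\<^sup>*P'\<close>.\<close>

definition elements_fun ::
  "('o, 'a) cat \<Rightarrow> ('o, 'a, 'u) presheaf \<Rightarrow> ('o, 'p, 'a, 'b) funct \<Rightarrow> ('o \<Rightarrow> 'u \<Rightarrow> 'u) \<Rightarrow>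
   ('o \<times> 'u, 'p \<times> 'u, 'a, 'b) funct" where
  "elements_fun C P F \<phi> = mk_functor (elements C P)
     (\<lambda>(\<Gamma>, A). (FOb F \<Gamma>, \<phi> \<Gamma> A)) (\<lambda>(\<Delta>, B) (\<Gamma>, A) f. FMap F \<Delta> \<Gamma> f)"


section \<open>Natural models\<close>

record 'u natmod =
  nm_cat :: "('u, 'u) cat"
  nm_Ty :: "('u, 'u, 'u) presheaf"
  nm_Tm :: "('u, 'u, 'u) presheaf"
  nm_p :: "'u \<Rightarrow> 'u \<Rightarrow> 'u"

definition representable_map ::
  "('u, 'u) cat \<Rightarrow> ('u, 'u, 'u) presheaf \<Rightarrow> ('u, 'u, 'u) presheaf \<Rightarrow> ('u \<Rightarrow> 'u \<Rightarrow> 'u) \<Rightarrow> bool" where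
  "representable_map C Tm Ty p \<longleftrightarrow> p \<in> Hom (psh C) Tm Ty \<and>
     (\<forall>\<Gamma>\<in>Ob C. \<forall>A\<in>Hom (psh C) (yoneda C \<Gamma>) Ty.
        \<exists>E\<in>Ob C. \<exists>u v. is_pullback (psh C) (yoneda C E) (yoneda C \<Gamma>) Tm Ty u v A p)"

definition natural_model :: "('u, 'z) natmod_scheme \<Rightarrow> bool" where
  "natural_model M \<longleftrightarrow> category (nm_cat M) \<and>
     nm_Ty M \<in> Ob (psh (nm_cat M)) \<and> nm_Tm M \<in> Ob (psh (nm_cat M)) \<and>
     representable_map (nm_cat M) (nm_Tm M) (nm_Ty M) (nm_p M)"

text \<open>\<open>\<pi> : E \<rightarrow> \<Gamma>\<close> and \<open>q \<in> Tm(E)\<close> exhibit \<open>E\<close> as the pullback of \<open>A : y\<Gamma> \<rightarrow> Ty\<close> along \<open>p\<close>.\<close>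

definition representing_pullback ::
  "('u, 'z) natmod_scheme \<Rightarrow> 'u \<Rightarrow> 'u \<Rightarrow> 'u \<Rightarrow> 'u \<Rightarrow> 'u \<Rightarrow> bool" where
  "representing_pullback M \<Gamma> A E \<pi> q \<longleftrightarrow>
     \<Gamma> \<in> Ob (nm_cat M) \<and> A \<in> FOb (nm_Ty M) \<Gamma> \<and>
     E \<in> Ob (nm_cat M) \<and> \<pi> \<in> Hom (nm_cat M) E \<Gamma> \<and> q \<in> FOb (nm_Tm M) E \<and>
     is_pullback (psh (nm_cat M)) (yoneda (nm_cat M) E) (yoneda (nm_cat M) \<Gamma>) (nm_Tm M) (nm_Ty M)
       (yoneda_map (nm_cat M) E \<Gamma> \<pi>) (yoneda_elem (nm_cat M) (nm_Tm M) E q)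
       (yoneda_elem (nm_cat M) (nm_Ty M) \<Gamma> A) (nm_p M)"

record 'u snatmod = "'u natmod" +
  nm_ctx :: "'u \<Rightarrow> 'u \<Rightarrow> 'u"
  nm_pr :: "'u \<Rightarrow> 'u \<Rightarrow> 'u"
  nm_var :: "'u \<Rightarrow> 'u \<Rightarrow> 'u"

definition structured_natural_model :: "'u snatmod \<Rightarrow> bool" where
  "structured_natural_model M \<longleftrightarrow> natural_model M \<and>
     (\<forall>\<Gamma>\<in>Ob (nm_cat M). \<forall>A\<in>FOb (nm_Ty M) \<Gamma>.
        representing_pullback M \<Gamma> A (nm_ctx M \<Gamma> A) (nm_pr M \<Gamma> A) (nm_var M \<Gamma> A))"

record 'u nm_map =
  nmm_fun :: "('u, 'u, 'u, 'u) funct"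
  nmm_Ty :: "'u \<Rightarrow> 'u \<Rightarrow> 'u"
  nmm_Tm :: "'u \<Rightarrow> 'u \<Rightarrow> 'u"

definition pseudo_maps ::
  "('u, 'z) natmod_scheme \<Rightarrow> ('u, 'z) natmod_scheme \<Rightarrow> 'u nm_map set" where
  "pseudo_maps M N = {h.
     let C = nm_cat M; F = nmm_fun h; Ty' = pull_psh C F (nm_Ty N); Tm' = pull_psh C F (nm_Tm N) in
     is_functor C (nm_cat N) F \<and>
     nmm_Ty h \<in> Hom (psh C) (nm_Ty M) Ty' \<and>
     nmm_Tm h \<in> Hom (psh C) (nm_Tm M) Tm' \<and>
     Comp (psh C) (nm_Tm M) Tm' Ty' (pull_psh_map C F (nm_p N)) (nmm_Tm h)
       = Comp (psh C) (nm_Tm M) (nm_Ty M) Ty' (nmm_Ty h) (nm_p M) \<and>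
     (\<forall>\<Gamma> A E \<pi> q. representing_pullback M \<Gamma> A E \<pi> q \<longrightarrow>
        representing_pullback N (FOb F \<Gamma>) (nmm_Ty h \<Gamma> A) (FOb F E) (FMap F E \<Gamma> \<pi>) (nmm_Tm h E q))}"

definition strict_nm_maps :: "'u snatmod \<Rightarrow> 'u snatmod \<Rightarrow> 'u nm_map set" where
  "strict_nm_maps M N = {h \<in> pseudo_maps M N.
     let F = nmm_fun h in
     \<forall>\<Gamma>\<in>Ob (nm_cat M). \<forall>A\<in>FOb (nm_Ty M) \<Gamma>.
       FOb F (nm_ctx M \<Gamma> A) = nm_ctx N (FOb F \<Gamma>) (nmm_Ty h \<Gamma> A) \<and>
       FMap F (nm_ctx M \<Gamma> A) \<Gamma> (nm_pr M \<Gamma> A) = nm_pr N (FOb F \<Gamma>) (nmm_Ty h \<Gamma> A) \<and>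
       nmm_Tm h (nm_ctx M \<Gamma> A) (nm_var M \<Gamma> A) = nm_var N (FOb F \<Gamma>) (nmm_Ty h \<Gamma> A)}"

definition nm_id :: "('u, 'z) natmod_scheme \<Rightarrow> 'u nm_map" where
  "nm_id M = \<lparr>nmm_fun = id_fun (nm_cat M),
     nmm_Ty = Ide (psh (nm_cat M)) (nm_Ty M),
     nmm_Tm = Ide (psh (nm_cat M)) (nm_Tm M)\<rparr>"

definition nm_comp :: "('u, 'z) natmod_scheme \<Rightarrow> 'u nm_map \<Rightarrow> 'u nm_map \<Rightarrow> 'u nm_map" where
  "nm_comp M k h = \<lparr>nmm_fun = comp_fun (nm_cat M) (nmm_fun k) (nmm_fun h),
     nmm_Ty = (\<lambda>\<Gamma>\<in>Ob (nm_cat M).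
       compose (FOb (nm_Ty M) \<Gamma>) (nmm_Ty k (FOb (nmm_fun h) \<Gamma>)) (nmm_Ty h \<Gamma>)),
     nmm_Tm = (\<lambda>\<Gamma>\<in>Ob (nm_cat M).
       compose (FOb (nm_Tm M) \<Gamma>) (nmm_Tm k (FOb (nmm_fun h) \<Gamma>)) (nmm_Tm h \<Gamma>))\<rparr>"

definition nm_transformations ::
  "('u, 'z) natmod_scheme \<Rightarrow> ('u, 'z) natmod_scheme \<Rightarrow> 'u nm_map \<Rightarrow> 'u nm_map \<Rightarrow> ('u \<Rightarrow> 'u) set" where
  "nm_transformations M N h k =
     {\<alpha> \<in> nat_trans (nm_cat M) (nm_cat N) (nmm_fun h) (nmm_fun k).
        \<forall>\<Gamma>\<in>Ob (nm_cat M).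
          (\<forall>A\<in>FOb (nm_Ty M) \<Gamma>.
             FMap (nm_Ty N) (FOb (nmm_fun k) \<Gamma>) (FOb (nmm_fun h) \<Gamma>) (\<alpha> \<Gamma>) (nmm_Ty k \<Gamma> A)
               = nmm_Ty h \<Gamma> A) \<and>
          (\<forall>a\<in>FOb (nm_Tm M) \<Gamma>.
             FMap (nm_Tm N) (FOb (nmm_fun k) \<Gamma>) (FOb (nmm_fun h) \<Gamma>) (\<alpha> \<Gamma>) (nmm_Tm k \<Gamma> a)
               = nmm_Tm h \<Gamma> a)}"

definition nm_hom_cat :: "'u natmod \<Rightarrow> 'u natmod \<Rightarrow> ('u nm_map, 'u \<Rightarrow> 'u) cat" where
  "nm_hom_cat M N =
     \<lparr>Ob = pseudo_maps M N,
      Hom = nm_transformations M N,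
      Ide = (\<lambda>h. Ide (fun_cat (nm_cat M) (nm_cat N)) (nmm_fun h)),
      Comp = (\<lambda>h k l \<beta> \<alpha>.
        Comp (fun_cat (nm_cat M) (nm_cat N)) (nmm_fun h) (nmm_fun k) (nmm_fun l) \<beta> \<alpha>)\<rparr>"

definition NatMod_str1 :: "('u snatmod, 'u nm_map) cat" where
  "NatMod_str1 = \<lparr>Ob = {M. structured_natural_model M}, Hom = strict_nm_maps, Ide = nm_id,
     Comp = (\<lambda>M N L k h. nm_comp M k h)\<rparr>"

definition NatMod_ps :: "('u natmod, 'u nm_map, 'u \<Rightarrow> 'u) cat2" where
  "NatMod_ps = \<lparr>Ob2 = {M. natural_model M}, Hom2 = nm_hom_cat, Id1 = nm_id,
     Comp2 = (\<lambda>M N L. mk_functor (prod_cat (nm_hom_cat N L) (nm_hom_cat M N))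
       (\<lambda>(k, h). nm_comp M k h)
       (\<lambda>(k, h) (k', h') (\<beta>, \<alpha>). hcomp (nm_cat M) (nm_cat L)
          (nmm_fun k) (nmm_fun k') (nmm_fun h) (nmm_fun h') \<beta> \<alpha>))\<rparr>"


section \<open>Categories with families\<close>

record 'u cwf =
  cwf_cat :: "('u, 'u) cat"
  cwf_Ty :: "('u, 'u, 'u) presheaf"
  cwf_Tm :: "('u \<times> 'u, 'u, 'u) presheaf"
  cwf_ctx :: "'u \<Rightarrow> 'u \<Rightarrow> 'u"
  cwf_pr :: "'u \<Rightarrow> 'u \<Rightarrow> 'u"
  cwf_var :: "'u \<Rightarrow> 'u \<Rightarrow> 'u"

text \<open>The universal property of a context extension \<open>E\<close> of \<open>\<Gamma>\<close> by \<open>A\<close>, with projection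
  \<open>\<pi> : E \<rightarrow> \<Gamma>\<close> and generic term \<open>q \<in> Tm(E, \<pi>\<^sup>*A)\<close>. When \<open>\<pi> \<circ> g = f\<close>, the arrow \<open>g\<close> is an
  arrow \<open>(\<Delta>, f\<^sup>*A) \<rightarrow> (E, \<pi>\<^sup>*A)\<close> of \<open>\<integral>\<^sub>C Ty\<close>, so that \<open>g\<^sup>*q\<close> makes sense.\<close>

definition context_extension :: "'u cwf \<Rightarrow> 'u \<Rightarrow> 'u \<Rightarrow> 'u \<Rightarrow> 'u \<Rightarrow> 'u \<Rightarrow> bool" where
  "context_extension W \<Gamma> A E \<pi> q \<longleftrightarrow>
     (let C = cwf_cat W; Ty = cwf_Ty W; Tm = cwf_Tm W in
      \<Gamma> \<in> Ob C \<and> A \<in> FOb Ty \<Gamma> \<and> E \<in> Ob C \<and> \<pi> \<in> Hom C E \<Gamma> \<and> q \<in> FOb Tm (E, FMap Ty \<Gamma> E \<pi> A) \<and>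
      (\<forall>\<Delta>\<in>Ob C. \<forall>f\<in>Hom C \<Delta> \<Gamma>. \<forall>a\<in>FOb Tm (\<Delta>, FMap Ty \<Gamma> \<Delta> f A).
         \<exists>!g. g \<in> Hom C \<Delta> E \<and> Comp C \<Delta> E \<Gamma> \<pi> g = f \<and>
              FMap Tm (E, FMap Ty \<Gamma> E \<pi> A) (\<Delta>, FMap Ty \<Gamma> \<Delta> f A) g q = a))"

definition is_cwf :: "'u cwf \<Rightarrow> bool" where
  "is_cwf W \<longleftrightarrow> category (cwf_cat W) \<and>
     cwf_Ty W \<in> Ob (psh (cwf_cat W)) \<and>
     cwf_Tm W \<in> Ob (psh (elements (cwf_cat W) (cwf_Ty W))) \<and>
     (\<forall>\<Gamma>\<in>Ob (cwf_cat W). \<forall>A\<in>FOb (cwf_Ty W) \<Gamma>.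
        context_extension W \<Gamma> A (cwf_ctx W \<Gamma> A) (cwf_pr W \<Gamma> A) (cwf_var W \<Gamma> A))"

record 'u cwf_map =
  cwfm_fun :: "('u, 'u, 'u, 'u) funct"
  cwfm_Ty :: "'u \<Rightarrow> 'u \<Rightarrow> 'u"
  cwfm_Tm :: "'u \<times> 'u \<Rightarrow> 'u \<Rightarrow> 'u"

text \<open>The data common to strict and weak maps.\<close>

definition cwf_premaps :: "'u cwf \<Rightarrow> 'u cwf \<Rightarrow> 'u cwf_map set" where
  "cwf_premaps W V = {h.
     let C = cwf_cat W; F = cwfm_fun h; EW = elements C (cwf_Ty W) in
     is_functor C (cwf_cat V) F \<and>
     cwfm_Ty h \<in> Hom (psh C) (cwf_Ty W) (pull_psh C F (cwf_Ty V)) \<and>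
     cwfm_Tm h \<in> Hom (psh EW) (cwf_Tm W)
       (pull_psh EW (elements_fun C (cwf_Ty W) F (cwfm_Ty h)) (cwf_Tm V))}"

definition strict_cwf_maps :: "'u cwf \<Rightarrow> 'u cwf \<Rightarrow> 'u cwf_map set" where
  "strict_cwf_maps W V = {h \<in> cwf_premaps W V.
     let F = cwfm_fun h in
     \<forall>\<Gamma>\<in>Ob (cwf_cat W). \<forall>A\<in>FOb (cwf_Ty W) \<Gamma>.
       let E = cwf_ctx W \<Gamma> A; \<pi> = cwf_pr W \<Gamma> A; q = cwf_var W \<Gamma> A in
       FOb F E = cwf_ctx V (FOb F \<Gamma>) (cwfm_Ty h \<Gamma> A) \<and>
       FMap F E \<Gamma> \<pi> = cwf_pr V (FOb F \<Gamma>) (cwfm_Ty h \<Gamma> A) \<and>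
       cwfm_Tm h (E, FMap (cwf_Ty W) \<Gamma> E \<pi> A) q = cwf_var V (FOb F \<Gamma>) (cwfm_Ty h \<Gamma> A)}"

definition weak_cwf_maps :: "'u cwf \<Rightarrow> 'u cwf \<Rightarrow> 'u cwf_map set" where
  "weak_cwf_maps W V = {h \<in> cwf_premaps W V.
     let F = cwfm_fun h in
     \<forall>\<Gamma>\<in>Ob (cwf_cat W). \<forall>A\<in>FOb (cwf_Ty W) \<Gamma>.
       let E = cwf_ctx W \<Gamma> A; \<pi> = cwf_pr W \<Gamma> A; q = cwf_var W \<Gamma> A in
       context_extension V (FOb F \<Gamma>) (cwfm_Ty h \<Gamma> A) (FOb F E) (FMap F E \<Gamma> \<pi>)
         (cwfm_Tm h (E, FMap (cwf_Ty W) \<Gamma> E \<pi> A) q)}"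

definition cwf_id :: "'u cwf \<Rightarrow> 'u cwf_map" where
  "cwf_id W = \<lparr>cwfm_fun = id_fun (cwf_cat W),
     cwfm_Ty = Ide (psh (cwf_cat W)) (cwf_Ty W),
     cwfm_Tm = Ide (psh (elements (cwf_cat W) (cwf_Ty W))) (cwf_Tm W)\<rparr>"

definition cwf_comp :: "'u cwf \<Rightarrow> 'u cwf_map \<Rightarrow> 'u cwf_map \<Rightarrow> 'u cwf_map" where
  "cwf_comp W k h = \<lparr>cwfm_fun = comp_fun (cwf_cat W) (cwfm_fun k) (cwfm_fun h),
     cwfm_Ty = (\<lambda>\<Gamma>\<in>Ob (cwf_cat W).
       compose (FOb (cwf_Ty W) \<Gamma>) (cwfm_Ty k (FOb (cwfm_fun h) \<Gamma>)) (cwfm_Ty h \<Gamma>)),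
     cwfm_Tm = (\<lambda>(\<Gamma>, A)\<in>Ob (elements (cwf_cat W) (cwf_Ty W)).
       compose (FOb (cwf_Tm W) (\<Gamma>, A))
         (cwfm_Tm k (FOb (cwfm_fun h) \<Gamma>, cwfm_Ty h \<Gamma> A)) (cwfm_Tm h (\<Gamma>, A)))\<rparr>"

definition cwf_transformations ::
  "'u cwf \<Rightarrow> 'u cwf \<Rightarrow> 'u cwf_map \<Rightarrow> 'u cwf_map \<Rightarrow> ('u \<Rightarrow> 'u) set" where
  "cwf_transformations W V h k =
     {\<alpha> \<in> nat_trans (cwf_cat W) (cwf_cat V) (cwfm_fun h) (cwfm_fun k).
        \<forall>\<Gamma>\<in>Ob (cwf_cat W). \<forall>A\<in>FOb (cwf_Ty W) \<Gamma>.
          FMap (cwf_Ty V) (FOb (cwfm_fun k) \<Gamma>) (FOb (cwfm_fun h) \<Gamma>) (\<alpha> \<Gamma>) (cwfm_Ty k \<Gamma> A)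
            = cwfm_Ty h \<Gamma> A \<and>
          (\<forall>a\<in>FOb (cwf_Tm W) (\<Gamma>, A).
             FMap (cwf_Tm V) (FOb (cwfm_fun k) \<Gamma>, cwfm_Ty k \<Gamma> A) (FOb (cwfm_fun h) \<Gamma>, cwfm_Ty h \<Gamma> A)
                 (\<alpha> \<Gamma>) (cwfm_Tm k (\<Gamma>, A) a)
               = cwfm_Tm h (\<Gamma>, A) a)}"

definition cwf_hom_cat :: "'u cwf \<Rightarrow> 'u cwf \<Rightarrow> ('u cwf_map, 'u \<Rightarrow> 'u) cat" where
  "cwf_hom_cat W V =
     \<lparr>Ob = weak_cwf_maps W V,
      Hom = cwf_transformations W V,
      Ide = (\<lambda>h. Ide (fun_cat (cwf_cat W) (cwf_cat V)) (cwfm_fun h)),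
      Comp = (\<lambda>h k l \<beta> \<alpha>.
        Comp (fun_cat (cwf_cat W) (cwf_cat V)) (cwfm_fun h) (cwfm_fun k) (cwfm_fun l) \<beta> \<alpha>)\<rparr>"

definition CwF_str1 :: "('u cwf, 'u cwf_map) cat" where
  "CwF_str1 = \<lparr>Ob = {W. is_cwf W}, Hom = strict_cwf_maps, Ide = cwf_id,
     Comp = (\<lambda>W V U k h. cwf_comp W k h)\<rparr>"

definition CwF_wk :: "('u cwf, 'u cwf_map, 'u \<Rightarrow> 'u) cat2" where
  "CwF_wk = \<lparr>Ob2 = {W. is_cwf W}, Hom2 = cwf_hom_cat, Id1 = cwf_id,
     Comp2 = (\<lambda>W V U. mk_functor (prod_cat (cwf_hom_cat V U) (cwf_hom_cat W V))
       (\<lambda>(k, h). cwf_comp W k h)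
       (\<lambda>(k, h) (k', h') (\<beta>, \<alpha>). hcomp (cwf_cat W) (cwf_cat U)
          (cwfm_fun k) (cwfm_fun k') (cwfm_fun h) (cwfm_fun h') \<beta> \<alpha>))\<rparr>"

end

theory Submission
  imports Defs
begin

text \<open>
  A natural model \<open>p : Tm \<rightarrow> Ty\<close> and a CwF determine each other by taking the fibres \<open>p\<^sup>-\<^sup>1(A)\<close>
  and by forming total spaces of pairs \<open>(A, a)\<close>, which an injection \<open>'u \<times> 'u \<rightarrow> 'u\<close> encodes in the
  universe. By the Yoneda lemma, \<open>(E, \<pi>, q)\<close> represents the pullback of \<open>A\<close> along \<open>p\<close> iff it is a
  context extension for the fibres. Taking fibres is bijective on 1-cells and the identity on 2-cells,
  and every CwF is isomorphic to the CwF of fibres of its total space.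
\<close>

section \<open>Categories and functors\<close>

text \<open>The passage is taken from natural models to CwFs because in that direction it is strict:
  the terms of a natural model already lie in disjoint fibres over the types, so a map of
  \<open>Tm\<close> over a map of \<open>Ty\<close> is exactly a family of maps between fibres, and
  composition is preserved on the nose. In a CwF the sets of terms over distinct types may overlap,
  hence the pairing with the type; this returns to the given CwF only up to isomorphism, which is
  all that surjectivity on objects asks. The two sides also treat extensions differently. A pseudo
  map preserves every representing pullback, while a weak map is tested only on chosen extensions;
  uniqueness of extensions up to isomorphism closes the gap. A natural model merely has representing
  pullbacks, so on the 2-categorical side its CwF receives extensions picked by Hilbert choice, and
  the isomorphism with the original CwF is in general only weak; on the strict side the chosen
  extensions are carried along.\<close>

lemma
  assumes "category C"
  shows category_Ide: "x \<in> Ob C \<Longrightarrow> Ide C x \<in> Hom C x x"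
    and category_Comp: "\<lbrakk>x \<in> Ob C; y \<in> Ob C; z \<in> Ob C; f \<in> Hom C x y; g \<in> Hom C y z\<rbrakk>
      \<Longrightarrow> Comp C x y z g f \<in> Hom C x z"
    and category_Comp_Ide: "\<lbrakk>x \<in> Ob C; y \<in> Ob C; f \<in> Hom C x y\<rbrakk> \<Longrightarrow> Comp C x x y f (Ide C x) = f"
    and category_Ide_Comp: "\<lbrakk>x \<in> Ob C; y \<in> Ob C; f \<in> Hom C x y\<rbrakk> \<Longrightarrow> Comp C x y y (Ide C y) f = f"
    and category_assoc: "\<lbrakk>w \<in> Ob C; x \<in> Ob C; y \<in> Ob C; z \<in> Ob C;
        f \<in> Hom C w x; g \<in> Hom C x y; h \<in> Hom C y z\<rbrakk>
      \<Longrightarrow> Comp C w x z (Comp C x y z h g) f = Comp C w y z h (Comp C w x y g f)"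
  using assms unfolding category_def by blast+

lemmas category_simps =
  category_Ide category_Comp category_Comp_Ide category_Ide_Comp category_assoc

lemma categoryI:
  assumes "\<And>x. x \<in> Ob C \<Longrightarrow> Ide C x \<in> Hom C x x"
    and "\<And>x y z f g. \<lbrakk>x \<in> Ob C; y \<in> Ob C; z \<in> Ob C; f \<in> Hom C x y; g \<in> Hom C y z\<rbrakk>
      \<Longrightarrow> Comp C x y z g f \<in> Hom C x z"
    and "\<And>x y f. \<lbrakk>x \<in> Ob C; y \<in> Ob C; f \<in> Hom C x y\<rbrakk> \<Longrightarrow> Comp C x x y f (Ide C x) = f"
    and "\<And>x y f. \<lbrakk>x \<in> Ob C; y \<in> Ob C; f \<in> Hom C x y\<rbrakk> \<Longrightarrow> Comp C x y y (Ide C y) f = f"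
    and "\<And>w x y z f g h. \<lbrakk>w \<in> Ob C; x \<in> Ob C; y \<in> Ob C; z \<in> Ob C;
        f \<in> Hom C w x; g \<in> Hom C x y; h \<in> Hom C y z\<rbrakk>
      \<Longrightarrow> Comp C w x z (Comp C x y z h g) f = Comp C w y z h (Comp C w x y g f)"
  shows "category C"
  unfolding category_def by (intro conjI ballI; rule assms; assumption)

lemma
  assumes "is_functor C D F"
  shows functor_source: "category C"
    and functor_target: "category D"
    and functor_Ob: "x \<in> Ob C \<Longrightarrow> FOb F x \<in> Ob D"
    and functor_Hom: "\<lbrakk>x \<in> Ob C; y \<in> Ob C; f \<in> Hom C x y\<rbrakk>
      \<Longrightarrow> FMap F x y f \<in> Hom D (FOb F x) (FOb F y)"
    and functor_Ide: "x \<in> Ob C \<Longrightarrow> FMap F x x (Ide C x) = Ide D (FOb F x)"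
    and functor_Comp: "\<lbrakk>x \<in> Ob C; y \<in> Ob C; z \<in> Ob C; f \<in> Hom C x y; g \<in> Hom C y z\<rbrakk>
      \<Longrightarrow> FMap F x z (Comp C x y z g f)
        = Comp D (FOb F x) (FOb F y) (FOb F z) (FMap F y z g) (FMap F x y f)"
    and functor_mk: "F = mk_functor C (FOb F) (FMap F)"
proof -
  note D = assms[unfolded is_functor_def]
  show "category C" by (rule D[THEN conjunct1])
  show "category D" by (rule D[THEN conjunct2, THEN conjunct1])
  show "F = mk_functor C (FOb F) (FMap F)" by (rule D[THEN conjunct2, THEN conjunct2, THEN conjunct1])
  note D = D[THEN conjunct2, THEN conjunct2, THEN conjunct2]
  show "x \<in> Ob C \<Longrightarrow> FOb F x \<in> Ob D"
    and "\<lbrakk>x \<in> Ob C; y \<in> Ob C; f \<in> Hom C x y\<rbrakk> \<Longrightarrow> FMap F x y f \<in> Hom D (FOb F x) (FOb F y)"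
    and "x \<in> Ob C \<Longrightarrow> FMap F x x (Ide C x) = Ide D (FOb F x)"
    and "\<lbrakk>x \<in> Ob C; y \<in> Ob C; z \<in> Ob C; f \<in> Hom C x y; g \<in> Hom C y z\<rbrakk>
      \<Longrightarrow> FMap F x z (Comp C x y z g f)
        = Comp D (FOb F x) (FOb F y) (FOb F z) (FMap F y z g) (FMap F x y f)"
    using D by blast+
qed

lemmas functor_simps = functor_Ob functor_Hom functor_Ide functor_Comp

lemma mk_functor_Ob [simp]: "x \<in> Ob C \<Longrightarrow> FOb (mk_functor C F0 F1) x = F0 x"
  and mk_functor_Map [simp]: "\<lbrakk>x \<in> Ob C; y \<in> Ob C; f \<in> Hom C x y\<rbrakk>
    \<Longrightarrow> FMap (mk_functor C F0 F1) x y f = F1 x y f"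
  by (simp_all add: mk_functor_def)

lemma mk_functor_cong:
  assumes "\<And>x. x \<in> Ob C \<Longrightarrow> F0 x = G0 x"
    and "\<And>x y f. \<lbrakk>x \<in> Ob C; y \<in> Ob C; f \<in> Hom C x y\<rbrakk> \<Longrightarrow> F1 x y f = G1 x y f"
  shows "mk_functor C F0 F1 = mk_functor C G0 G1"
  using assms by (auto simp: mk_functor_def fun_eq_iff restrict_def)

text \<open>Functors are \<open>undefined\<close> off their domain, so agreement on the objects and
  arrows of \<open>C\<close> is genuine equality. The targets may differ, because the normal form
  \<open>mk_functor C\<close> refers to the source alone.\<close>

lemma functor_eqI:
  assumes "is_functor C D F" "is_functor C E G"
    and "\<And>x. x \<in> Ob C \<Longrightarrow> FOb F x = FOb G x"
    and "\<And>x y f. \<lbrakk>x \<in> Ob C; y \<in> Ob C; f \<in> Hom C x y\<rbrakk> \<Longrightarrow> FMap F x y f = FMap G x y f"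
  shows "F = G"
  by (rule trans[OF functor_mk[OF assms(1)] trans[OF mk_functor_cong functor_mk[OF assms(2), symmetric]]])
    (simp_all add: assms(3,4))

text \<open>Serves the clause of \<open>is_functor\<close> that fixes values off the domain:
  normalising a second time consults the first result only where it agrees with \<open>F0\<close>
  and \<open>F1\<close>.\<close>

lemma mk_functor_idem: "mk_functor C (FOb (mk_functor C F0 F1)) (FMap (mk_functor C F0 F1))
    = mk_functor C F0 F1"
  by (rule mk_functor_cong) simp_all

lemma is_functor_mk_functorI:
  assumes "category C" "category D"
    and "\<And>x. x \<in> Ob C \<Longrightarrow> F0 x \<in> Ob D"
    and "\<And>x y f. \<lbrakk>x \<in> Ob C; y \<in> Ob C; f \<in> Hom C x y\<rbrakk> \<Longrightarrow> F1 x y f \<in> Hom D (F0 x) (F0 y)"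
    and "\<And>x. x \<in> Ob C \<Longrightarrow> F1 x x (Ide C x) = Ide D (F0 x)"
    and "\<And>x y z f g. \<lbrakk>x \<in> Ob C; y \<in> Ob C; z \<in> Ob C; f \<in> Hom C x y; g \<in> Hom C y z\<rbrakk>
      \<Longrightarrow> F1 x z (Comp C x y z g f) = Comp D (F0 x) (F0 y) (F0 z) (F1 y z g) (F1 x y f)"
  shows "is_functor C D (mk_functor C F0 F1)"
  unfolding is_functor_def mk_functor_idem
  by (intro conjI ballI refl) (simp_all add: assms category_Ide[OF assms(1)] category_Comp[OF assms(1)])

lemma id_fun_Ob [simp]: "x \<in> Ob C \<Longrightarrow> FOb (id_fun C) x = x"
  and id_fun_Map [simp]: "\<lbrakk>x \<in> Ob C; y \<in> Ob C; f \<in> Hom C x y\<rbrakk> \<Longrightarrow> FMap (id_fun C) x y f = f"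
  by (simp_all add: id_fun_def)

lemma comp_fun_Ob [simp]: "x \<in> Ob C \<Longrightarrow> FOb (comp_fun C G F) x = FOb G (FOb F x)"
  and comp_fun_Map [simp]: "\<lbrakk>x \<in> Ob C; y \<in> Ob C; f \<in> Hom C x y\<rbrakk>
    \<Longrightarrow> FMap (comp_fun C G F) x y f = FMap G (FOb F x) (FOb F y) (FMap F x y f)"
  by (simp_all add: comp_fun_def)

lemma is_functor_id_fun: "category C \<Longrightarrow> is_functor C C (id_fun C)"
  unfolding id_fun_def by (rule is_functor_mk_functorI) (simp_all add: category_simps)

lemma is_functor_comp_fun:
  assumes F: "is_functor C D F" and G: "is_functor D E G"
  shows "is_functor C E (comp_fun C G F)"
  unfolding comp_fun_def
  by (rule is_functor_mk_functorI)
    (simp_all add: functor_simps[OF F] functor_simps[OF G] functor_source[OF F] functor_target[OF G])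

lemma comp_fun_id_fun:
  assumes F: "is_functor C D F"
  shows "comp_fun C F (id_fun C) = F" "comp_fun C (id_fun D) F = F"
proof -
  have "category C" "category D"
    using F by (rule functor_source, rule functor_target)
  then show "comp_fun C F (id_fun C) = F" "comp_fun C (id_fun D) F = F"
    using F by (auto intro!: functor_eqI[of C D _ D F] is_functor_comp_fun is_functor_id_fun
        simp: functor_simps[OF F])
qed

lemma comp_fun_assoc:
  assumes "is_functor B C F" "is_functor C D G" "is_functor D E H"
  shows "comp_fun B (comp_fun C H G) F = comp_fun B H (comp_fun B G F)"
  by (rule functor_eqI[of B E _ E])
    (use assms in \<open>auto intro: is_functor_comp_fun simp: functor_simps[OF assms(1)]\<close>)

lemma is_isoI:
  assumes "f \<in> Hom C x y" "g \<in> Hom C y x" "Comp C x y x g f = Ide C x" "Comp C y x y f g = Ide C y"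
  shows "is_iso C x y f"
  using assms unfolding is_iso_def by blast

lemma isomorphic_refl:
  assumes "category C" "x \<in> Ob C"
  shows "isomorphic C x x"
  using assms is_isoI[of "Ide C x" C x x "Ide C x"]
  by (auto simp: isomorphic_def category_simps)

section \<open>Natural isomorphisms and equivalences of categories\<close>

lemma nat_trans_iff:
  "\<alpha> \<in> nat_trans C D F G \<longleftrightarrow> \<alpha> \<in> extensional (Ob C) \<and>
     (\<forall>x\<in>Ob C. \<alpha> x \<in> Hom D (FOb F x) (FOb G x)) \<and>
     (\<forall>x\<in>Ob C. \<forall>y\<in>Ob C. \<forall>f\<in>Hom C x y.
        Comp D (FOb F x) (FOb F y) (FOb G y) (\<alpha> y) (FMap F x y f)
          = Comp D (FOb F x) (FOb G x) (FOb G y) (FMap G x y f) (\<alpha> x))"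
  by (simp add: nat_trans_def)

lemma
  assumes "\<alpha> \<in> nat_trans C D F G"
  shows nat_trans_Hom: "x \<in> Ob C \<Longrightarrow> \<alpha> x \<in> Hom D (FOb F x) (FOb G x)"
    and nat_trans_natural: "\<lbrakk>x \<in> Ob C; y \<in> Ob C; f \<in> Hom C x y\<rbrakk> \<Longrightarrow>
        Comp D (FOb F x) (FOb F y) (FOb G y) (\<alpha> y) (FMap F x y f)
          = Comp D (FOb F x) (FOb G x) (FOb G y) (FMap G x y f) (\<alpha> x)"
    and nat_trans_extensional: "\<alpha> \<in> extensional (Ob C)"
  using assms by (auto simp: nat_trans_iff)

text \<open>Serves as a conditional rewrite rule that spares explicit reassociation when arrows are
  conjugated with isomorphisms.\<close>

lemma category_cancel:
  assumes C: "category C" and "w \<in> Ob C" "x \<in> Ob C" "y \<in> Ob C"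
    and "f \<in> Hom C w x" "u \<in> Hom C x y" "v \<in> Hom C y x" "Comp C x y x v u = Ide C x"
  shows "Comp C w y x v (Comp C w x y u f) = f"
  using assms category_assoc[OF C, of w x y x f u v, symmetric] by (simp add: category_simps)

text \<open>Componentwise inverses of a natural transformation are automatically natural, so it is
  enough to supply \<open>\<beta>\<close> pointwise. It is restricted to \<open>Ob C\<close> before
  it serves as the inverse.\<close>

lemma nat_iso_isomorphic:
  assumes F: "is_functor C D F" and G: "is_functor C D G"
    and \<alpha>: "\<alpha> \<in> nat_trans C D F G"
    and \<beta>: "\<And>x. x \<in> Ob C \<Longrightarrow> \<beta> x \<in> Hom D (FOb G x) (FOb F x)"
    and \<beta>\<alpha>: "\<And>x. x \<in> Ob C \<Longrightarrow> Comp D (FOb F x) (FOb G x) (FOb F x) (\<beta> x) (\<alpha> x) = Ide D (FOb F x)"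
    and \<alpha>\<beta>: "\<And>x. x \<in> Ob C \<Longrightarrow> Comp D (FOb G x) (FOb F x) (FOb G x) (\<alpha> x) (\<beta> x) = Ide D (FOb G x)"
  shows "isomorphic (fun_cat C D) F G"
proof -
  have D: "category D" using F by (rule functor_target)
  note [simp] = category_simps[OF D] functor_simps[OF F] functor_simps[OF G] \<beta> nat_trans_Hom[OF \<alpha>]
  have "Comp D (FOb G x) (FOb G y) (FOb F y) (\<beta> y) (FMap G x y f)
      = Comp D (FOb G x) (FOb F x) (FOb F y) (FMap F x y f) (\<beta> x)"
    if xy: "x \<in> Ob C" "y \<in> Ob C" "f \<in> Hom C x y" for x y f
  proof -
    \<comment> \<open>Insert \<open>\<alpha> x\<close> after \<open>\<beta> x\<close>, which is an
      identity, so that naturality of \<open>\<alpha>\<close> can exchange the image of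
      \<open>f\<close> under \<open>G\<close> for its image under \<open>F\<close>.\<close>
    have "Comp D (FOb G x) (FOb G y) (FOb F y) (\<beta> y) (FMap G x y f)
      = Comp D (FOb G x) (FOb G y) (FOb F y) (\<beta> y)
          (Comp D (FOb G x) (FOb F x) (FOb G y)
             (Comp D (FOb F x) (FOb G x) (FOb G y) (FMap G x y f) (\<alpha> x)) (\<beta> x))"
      using xy by (simp add: \<alpha>\<beta>)
    also have "\<dots> = Comp D (FOb G x) (FOb G y) (FOb F y) (\<beta> y)
          (Comp D (FOb G x) (FOb F y) (FOb G y) (\<alpha> y)
             (Comp D (FOb G x) (FOb F x) (FOb F y) (FMap F x y f) (\<beta> x)))"
      using xy by (simp add: nat_trans_natural[OF \<alpha>, symmetric])
    also have "\<dots> = Comp D (FOb G x) (FOb F x) (FOb F y) (FMap F x y f) (\<beta> x)"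
      using xy by (intro category_cancel[OF D]) (simp_all add: \<beta>\<alpha>)
    finally show ?thesis .
  qed
  then have "restrict \<beta> (Ob C) \<in> nat_trans C D G F"
    by (auto simp: nat_trans_iff)
  then have "is_iso (fun_cat C D) F G \<alpha>"
    using \<alpha> by (intro is_isoI) (auto simp: fun_cat_def \<beta>\<alpha> \<alpha>\<beta> intro!: restrict_ext)
  then show ?thesis using F G by (auto simp: isomorphic_def fun_cat_def)
qed

text \<open>The quasi-inverse picks for each \<open>y\<close> a preimage up to isomorphism, and
  sends an arrow to the unique lift along \<open>F\<close> of its conjugate by the chosen
  isomorphisms. Equations between arrows of \<open>C\<close> are proved by faithfulness, after
  applying \<open>F\<close>.\<close>

proposition fully_faithful_essentially_surjective_is_equivalence:
  assumes F: "is_functor C D F"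
    and ff: "\<And>x y. \<lbrakk>x \<in> Ob C; y \<in> Ob C\<rbrakk>
      \<Longrightarrow> bij_betw (FMap F x y) (Hom C x y) (Hom D (FOb F x) (FOb F y))"
    and es: "\<And>y. y \<in> Ob D \<Longrightarrow> \<exists>x\<in>Ob C. isomorphic D (FOb F x) y"
  shows "is_equivalence C D F"
proof -
  have C: "category C" and D: "category D"
    using F by (rule functor_source, rule functor_target)
  have "\<forall>y\<in>Ob D. \<exists>x e e'. x \<in> Ob C \<and> e \<in> Hom D (FOb F x) y \<and> e' \<in> Hom D y (FOb F x) \<and>
      Comp D (FOb F x) y (FOb F x) e' e = Ide D (FOb F x) \<and> Comp D y (FOb F x) y e e' = Ide D y"
    using es unfolding isomorphic_def is_iso_def by meson
  then obtain g e e' where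
    g: "\<And>y. y \<in> Ob D \<Longrightarrow> g y \<in> Ob C" and
    e: "\<And>y. y \<in> Ob D \<Longrightarrow> e y \<in> Hom D (FOb F (g y)) y" and
    e': "\<And>y. y \<in> Ob D \<Longrightarrow> e' y \<in> Hom D y (FOb F (g y))" and
    e'e: "\<And>y. y \<in> Ob D \<Longrightarrow> Comp D (FOb F (g y)) y (FOb F (g y)) (e' y) (e y) = Ide D (FOb F (g y))" and
    ee': "\<And>y. y \<in> Ob D \<Longrightarrow> Comp D y (FOb F (g y)) y (e y) (e' y) = Ide D y"
    by metis
  define lift where "lift x y = inv_into (Hom C x y) (FMap F x y)" for x y
  have lift_Hom: "lift x y f \<in> Hom C x y" and F_lift: "FMap F x y (lift x y f) = f"
    if "x \<in> Ob C" "y \<in> Ob C" "f \<in> Hom D (FOb F x) (FOb F y)" for x y f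
    using ff[OF that(1,2)] that(3)
    unfolding lift_def bij_betw_def by (auto simp: inv_into_into f_inv_into_f)
  have faithful: "f = f'" if "FMap F x y f = FMap F x y f'" "x \<in> Ob C" "y \<in> Ob C"
    "f \<in> Hom C x y" "f' \<in> Hom C x y" for x y f f'
    using ff[OF that(2,3)] that(1,4,5) by (auto simp: bij_betw_def inj_on_def)
  note [simp] = category_simps[OF C] category_simps[OF D] functor_simps[OF F]
    g e e' e'e ee' lift_Hom F_lift category_cancel[OF D]
  define conj where "conj y z f = Comp D (FOb F (g y)) z (FOb F (g z)) (e' z)
      (Comp D (FOb F (g y)) y z f (e y))" for y z f
  have conj_Hom [simp]: "conj y z f \<in> Hom D (FOb F (g y)) (FOb F (g z))"
    if "y \<in> Ob D" "z \<in> Ob D" "f \<in> Hom D y z" for y z f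
    using that by (simp add: conj_def)
  define G where "G = mk_functor D g (\<lambda>y z f. lift (g y) (g z) (conj y z f))"
  have G: "is_functor D C G"
    unfolding G_def
  proof (rule is_functor_mk_functorI[OF D C])
    fix x assume x: "x \<in> Ob D"
    show "lift (g x) (g x) (conj x x (Ide D x)) = Ide C (g x)"
      by (rule faithful[of "g x" "g x"]) (use x in \<open>simp_all add: conj_def\<close>)
  next
    fix x y z f h assume *: "x \<in> Ob D" "y \<in> Ob D" "z \<in> Ob D" "f \<in> Hom D x y" "h \<in> Hom D y z"
    have "conj x z (Comp D x y z h f)
        = Comp D (FOb F (g x)) (FOb F (g y)) (FOb F (g z)) (conj y z h) (conj x y f)"
      using * by (simp add: conj_def)
    then show "lift (g x) (g z) (conj x z (Comp D x y z h f))
        = Comp C (g x) (g y) (g z) (lift (g y) (g z) (conj y z h)) (lift (g x) (g y) (conj x y f))"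
      by (intro faithful[of "g x" "g z"]) (use * in simp_all)
  qed simp_all
  note [simp] = functor_simps[OF G]
  have G_Ob [simp]: "FOb G y = g y" if "y \<in> Ob D" for y
    using that by (simp add: G_def)
  have F_G: "FMap F (g y) (g z) (FMap G y z f) = conj y z f"
    if "y \<in> Ob D" "z \<in> Ob D" "f \<in> Hom D y z" for y z f
    using that by (simp add: G_def)
  have GHom: "FMap G y z f \<in> Hom C (g y) (g z)"
    if "y \<in> Ob D" "z \<in> Ob D" "f \<in> Hom D y z" for y z f
    using functor_Hom[OF G, of y z f] that by simp
  note [simp] = GHom
  have "isomorphic (fun_cat D D) (comp_fun D F G) (id_fun D)"
  proof (rule nat_iso_isomorphic[where \<alpha> = "restrict e (Ob D)" and \<beta> = e'])
    show "restrict e (Ob D) \<in> nat_trans D D (comp_fun D F G) (id_fun D)"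
      by (auto simp: nat_trans_iff F_G conj_def)
  qed (simp_all add: is_functor_comp_fun[OF G F] is_functor_id_fun[OF D])
  \<comment> \<open>The unit at \<open>x\<close> is the lift of \<open>e'\<close> at
    \<open>FOb F x\<close>, and its inverse is the lift of \<open>e\<close> there. Both can be
    lifted, since they connect the images under \<open>F\<close> of \<open>x\<close> and of
    \<open>g (FOb F x)\<close>.\<close>
  moreover have "isomorphic (fun_cat C C) (id_fun C) (comp_fun C G F)"
  proof (rule nat_iso_isomorphic[where
        \<alpha> = "\<lambda>x\<in>Ob C. lift x (g (FOb F x)) (e' (FOb F x))" and
        \<beta> = "\<lambda>x. lift (g (FOb F x)) x (e (FOb F x))"])
    show "(\<lambda>x\<in>Ob C. lift x (g (FOb F x)) (e' (FOb F x)))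
        \<in> nat_trans C C (id_fun C) (comp_fun C G F)"
      unfolding nat_trans_iff
    proof (intro conjI ballI)
      fix x y f assume *: "x \<in> Ob C" "y \<in> Ob C" "f \<in> Hom C x y"
      have "Comp C x y (g (FOb F y)) (lift y (g (FOb F y)) (e' (FOb F y))) f
        = Comp C x (g (FOb F x)) (g (FOb F y))
            (FMap G (FOb F x) (FOb F y) (FMap F x y f)) (lift x (g (FOb F x)) (e' (FOb F x)))"
        by (rule faithful[of x "g (FOb F y)"]) (use * in \<open>simp_all add: F_G conj_def\<close>)
      then show "Comp C (FOb (id_fun C) x) (FOb (id_fun C) y) (FOb (comp_fun C G F) y)
          ((\<lambda>x\<in>Ob C. lift x (g (FOb F x)) (e' (FOb F x))) y) (FMap (id_fun C) x y f)
        = Comp C (FOb (id_fun C) x) (FOb (comp_fun C G F) x) (FOb (comp_fun C G F) y)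
          (FMap (comp_fun C G F) x y f) ((\<lambda>x\<in>Ob C. lift x (g (FOb F x)) (e' (FOb F x))) x)"
        using * by simp
    qed simp_all
  next
    fix x assume x: "x \<in> Ob C"
    have "Comp C x (g (FOb F x)) x (lift (g (FOb F x)) x (e (FOb F x)))
        (lift x (g (FOb F x)) (e' (FOb F x))) = Ide C x"
      by (rule faithful[of x x]) (use x in simp_all)
    then show "Comp C (FOb (id_fun C) x) (FOb (comp_fun C G F) x) (FOb (id_fun C) x)
        (lift (g (FOb F x)) x (e (FOb F x)))
        ((\<lambda>x\<in>Ob C. lift x (g (FOb F x)) (e' (FOb F x))) x) = Ide C (FOb (id_fun C) x)"
      using x by simp
    have "Comp C (g (FOb F x)) x (g (FOb F x)) (lift x (g (FOb F x)) (e' (FOb F x)))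
        (lift (g (FOb F x)) x (e (FOb F x))) = Ide C (g (FOb F x))"
      by (rule faithful[of "g (FOb F x)" "g (FOb F x)"]) (use x in simp_all)
    then show "Comp C (FOb (comp_fun C G F) x) (FOb (id_fun C) x) (FOb (comp_fun C G F) x)
        ((\<lambda>x\<in>Ob C. lift x (g (FOb F x)) (e' (FOb F x))) x)
        (lift (g (FOb F x)) x (e (FOb F x))) = Ide C (FOb (comp_fun C G F) x)"
      using x by simp
  qed (simp_all add: is_functor_comp_fun[OF F G] is_functor_id_fun[OF C])
  ultimately show ?thesis
    using F G by (auto simp: is_equivalence_def)
qed

section \<open>2-categories whose 2-cells are natural transformations\<close>

lemma fun_cat_simps [simp]:
  "Ob (fun_cat C D) = {F. is_functor C D F}"
  "Hom (fun_cat C D) = nat_trans C D"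
  "Ide (fun_cat C D) F = (\<lambda>x\<in>Ob C. Ide D (FOb F x))"
  "Comp (fun_cat C D) F G H \<beta> \<alpha> = (\<lambda>x\<in>Ob C. Comp D (FOb F x) (FOb G x) (FOb H x) (\<beta> x) (\<alpha> x))"
  by (simp_all add: fun_cat_def)

lemma category_fun_cat:
  assumes D: "category D"
  shows "category (fun_cat C D)"
proof (rule categoryI)
  note [simp] = category_simps[OF D]
  show "Ide (fun_cat C D) F \<in> Hom (fun_cat C D) F F" if F: "F \<in> Ob (fun_cat C D)" for F
  proof -
    have "is_functor C D F" using F by simp
    note [simp] = functor_simps[OF this]
    show ?thesis by (simp add: nat_trans_iff)
  qed
  show "Comp (fun_cat C D) F G H \<beta> \<alpha> \<in> Hom (fun_cat C D) F H"
    if FGH: "F \<in> Ob (fun_cat C D)" "G \<in> Ob (fun_cat C D)" "H \<in> Ob (fun_cat C D)"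
      and "\<alpha> \<in> Hom (fun_cat C D) F G" "\<beta> \<in> Hom (fun_cat C D) G H" for F G H \<alpha> \<beta>
  proof -
    have "is_functor C D F" "is_functor C D G" "is_functor C D H" using FGH by simp_all
    note [simp] = this[THEN functor_Ob] this[THEN functor_Hom]
    have \<alpha>: "\<alpha> \<in> nat_trans C D F G" and \<beta>: "\<beta> \<in> nat_trans C D G H" using that by simp_all
    note [simp] = nat_trans_Hom[OF \<alpha>] nat_trans_Hom[OF \<beta>]
    have "Comp D (FOb F x) (FOb F y) (FOb H y) (Comp D (FOb F y) (FOb G y) (FOb H y) (\<beta> y) (\<alpha> y))
        (FMap F x y f)
      = Comp D (FOb F x) (FOb H x) (FOb H y) (FMap H x y f)
        (Comp D (FOb F x) (FOb G x) (FOb H x) (\<beta> x) (\<alpha> x))"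
      if "x \<in> Ob C" "y \<in> Ob C" "f \<in> Hom C x y" for x y f
    proof -
      have "Comp D (FOb F x) (FOb F y) (FOb H y) (Comp D (FOb F y) (FOb G y) (FOb H y) (\<beta> y) (\<alpha> y))
          (FMap F x y f)
        = Comp D (FOb F x) (FOb G y) (FOb H y) (\<beta> y)
          (Comp D (FOb F x) (FOb G x) (FOb G y) (FMap G x y f) (\<alpha> x))"
        using that by (simp add: nat_trans_natural[OF \<alpha>, symmetric])
      also have "\<dots> = Comp D (FOb F x) (FOb G x) (FOb H y)
          (Comp D (FOb G x) (FOb G y) (FOb H y) (\<beta> y) (FMap G x y f)) (\<alpha> x)"
        using that by simp
      also have "\<dots> = Comp D (FOb F x) (FOb H x) (FOb H y) (FMap H x y f)
          (Comp D (FOb F x) (FOb G x) (FOb H x) (\<beta> x) (\<alpha> x))"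
        unfolding nat_trans_natural[OF \<beta> that] using that by simp
      finally show ?thesis .
    qed
    then show ?thesis by (simp add: nat_trans_iff)
  qed
  show "Comp (fun_cat C D) F F G \<alpha> (Ide (fun_cat C D) F) = \<alpha>"
    "Comp (fun_cat C D) F G G (Ide (fun_cat C D) G) \<alpha> = \<alpha>"
    if "F \<in> Ob (fun_cat C D)" "G \<in> Ob (fun_cat C D)" "\<alpha> \<in> Hom (fun_cat C D) F G" for F G \<alpha>
    using that by (auto simp: nat_trans_iff functor_Ob intro!: extensionalityI[of _ "Ob C"])
  show "Comp (fun_cat C D) F G I (Comp (fun_cat C D) G H I \<gamma> \<beta>) \<alpha>
      = Comp (fun_cat C D) F H I \<gamma> (Comp (fun_cat C D) F G H \<beta> \<alpha>)"
    if "F \<in> Ob (fun_cat C D)" "G \<in> Ob (fun_cat C D)" "H \<in> Ob (fun_cat C D)" "I \<in> Ob (fun_cat C D)"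
      "\<alpha> \<in> Hom (fun_cat C D) F G" "\<beta> \<in> Hom (fun_cat C D) G H" "\<gamma> \<in> Hom (fun_cat C D) H I"
    for F G H I \<alpha> \<beta> \<gamma>
    using that by (auto simp: nat_trans_iff functor_Ob intro!: restrict_ext)
qed

lemma hcomp_nat_trans:
  assumes F: "is_functor C D F" and F': "is_functor C D F'"
    and G: "is_functor D E G" and G': "is_functor D E G'"
    and \<alpha>: "\<alpha> \<in> nat_trans C D F F'" and \<beta>: "\<beta> \<in> nat_trans D E G G'"
  shows "hcomp C E G G' F F' \<beta> \<alpha> \<in> nat_trans C E (comp_fun C G F) (comp_fun C G' F')"
proof -
  note [simp] = category_simps[OF functor_source[OF F]] category_simps[OF functor_target[OF F]]
    category_simps[OF functor_target[OF G]]
    functor_Ob[OF F] functor_Ob[OF F'] functor_Hom[OF F] functor_Hom[OF F']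
    functor_Ob[OF G] functor_Ob[OF G'] functor_Hom[OF G] functor_Hom[OF G']
    nat_trans_Hom[OF \<alpha>] nat_trans_Hom[OF \<beta>]
  have "Comp E (FOb G (FOb F x)) (FOb G (FOb F y)) (FOb G' (FOb F' y))
      (Comp E (FOb G (FOb F y)) (FOb G (FOb F' y)) (FOb G' (FOb F' y)) (\<beta> (FOb F' y))
        (FMap G (FOb F y) (FOb F' y) (\<alpha> y)))
      (FMap G (FOb F x) (FOb F y) (FMap F x y f))
    = Comp E (FOb G (FOb F x)) (FOb G' (FOb F' x)) (FOb G' (FOb F' y))
      (FMap G' (FOb F' x) (FOb F' y) (FMap F' x y f))
      (Comp E (FOb G (FOb F x)) (FOb G (FOb F' x)) (FOb G' (FOb F' x)) (\<beta> (FOb F' x))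
        (FMap G (FOb F x) (FOb F' x) (\<alpha> x)))" (is "?l = ?r")
    if xy: "x \<in> Ob C" "y \<in> Ob C" "f \<in> Hom C x y" for x y f
  proof -
    have "?l = Comp E (FOb G (FOb F x)) (FOb G (FOb F' y)) (FOb G' (FOb F' y)) (\<beta> (FOb F' y))
        (FMap G (FOb F x) (FOb F' y) (Comp D (FOb F x) (FOb F y) (FOb F' y) (\<alpha> y) (FMap F x y f)))"
      using xy by (simp add: functor_Comp[OF G])
    also have "\<dots> = Comp E (FOb G (FOb F x)) (FOb G (FOb F' x)) (FOb G' (FOb F' y))
        (Comp E (FOb G (FOb F' x)) (FOb G (FOb F' y)) (FOb G' (FOb F' y)) (\<beta> (FOb F' y))
          (FMap G (FOb F' x) (FOb F' y) (FMap F' x y f)))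
        (FMap G (FOb F x) (FOb F' x) (\<alpha> x))"
      unfolding nat_trans_natural[OF \<alpha> xy] using xy by (simp add: functor_Comp[OF G])
    also have "\<dots> = ?r"
      using xy by (simp add: nat_trans_natural[OF \<beta>])
    finally show ?thesis .
  qed
  then show ?thesis
    by (auto simp: nat_trans_iff hcomp_def)
qed

text \<open>Expanding both composites and reassociating leaves one square in the middle, which is
  naturality of \<open>\<beta>\<close> at the arrow \<open>\<alpha>' x\<close>. This is what makes
  horizontal composition a functor on the product of hom-categories.\<close>

lemma hcomp_interchange:
  assumes F: "is_functor C D F" "is_functor C D F'" "is_functor C D F''"
    and G: "is_functor D E G" "is_functor D E G'" "is_functor D E G''"
    and \<alpha>: "\<alpha> \<in> nat_trans C D F F'" and \<alpha>': "\<alpha>' \<in> nat_trans C D F' F''"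
    and \<beta>: "\<beta> \<in> nat_trans D E G G'" and \<beta>': "\<beta>' \<in> nat_trans D E G' G''"
  shows "hcomp C E G G'' F F'' (Comp (fun_cat D E) G G' G'' \<beta>' \<beta>) (Comp (fun_cat C D) F F' F'' \<alpha>' \<alpha>)
    = Comp (fun_cat C E) (comp_fun C G F) (comp_fun C G' F') (comp_fun C G'' F'')
        (hcomp C E G' G'' F' F'' \<beta>' \<alpha>') (hcomp C E G G' F F' \<beta> \<alpha>)"
proof -
  note [simp] = category_simps[OF functor_target[OF F(1)]]
    category_simps[OF functor_target[OF G(1)]]
    F[THEN functor_Ob] F[THEN functor_Hom] G[THEN functor_Ob] G[THEN functor_Hom]
    G[THEN functor_Comp]
    nat_trans_Hom[OF \<alpha>] nat_trans_Hom[OF \<beta>] nat_trans_Hom[OF \<alpha>'] nat_trans_Hom[OF \<beta>']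
  have "Comp E (FOb G (FOb F x)) (FOb G (FOb F'' x)) (FOb G'' (FOb F'' x))
      (Comp E (FOb G (FOb F'' x)) (FOb G' (FOb F'' x)) (FOb G'' (FOb F'' x))
        (\<beta>' (FOb F'' x)) (\<beta> (FOb F'' x)))
      (FMap G (FOb F x) (FOb F'' x) (Comp D (FOb F x) (FOb F' x) (FOb F'' x) (\<alpha>' x) (\<alpha> x)))
    = Comp E (FOb G (FOb F x)) (FOb G' (FOb F' x)) (FOb G'' (FOb F'' x))
       (Comp E (FOb G' (FOb F' x)) (FOb G' (FOb F'' x)) (FOb G'' (FOb F'' x)) (\<beta>' (FOb F'' x))
          (FMap G' (FOb F' x) (FOb F'' x) (\<alpha>' x)))
       (Comp E (FOb G (FOb F x)) (FOb G (FOb F' x)) (FOb G' (FOb F' x)) (\<beta> (FOb F' x))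
          (FMap G (FOb F x) (FOb F' x) (\<alpha> x)))" (is "?l = ?r")
    if x: "x \<in> Ob C" for x
  proof -
    have "?l = Comp E (FOb G (FOb F x)) (FOb G' (FOb F'' x)) (FOb G'' (FOb F'' x)) (\<beta>' (FOb F'' x))
        (Comp E (FOb G (FOb F x)) (FOb G (FOb F' x)) (FOb G' (FOb F'' x))
          (Comp E (FOb G (FOb F' x)) (FOb G (FOb F'' x)) (FOb G' (FOb F'' x)) (\<beta> (FOb F'' x))
            (FMap G (FOb F' x) (FOb F'' x) (\<alpha>' x)))
          (FMap G (FOb F x) (FOb F' x) (\<alpha> x)))"
      using x by simp
    also have "\<dots> = ?r"
      using x by (subst nat_trans_natural[OF \<beta>]) simp_all
    finally show ?thesis .
  qed
  then show ?thesis
    by (auto simp: hcomp_def intro!: restrict_ext)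
qed

lemma hcomp_Ide:
  assumes F: "is_functor C D F" and G: "is_functor D E G"
  shows "hcomp C E G G F F (Ide (fun_cat D E) G) (Ide (fun_cat C D) F)
    = Ide (fun_cat C E) (comp_fun C G F)"
  by (auto simp: hcomp_def category_simps[OF functor_target[OF G]] functor_simps[OF F]
      functor_simps[OF G] category_simps[OF functor_target[OF F]] intro!: restrict_ext)

lemma hcomp_Ide_id_fun:
  assumes F: "is_functor C D F" and F': "is_functor C D F'" and \<alpha>: "\<alpha> \<in> nat_trans C D F F'"
  shows "hcomp C D F F' (id_fun C) (id_fun C) \<alpha> (Ide (fun_cat C C) (id_fun C)) = \<alpha>"
    and "hcomp C D (id_fun D) (id_fun D) F F' (Ide (fun_cat D D) (id_fun D)) \<alpha> = \<alpha>"
proof -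
  note [simp] = category_simps[OF functor_source[OF F]] category_simps[OF functor_target[OF F]]
    functor_simps[OF F] functor_simps[OF F'] nat_trans_Hom[OF \<alpha>]
  show "hcomp C D F F' (id_fun C) (id_fun C) \<alpha> (Ide (fun_cat C C) (id_fun C)) = \<alpha>"
    "hcomp C D (id_fun D) (id_fun D) F F' (Ide (fun_cat D D) (id_fun D)) \<alpha> = \<alpha>"
    by (auto simp: hcomp_def intro!: extensionalityI[of _ "Ob C"] nat_trans_extensional[OF \<alpha>])
qed

text \<open>Both bracketings expand to a component of \<open>\<gamma>\<close> after the image under
  \<open>H\<close> of a component of \<open>\<beta>\<close> after the image of
  \<open>\<alpha> x\<close> under \<open>G\<close> and \<open>H\<close>, by functoriality of
  \<open>H\<close> and associativity in \<open>E\<close>.\<close>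

lemma hcomp_assoc:
  assumes F: "is_functor B C F" "is_functor B C F'"
    and G: "is_functor C D G" "is_functor C D G'"
    and H: "is_functor D E H" "is_functor D E H'"
    and \<alpha>: "\<alpha> \<in> nat_trans B C F F'" and \<beta>: "\<beta> \<in> nat_trans C D G G'" and \<gamma>: "\<gamma> \<in> nat_trans D E H H'"
  shows "hcomp B E (comp_fun C H G) (comp_fun C H' G') F F' (hcomp C E H H' G G' \<gamma> \<beta>) \<alpha>
    = hcomp B E H H' (comp_fun B G F) (comp_fun B G' F') \<gamma> (hcomp B D G G' F F' \<beta> \<alpha>)"
proof -
  note [simp] = category_simps[OF functor_target[OF H(1)]]
    F[THEN functor_Ob] G[THEN functor_Ob] G[THEN functor_Hom]
    H[THEN functor_Ob] H[THEN functor_Hom] H[THEN functor_Comp]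
    nat_trans_Hom[OF \<alpha>] nat_trans_Hom[OF \<beta>] nat_trans_Hom[OF \<gamma>]
  show ?thesis by (auto simp: hcomp_def intro!: restrict_ext)
qed

section \<open>2-categories of structured categories\<close>

lemma category_prod_cat:
  assumes C: "category C" and D: "category D"
  shows "category (prod_cat C D)"
  by (rule categoryI)
    (auto simp: prod_cat_def category_simps[OF C] category_simps[OF D])

text \<open>Abstracts what natural models and CwFs share: 1-cells with an underlying functor
  \<open>V\<close>, and 2-cells that are natural transformations satisfying a property. The
  equations between 2-cells then hold because they hold for natural transformations, so that for
  2-cells only closure under identities and the two compositions is checked case by case.
  \<open>cmp\<close> receives the source object alone, since this is what the normalisation of a
  composite refers to.\<close>

locale cat2_over_Cat =
  fixes X :: "'x set" and U :: "'x \<Rightarrow> ('o, 'a) cat"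
    and maps :: "'x \<Rightarrow> 'x \<Rightarrow> 'm set" and V :: "'m \<Rightarrow> ('o, 'o, 'a, 'a) funct"
    and cells :: "'x \<Rightarrow> 'x \<Rightarrow> 'm \<Rightarrow> 'm \<Rightarrow> ('o \<Rightarrow> 'a) set"
    and ide :: "'x \<Rightarrow> 'm" and cmp :: "'x \<Rightarrow> 'm \<Rightarrow> 'm \<Rightarrow> 'm"
  assumes maps_functor: "\<lbrakk>x \<in> X; y \<in> X; h \<in> maps x y\<rbrakk> \<Longrightarrow> is_functor (U x) (U y) (V h)"
    and cells_nat_trans: "\<lbrakk>x \<in> X; y \<in> X; h \<in> maps x y; k \<in> maps x y; \<alpha> \<in> cells x y h k\<rbrakk>
      \<Longrightarrow> \<alpha> \<in> nat_trans (U x) (U y) (V h) (V k)"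
    and ide_maps: "x \<in> X \<Longrightarrow> ide x \<in> maps x x"
    and V_ide: "x \<in> X \<Longrightarrow> V (ide x) = id_fun (U x)"
    and cmp_maps: "\<lbrakk>x \<in> X; y \<in> X; z \<in> X; h \<in> maps x y; k \<in> maps y z\<rbrakk> \<Longrightarrow> cmp x k h \<in> maps x z"
    and V_cmp: "\<lbrakk>x \<in> X; y \<in> X; z \<in> X; h \<in> maps x y; k \<in> maps y z\<rbrakk>
      \<Longrightarrow> V (cmp x k h) = comp_fun (U x) (V k) (V h)"
    and cmp_ide: "\<lbrakk>x \<in> X; y \<in> X; h \<in> maps x y\<rbrakk> \<Longrightarrow> cmp x h (ide x) = h"
    and ide_cmp: "\<lbrakk>x \<in> X; y \<in> X; h \<in> maps x y\<rbrakk> \<Longrightarrow> cmp x (ide y) h = h"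
    and cmp_assoc: "\<lbrakk>w \<in> X; x \<in> X; y \<in> X; z \<in> X; h \<in> maps w x; k \<in> maps x y; l \<in> maps y z\<rbrakk>
      \<Longrightarrow> cmp w (cmp x l k) h = cmp w l (cmp w k h)"
    and Ide_cells: "\<lbrakk>x \<in> X; y \<in> X; h \<in> maps x y\<rbrakk> \<Longrightarrow> Ide (fun_cat (U x) (U y)) (V h) \<in> cells x y h h"
    and Comp_cells: "\<lbrakk>x \<in> X; y \<in> X; h \<in> maps x y; k \<in> maps x y; l \<in> maps x y;
        \<alpha> \<in> cells x y h k; \<beta> \<in> cells x y k l\<rbrakk>
      \<Longrightarrow> Comp (fun_cat (U x) (U y)) (V h) (V k) (V l) \<beta> \<alpha> \<in> cells x y h l"
    and hcomp_cells: "\<lbrakk>x \<in> X; y \<in> X; z \<in> X; h \<in> maps x y; h' \<in> maps x y; k \<in> maps y z; k' \<in> maps y z;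
        \<alpha> \<in> cells x y h h'; \<beta> \<in> cells y z k k'\<rbrakk>
      \<Longrightarrow> hcomp (U x) (U z) (V k) (V k') (V h) (V h') \<beta> \<alpha> \<in> cells x z (cmp x k h) (cmp x k' h')"
begin

definition hom_cat :: "'x \<Rightarrow> 'x \<Rightarrow> ('m, 'o \<Rightarrow> 'a) cat" where
  "hom_cat x y = \<lparr>Ob = maps x y, Hom = cells x y,
     Ide = (\<lambda>h. Ide (fun_cat (U x) (U y)) (V h)),
     Comp = (\<lambda>h k l \<beta> \<alpha>. Comp (fun_cat (U x) (U y)) (V h) (V k) (V l) \<beta> \<alpha>)\<rparr>"

definition the_cat2 :: "('x, 'm, 'o \<Rightarrow> 'a) cat2" where
  "the_cat2 = \<lparr>Ob2 = X, Hom2 = hom_cat, Id1 = ide,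
     Comp2 = (\<lambda>x y z. mk_functor (prod_cat (hom_cat y z) (hom_cat x y)) (\<lambda>(k, h). cmp x k h)
       (\<lambda>(k, h) (k', h') (\<beta>, \<alpha>). hcomp (U x) (U z) (V k) (V k') (V h) (V h') \<beta> \<alpha>))\<rparr>"

lemma the_cat2_simps [simp]:
  "Ob2 the_cat2 = X" "Hom2 the_cat2 = hom_cat" "Id1 the_cat2 = ide"
  by (simp_all add: the_cat2_def)

lemma hom_cat_simps [simp]:
  "Ob (hom_cat x y) = maps x y" "Hom (hom_cat x y) = cells x y"
  "Ide (hom_cat x y) h = Ide (fun_cat (U x) (U y)) (V h)"
  "Comp (hom_cat x y) h k l \<beta> \<alpha> = Comp (fun_cat (U x) (U y)) (V h) (V k) (V l) \<beta> \<alpha>"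
  by (simp_all add: hom_cat_def)

lemma comp1_the_cat2 [simp]:
  "\<lbrakk>h \<in> maps x y; k \<in> maps y z\<rbrakk> \<Longrightarrow> comp1 the_cat2 x y z k h = cmp x k h"
  by (simp add: the_cat2_def prod_cat_def)

lemma comp2_the_cat2 [simp]:
  "\<lbrakk>h \<in> maps x y; h' \<in> maps x y; k \<in> maps y z; k' \<in> maps y z; \<alpha> \<in> cells x y h h'; \<beta> \<in> cells y z k k'\<rbrakk>
    \<Longrightarrow> comp2 the_cat2 x y z k k' h h' \<beta> \<alpha> = hcomp (U x) (U z) (V k) (V k') (V h) (V h') \<beta> \<alpha>"
  by (simp add: the_cat2_def prod_cat_def)

text \<open>The underlying functor of an identity 1-cell has \<open>U x\<close> as its source, and
  \<open>is_functor\<close> includes that the source is a category.\<close>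

lemma category_U: "x \<in> X \<Longrightarrow> category (U x)"
  using maps_functor[OF _ _ ide_maps] functor_source by blast

lemma category_hom_cat:
  assumes x: "x \<in> X" "y \<in> X"
  shows "category (hom_cat x y)"
proof -
  note * = category_fun_cat[OF category_U[OF x(2)], of "U x"]
  have [simp]: "is_functor (U x) (U y) (V h)" if "h \<in> maps x y" for h
    using x that by (simp add: maps_functor)
  have nt: "\<alpha> \<in> Hom (fun_cat (U x) (U y)) (V h) (V k)"
    if "h \<in> maps x y" "k \<in> maps x y" "\<alpha> \<in> cells x y h k" for h k \<alpha>
    using cells_nat_trans[OF x that] by simp
  have ob: "V h \<in> Ob (fun_cat (U x) (U y))" if "h \<in> maps x y" for h
    using that by simp
  show ?thesis
    by (rule categoryI; unfold hom_cat_simps)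
      (erule (2) Ide_cells[OF x] Comp_cells[OF x] |
       blast intro: Ide_cells[OF x] Comp_cells[OF x] category_Comp_Ide[OF *] category_Ide_Comp[OF *]
        category_assoc[OF *] nt ob)+
qed

lemma two_category_the_cat2: "two_category the_cat2"
proof -
  have "is_functor (prod_cat (hom_cat y z) (hom_cat x y)) (hom_cat x z) (Comp2 the_cat2 x y z)"
    if xyz: "x \<in> X" "y \<in> X" "z \<in> X" for x y z
    unfolding the_cat2_def cat2.simps
  proof (rule is_functor_mk_functorI)
    show "category (prod_cat (hom_cat y z) (hom_cat x y))" "category (hom_cat x z)"
      using xyz by (simp_all add: category_hom_cat category_prod_cat)
  \<comment> \<open>Composites in \<open>fun_cat\<close> stay folded, so that
    \<open>hcomp_Ide\<close> and \<open>hcomp_interchange\<close> match the identity and composition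
    laws.\<close>
  qed (use xyz in \<open>auto simp: prod_cat_def cmp_maps V_cmp hcomp_cells
      simp del: fun_cat_simps
      intro!: hcomp_Ide[OF maps_functor maps_functor] hcomp_interchange[OF maps_functor maps_functor
        maps_functor maps_functor maps_functor maps_functor
        cells_nat_trans cells_nat_trans cells_nat_trans cells_nat_trans]\<close>)
  moreover have "hcomp (U x) (U y) (V f) (V f') (V (ide x)) (V (ide x)) \<alpha>
        (Ide (fun_cat (U x) (U x)) (V (ide x))) = \<alpha> \<and>
      hcomp (U x) (U y) (V (ide y)) (V (ide y)) (V f) (V f')
        (Ide (fun_cat (U y) (U y)) (V (ide y))) \<alpha> = \<alpha>"
    if *: "x \<in> X" "y \<in> X" "f \<in> maps x y" "f' \<in> maps x y" "\<alpha> \<in> cells x y f f'" for x y f f' \<alpha>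
    using hcomp_Ide_id_fun[OF maps_functor[OF *(1,2,3)] maps_functor[OF *(1,2,4)]
        cells_nat_trans[OF *]]
    by (simp only: V_ide * simp_thms)
  moreover have "hcomp (U w) (U z) (V (cmp x h g)) (V (cmp x h' g')) (V f) (V f')
        (hcomp (U x) (U z) (V h) (V h') (V g) (V g') \<gamma> \<beta>) \<alpha>
      = hcomp (U w) (U z) (V h) (V h') (V (cmp w g f)) (V (cmp w g' f')) \<gamma>
        (hcomp (U w) (U y) (V g) (V g') (V f) (V f') \<beta> \<alpha>)"
    if *: "w \<in> X" "x \<in> X" "y \<in> X" "z \<in> X" "f \<in> maps w x" "f' \<in> maps w x"
      "g \<in> maps x y" "g' \<in> maps x y" "h \<in> maps y z" "h' \<in> maps y z"
      "\<alpha> \<in> cells w x f f'" "\<beta> \<in> cells x y g g'" "\<gamma> \<in> cells y z h h'"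
    for w x y z f f' g g' h h' \<alpha> \<beta> \<gamma>
    using hcomp_assoc[OF maps_functor[OF *(1,2,5)] maps_functor[OF *(1,2,6)]
        maps_functor[OF *(2,3,7)] maps_functor[OF *(2,3,8)]
        maps_functor[OF *(3,4,9)] maps_functor[OF *(3,4,10)]
        cells_nat_trans[OF *(1,2,5,6,11)] cells_nat_trans[OF *(2,3,7,8,12)]
        cells_nat_trans[OF *(3,4,9,10,13)]]
    by (simp only: V_cmp[OF *(1,2,3,5,7)] V_cmp[OF *(1,2,3,6,8)]
        V_cmp[OF *(2,3,4,7,9)] V_cmp[OF *(2,3,4,8,10)])
  ultimately show ?thesis
    unfolding two_category_def
    by (simp add: category_hom_cat ide_maps cmp_maps cmp_ide ide_cmp cmp_assoc Ide_cells hcomp_cells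
        del: fun_cat_simps)
qed

end

text \<open>With \<open>F1\<close> bijective and the 2-cells unchanged, every hom-functor is
  bijective on objects and on arrows; essential surjectivity there is witnessed by identities. The
  last hypothesis gives 1-cells whose composites equal identity 1-cells, so that the invertible
  2-cells of an internal equivalence can be identities too.\<close>

proposition equivalent_2cats_over_Cat:
  fixes F0 :: "'x \<Rightarrow> 'y" and F1 :: "'x \<Rightarrow> 'm \<Rightarrow> 'n"
  assumes K: "cat2_over_Cat X U maps V cells ide cmp"
    and L: "cat2_over_Cat Y U' maps' V' cells' ide' cmp'"
    and F0: "\<And>x. x \<in> X \<Longrightarrow> F0 x \<in> Y" and U: "\<And>x. x \<in> X \<Longrightarrow> U' (F0 x) = U x"
    and F1: "\<And>x y. \<lbrakk>x \<in> X; y \<in> X\<rbrakk> \<Longrightarrow> bij_betw (F1 x) (maps x y) (maps' (F0 x) (F0 y))"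
    and V: "\<And>x y h. \<lbrakk>x \<in> X; y \<in> X; h \<in> maps x y\<rbrakk> \<Longrightarrow> V' (F1 x h) = V h"
    and cells: "\<And>x y h k. \<lbrakk>x \<in> X; y \<in> X; h \<in> maps x y; k \<in> maps x y\<rbrakk>
      \<Longrightarrow> cells' (F0 x) (F0 y) (F1 x h) (F1 x k) = cells x y h k"
    and ide: "\<And>x. x \<in> X \<Longrightarrow> F1 x (ide x) = ide' (F0 x)"
    and cmp: "\<And>x y z h k. \<lbrakk>x \<in> X; y \<in> X; z \<in> X; h \<in> maps x y; k \<in> maps y z\<rbrakk>
      \<Longrightarrow> F1 x (cmp x k h) = cmp' (F0 x) (F1 y k) (F1 x h)"
    and es: "\<And>y. y \<in> Y \<Longrightarrow> \<exists>x\<in>X. \<exists>f\<in>maps' (F0 x) y. \<exists>g\<in>maps' y (F0 x).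
      cmp' (F0 x) g f = ide' (F0 x) \<and> cmp' y f g = ide' y"
  shows "equivalent_2cats (cat2_over_Cat.the_cat2 X U maps V cells ide cmp)
    (cat2_over_Cat.the_cat2 Y U' maps' V' cells' ide' cmp')"
proof -
  interpret K: cat2_over_Cat X U maps V cells ide cmp by (rule K)
  interpret L: cat2_over_Cat Y U' maps' V' cells' ide' cmp' by (rule L)
  define F where
    "F = \<lparr>F2Ob = F0, F2Hom = (\<lambda>x y. mk_functor (K.hom_cat x y) (F1 x) (\<lambda>h k \<alpha>. \<alpha>))\<rparr>"
  have F1_maps [simp]: "F1 x h \<in> maps' (F0 x) (F0 y)" if "x \<in> X" "y \<in> X" "h \<in> maps x y" for x y h
    using F1[OF that(1,2)] that(3) by (auto simp: bij_betw_def)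
  have F2Ob [simp]: "F2Ob F = F0" by (simp add: F_def)
  have F2Hom_Ob [simp]: "FOb (F2Hom F x y) h = F1 x h" if "h \<in> maps x y" for x y h
    using that by (simp add: F_def)
  have F2Hom_Map [simp]: "FMap (F2Hom F x y) h k \<alpha> = \<alpha>"
    if "h \<in> maps x y" "k \<in> maps x y" "\<alpha> \<in> cells x y h k" for x y h k \<alpha>
    using that by (simp add: F_def)
  have F_functor: "is_functor (K.hom_cat x y) (L.hom_cat (F0 x) (F0 y)) (F2Hom F x y)"
    if xy: "x \<in> X" "y \<in> X" for x y
    unfolding F_def funct2.simps
    by (rule is_functor_mk_functorI)
      (use xy in \<open>simp_all add: K.category_hom_cat L.category_hom_cat F0 cells V U\<close>)
  have "is_equivalence (K.hom_cat x y) (L.hom_cat (F0 x) (F0 y)) (F2Hom F x y)"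
    if xy: "x \<in> X" "y \<in> X" for x y
  proof (rule fully_faithful_essentially_surjective_is_equivalence)
    fix h k assume "h \<in> Ob (K.hom_cat x y)" "k \<in> Ob (K.hom_cat x y)"
    then show "bij_betw (FMap (F2Hom F x y) h k) (Hom (K.hom_cat x y) h k)
        (Hom (L.hom_cat (F0 x) (F0 y)) (FOb (F2Hom F x y) h) (FOb (F2Hom F x y) k))"
      using xy by (auto simp: cells bij_betw_def inj_on_def image_iff)
  next
    fix h' assume "h' \<in> Ob (L.hom_cat (F0 x) (F0 y))"
    then obtain h where "h \<in> maps x y" "h' = F1 x h"
      using F1[OF xy] by (auto simp: bij_betw_def)
    then show "\<exists>h\<in>Ob (K.hom_cat x y). isomorphic (L.hom_cat (F0 x) (F0 y)) (FOb (F2Hom F x y) h) h'"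
      using xy by (auto intro!: bexI[of _ h] isomorphic_refl L.category_hom_cat F0)
  qed (rule F_functor[OF xy])
  moreover have "\<exists>x\<in>X. internally_equivalent L.the_cat2 (F0 x) y" if y: "y \<in> Y" for y
  proof -
    obtain x f g where *: "x \<in> X" "f \<in> maps' (F0 x) y" "g \<in> maps' y (F0 x)"
      "cmp' (F0 x) g f = ide' (F0 x)" "cmp' y f g = ide' y"
      using es[OF y] by blast
    then have "internally_equivalent L.the_cat2 (F0 x) y"
      unfolding internally_equivalent_def using y F0
      by (intro conjI bexI[of _ f] rev_bexI[of g])
        (auto simp: L.ide_maps intro!: isomorphic_refl L.category_hom_cat)
    then show ?thesis using * by blast
  qed
  moreover have "is_2functor K.the_cat2 L.the_cat2 F"
    unfolding is_2functor_def
    using K.two_category_the_cat2 L.two_category_the_cat2 F_functor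
    by (simp add: F0 K.ide_maps ide K.cmp_maps cmp K.hcomp_cells U V cells)
  ultimately show ?thesis
    unfolding equivalent_2cats_def is_2equivalence_def by (intro exI[of _ F]) simp
qed

section \<open>Presheaves\<close>

lemma op_cat_simps [simp]:
  "Ob (op_cat C) = Ob C" "Hom (op_cat C) x y = Hom C y x" "Ide (op_cat C) = Ide C"
  "Comp (op_cat C) x y z g f = Comp C z y x f g"
  by (simp_all add: op_cat_def)

lemma category_op_cat_iff [simp]: "category (op_cat C) \<longleftrightarrow> category C"
proof -
  have op: "category (op_cat D)" if "category D" for D :: "('a, 'b) cat"
    by (rule categoryI) (simp_all add: category_simps[OF that])
  have "op_cat (op_cat C) = C" by (simp add: op_cat_def)
  then show ?thesis using op[of C] op[of "op_cat C"] by auto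
qed

lemma set_cat_simps [simp]:
  "Ob set_cat = UNIV" "Hom set_cat A B = A \<rightarrow>\<^sub>E B" "Ide set_cat A = (\<lambda>x\<in>A. x)"
  "Comp set_cat A B D g f = compose A g f"
  by (simp_all add: set_cat_def)

lemma category_set_cat: "category set_cat"
  by (rule categoryI) (auto simp: compose_def PiE_def Pi_def fun_eq_iff extensional_def)

lemma
  assumes "P \<in> Ob (psh C)"
  shows psh_category: "category C"
    and psh_Map: "\<lbrakk>\<Gamma> \<in> Ob C; \<Delta> \<in> Ob C; f \<in> Hom C \<Delta> \<Gamma>; x \<in> FOb P \<Gamma>\<rbrakk> \<Longrightarrow> FMap P \<Gamma> \<Delta> f x \<in> FOb P \<Delta>"
    and psh_Ide: "\<lbrakk>\<Gamma> \<in> Ob C; x \<in> FOb P \<Gamma>\<rbrakk> \<Longrightarrow> FMap P \<Gamma> \<Gamma> (Ide C \<Gamma>) x = x"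
    and psh_Comp: "\<lbrakk>\<Gamma> \<in> Ob C; \<Delta> \<in> Ob C; \<Theta> \<in> Ob C; f \<in> Hom C \<Delta> \<Gamma>; g \<in> Hom C \<Theta> \<Delta>; x \<in> FOb P \<Gamma>\<rbrakk>
      \<Longrightarrow> FMap P \<Gamma> \<Theta> (Comp C \<Theta> \<Delta> \<Gamma> f g) x = FMap P \<Delta> \<Theta> g (FMap P \<Gamma> \<Delta> f x)"
proof -
  have P: "is_functor (op_cat C) set_cat P" using assms by (simp add: psh_def)
  show "category C" using functor_source[OF P] by simp
  show "FMap P \<Gamma> \<Delta> f x \<in> FOb P \<Delta>" if "\<Gamma> \<in> Ob C" "\<Delta> \<in> Ob C" "f \<in> Hom C \<Delta> \<Gamma>" "x \<in> FOb P \<Gamma>"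
    using functor_Hom[OF P, of \<Gamma> \<Delta> f] that by auto
  show "FMap P \<Gamma> \<Gamma> (Ide C \<Gamma>) x = x" if "\<Gamma> \<in> Ob C" "x \<in> FOb P \<Gamma>"
    using functor_Ide[OF P, of \<Gamma>] that by simp
  show "FMap P \<Gamma> \<Theta> (Comp C \<Theta> \<Delta> \<Gamma> f g) x = FMap P \<Delta> \<Theta> g (FMap P \<Gamma> \<Delta> f x)"
    if "\<Gamma> \<in> Ob C" "\<Delta> \<in> Ob C" "\<Theta> \<in> Ob C" "f \<in> Hom C \<Delta> \<Gamma>" "g \<in> Hom C \<Theta> \<Delta>" "x \<in> FOb P \<Gamma>"
    using functor_Comp[OF P, of \<Gamma> \<Delta> \<Theta> f g] that by (simp add: compose_def)
qed

lemmas psh_simps = psh_Map psh_Ide psh_Comp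

text \<open>The laws are asked for on elements of \<open>P0 \<Gamma>\<close> only: membership in
  \<open>\<rightarrow>\<^sub>E\<close> makes both sides extensional, so that they then agree as
  functions.\<close>

lemma mk_functor_pshI:
  assumes "category C"
    and "\<And>\<Gamma> \<Delta> f. \<lbrakk>\<Gamma> \<in> Ob C; \<Delta> \<in> Ob C; f \<in> Hom C \<Delta> \<Gamma>\<rbrakk> \<Longrightarrow> P1 \<Gamma> \<Delta> f \<in> P0 \<Gamma> \<rightarrow>\<^sub>E P0 \<Delta>"
    and "\<And>\<Gamma> x. \<lbrakk>\<Gamma> \<in> Ob C; x \<in> P0 \<Gamma>\<rbrakk> \<Longrightarrow> P1 \<Gamma> \<Gamma> (Ide C \<Gamma>) x = x"
    and "\<And>\<Gamma> \<Delta> \<Theta> f g x. \<lbrakk>\<Gamma> \<in> Ob C; \<Delta> \<in> Ob C; \<Theta> \<in> Ob C; f \<in> Hom C \<Delta> \<Gamma>; g \<in> Hom C \<Theta> \<Delta>; x \<in> P0 \<Gamma>\<rbrakk>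
      \<Longrightarrow> P1 \<Gamma> \<Theta> (Comp C \<Theta> \<Delta> \<Gamma> f g) x = P1 \<Delta> \<Theta> g (P1 \<Gamma> \<Delta> f x)"
  shows "mk_functor (op_cat C) P0 P1 \<in> Ob (psh C)"
proof -
  have "is_functor (op_cat C) set_cat (mk_functor (op_cat C) P0 P1)"
  proof (rule is_functor_mk_functorI)
    fix \<Gamma> assume \<Gamma>: "\<Gamma> \<in> Ob (op_cat C)"
    then have "P1 \<Gamma> \<Gamma> (Ide C \<Gamma>) \<in> P0 \<Gamma> \<rightarrow>\<^sub>E P0 \<Gamma>"
      by (simp add: assms(2) category_simps[OF assms(1)])
    then show "P1 \<Gamma> \<Gamma> (Ide (op_cat C) \<Gamma>) = Ide set_cat (P0 \<Gamma>)"
      using \<Gamma> by (auto simp: PiE_iff assms(3) intro!: extensionalityI[of _ "P0 \<Gamma>"])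
  next
    fix \<Gamma> \<Delta> \<Theta> f g
    assume *: "\<Gamma> \<in> Ob (op_cat C)" "\<Delta> \<in> Ob (op_cat C)" "\<Theta> \<in> Ob (op_cat C)"
      "f \<in> Hom (op_cat C) \<Gamma> \<Delta>" "g \<in> Hom (op_cat C) \<Delta> \<Theta>"
    then have "P1 \<Gamma> \<Theta> (Comp C \<Theta> \<Delta> \<Gamma> f g) \<in> P0 \<Gamma> \<rightarrow>\<^sub>E P0 \<Theta>"
      by (simp add: assms(2) category_simps[OF assms(1)])
    then show "P1 \<Gamma> \<Theta> (Comp (op_cat C) \<Gamma> \<Delta> \<Theta> g f)
        = Comp set_cat (P0 \<Gamma>) (P0 \<Delta>) (P0 \<Theta>) (P1 \<Delta> \<Theta> g) (P1 \<Gamma> \<Delta> f)"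
      using * by (auto simp: PiE_iff assms(4) compose_def intro!: extensionalityI[of _ "P0 \<Gamma>"])
  qed (use assms in \<open>simp_all add: category_set_cat\<close>)
  then show ?thesis by (simp add: psh_def)
qed

section \<open>Maps of presheaves, elementwise\<close>

lemma psh_Hom_iff:
  "\<tau> \<in> Hom (psh C) P Q \<longleftrightarrow> \<tau> \<in> extensional (Ob C) \<and>
     (\<forall>\<Gamma>\<in>Ob C. \<tau> \<Gamma> \<in> FOb P \<Gamma> \<rightarrow>\<^sub>E FOb Q \<Gamma>) \<and>
     (\<forall>\<Gamma>\<in>Ob C. \<forall>\<Delta>\<in>Ob C. \<forall>f\<in>Hom C \<Delta> \<Gamma>. \<forall>x\<in>FOb P \<Gamma>.
        \<tau> \<Delta> (FMap P \<Gamma> \<Delta> f x) = FMap Q \<Gamma> \<Delta> f (\<tau> \<Gamma> x))"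
proof -
  have "compose (FOb P \<Gamma>) (\<tau> \<Delta>) (FMap P \<Gamma> \<Delta> f) = compose (FOb P \<Gamma>) (FMap Q \<Gamma> \<Delta> f) (\<tau> \<Gamma>) \<longleftrightarrow>
      (\<forall>x\<in>FOb P \<Gamma>. \<tau> \<Delta> (FMap P \<Gamma> \<Delta> f x) = FMap Q \<Gamma> \<Delta> f (\<tau> \<Gamma> x))" for \<Gamma> \<Delta> f
    by (auto simp: compose_def restrict_def fun_eq_iff)
  then show ?thesis by (simp add: psh_def nat_trans_iff)
qed

lemma
  assumes "\<tau> \<in> Hom (psh C) P Q"
  shows psh_Hom_extensional: "\<tau> \<in> extensional (Ob C)"
    and psh_Hom_PiE: "\<Gamma> \<in> Ob C \<Longrightarrow> \<tau> \<Gamma> \<in> FOb P \<Gamma> \<rightarrow>\<^sub>E FOb Q \<Gamma>"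
    and psh_Hom_in: "\<lbrakk>\<Gamma> \<in> Ob C; x \<in> FOb P \<Gamma>\<rbrakk> \<Longrightarrow> \<tau> \<Gamma> x \<in> FOb Q \<Gamma>"
    and psh_Hom_natural: "\<lbrakk>\<Gamma> \<in> Ob C; \<Delta> \<in> Ob C; f \<in> Hom C \<Delta> \<Gamma>; x \<in> FOb P \<Gamma>\<rbrakk>
      \<Longrightarrow> \<tau> \<Delta> (FMap P \<Gamma> \<Delta> f x) = FMap Q \<Gamma> \<Delta> f (\<tau> \<Gamma> x)"
  using assms by (auto simp: psh_Hom_iff)

text \<open>Arrows of \<open>psh C\<close> are extensional both in the object and in the element, so
  their values decide equality; this is why the targets may differ.\<close>

lemma psh_Hom_eqI:
  assumes "\<sigma> \<in> Hom (psh C) P Q" "\<tau> \<in> Hom (psh C) P R"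
    and "\<And>\<Gamma> x. \<lbrakk>\<Gamma> \<in> Ob C; x \<in> FOb P \<Gamma>\<rbrakk> \<Longrightarrow> \<sigma> \<Gamma> x = \<tau> \<Gamma> x"
  shows "\<sigma> = \<tau>"
proof (rule extensionalityI[OF psh_Hom_extensional[OF assms(1)] psh_Hom_extensional[OF assms(2)]])
  fix \<Gamma> assume \<Gamma>: "\<Gamma> \<in> Ob C"
  then show "\<sigma> \<Gamma> = \<tau> \<Gamma>"
    using psh_Hom_PiE[OF assms(1) \<Gamma>] psh_Hom_PiE[OF assms(2) \<Gamma>] assms(3)
    by (auto simp: PiE_iff intro!: extensionalityI[of _ "FOb P \<Gamma>"])
qed

text \<open>Composites in \<open>psh C\<close> unfold to nested restricted abstractions, which this
  identifies with a given map.\<close>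

lemma psh_Hom_restrict_eqI:
  assumes "\<tau> \<in> Hom (psh C) P Q" "\<And>\<Gamma> x. \<lbrakk>\<Gamma> \<in> Ob C; x \<in> FOb P \<Gamma>\<rbrakk> \<Longrightarrow> f \<Gamma> x = \<tau> \<Gamma> x"
  shows "(\<lambda>\<Gamma>\<in>Ob C. \<lambda>x\<in>FOb P \<Gamma>. f \<Gamma> x) = \<tau>"
proof -
  have "(\<lambda>\<Gamma>\<in>Ob C. \<lambda>x\<in>FOb P \<Gamma>. f \<Gamma> x) \<Gamma> = \<tau> \<Gamma>" if "\<Gamma> \<in> Ob C" for \<Gamma>
    using that assms(2) psh_Hom_PiE[OF assms(1) that]
    by (auto simp: PiE_iff intro!: extensionalityI[of _ "FOb P \<Gamma>"])
  then show ?thesis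
    by (intro extensionalityI[OF _ psh_Hom_extensional[OF assms(1)]]) auto
qed

lemma psh_Ide_apply [simp]: "Ide (psh C) P = (\<lambda>\<Gamma>\<in>Ob C. \<lambda>x\<in>FOb P \<Gamma>. x)"
  and psh_Comp_apply [simp]:
    "Comp (psh C) P Q R \<sigma> \<tau> = (\<lambda>\<Gamma>\<in>Ob C. \<lambda>x\<in>FOb P \<Gamma>. \<sigma> \<Gamma> (\<tau> \<Gamma> x))"
  by (auto simp: psh_def compose_def)

lemma pull_psh_simps [simp]:
  "\<Gamma> \<in> Ob C \<Longrightarrow> FOb (pull_psh C F P) \<Gamma> = FOb P (FOb F \<Gamma>)"
  "\<lbrakk>\<Gamma> \<in> Ob C; \<Delta> \<in> Ob C; f \<in> Hom C \<Delta> \<Gamma>\<rbrakk>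
    \<Longrightarrow> FMap (pull_psh C F P) \<Gamma> \<Delta> f = FMap P (FOb F \<Gamma>) (FOb F \<Delta>) (FMap F \<Delta> \<Gamma> f)"
  by (simp_all add: pull_psh_def op_fun_def)

section \<open>The Yoneda embedding\<close>

lemma yoneda_simps [simp]:
  "\<Delta> \<in> Ob C \<Longrightarrow> FOb (yoneda C \<Gamma>) \<Delta> = Hom C \<Delta> \<Gamma>"
  "\<lbrakk>\<Delta> \<in> Ob C; \<Theta> \<in> Ob C; f \<in> Hom C \<Theta> \<Delta>; g \<in> Hom C \<Delta> \<Gamma>\<rbrakk>
    \<Longrightarrow> FMap (yoneda C \<Gamma>) \<Delta> \<Theta> f g = Comp C \<Theta> \<Delta> \<Gamma> g f"
  by (simp_all add: yoneda_def)

lemma yoneda_psh: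
  assumes C: "category C" and "\<Gamma> \<in> Ob C"
  shows "yoneda C \<Gamma> \<in> Ob (psh C)"
  unfolding yoneda_def
  by (rule mk_functor_pshI) (use assms in \<open>auto simp: category_simps[OF C]\<close>)

lemma yoneda_elem_apply [simp]:
  "\<lbrakk>\<Delta> \<in> Ob C; f \<in> Hom C \<Delta> \<Gamma>\<rbrakk> \<Longrightarrow> yoneda_elem C P \<Gamma> x \<Delta> f = FMap P \<Gamma> \<Delta> f x"
  by (simp add: yoneda_elem_def)

lemma yoneda_elem_Hom:
  assumes "P \<in> Ob (psh C)" "\<Gamma> \<in> Ob C" "x \<in> FOb P \<Gamma>"
  shows "yoneda_elem C P \<Gamma> x \<in> Hom (psh C) (yoneda C \<Gamma>) P"
  using assms by (auto simp: psh_Hom_iff psh_simps[OF assms(1)] yoneda_elem_def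
      category_simps[OF psh_category[OF assms(1)]])

text \<open>The image of \<open>\<pi>\<close> under the Yoneda embedding is the map that classifies
  \<open>\<pi>\<close> as an element of the presheaf represented by \<open>\<Gamma>\<close>. Facts
  on \<open>yoneda_elem\<close> thereby apply to \<open>yoneda_map\<close>.\<close>

lemma yoneda_map_eq_yoneda_elem:
  assumes "category C" "\<Gamma> \<in> Ob C" "E \<in> Ob C" "\<pi> \<in> Hom C E \<Gamma>"
  shows "yoneda_map C E \<Gamma> \<pi> = yoneda_elem C (yoneda C \<Gamma>) E \<pi>"
  using assms by (auto simp: yoneda_map_def yoneda_elem_def intro!: restrict_ext)

lemma yoneda_lemma:
  assumes P: "P \<in> Ob (psh C)" and \<Gamma>: "\<Gamma> \<in> Ob C" and \<tau>: "\<tau> \<in> Hom (psh C) (yoneda C \<Gamma>) P"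
  shows "\<tau> \<Gamma> (Ide C \<Gamma>) \<in> FOb P \<Gamma>" and "\<tau> = yoneda_elem C P \<Gamma> (\<tau> \<Gamma> (Ide C \<Gamma>))"
proof -
  note [simp] = category_simps[OF psh_category[OF P]]
  show x: "\<tau> \<Gamma> (Ide C \<Gamma>) \<in> FOb P \<Gamma>"
    using \<Gamma> by (simp add: psh_Hom_in[OF \<tau>])
  show "\<tau> = yoneda_elem C P \<Gamma> (\<tau> \<Gamma> (Ide C \<Gamma>))"
  proof (rule psh_Hom_eqI[OF \<tau> yoneda_elem_Hom[OF P \<Gamma> x]])
    fix \<Delta> f assume *: "\<Delta> \<in> Ob C" "f \<in> FOb (yoneda C \<Gamma>) \<Delta>"
    then show "\<tau> \<Delta> f = yoneda_elem C P \<Gamma> (\<tau> \<Gamma> (Ide C \<Gamma>)) \<Delta> f"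
      using \<Gamma> psh_Hom_natural[OF \<tau>, of \<Gamma> \<Delta> f "Ide C \<Gamma>"] by simp
  qed
qed

section \<open>Presheaves on a category of elements\<close>

lemma elements_simps [simp]:
  "Ob (elements C P) = (SIGMA \<Gamma>:Ob C. FOb P \<Gamma>)"
  "Hom (elements C P) (\<Delta>, B) (\<Gamma>, A) = {f \<in> Hom C \<Delta> \<Gamma>. FMap P \<Gamma> \<Delta> f A = B}"
  "Ide (elements C P) (\<Gamma>, A) = Ide C \<Gamma>"
  "Comp (elements C P) (\<Theta>, D) (\<Delta>, B) (\<Gamma>, A) g f = Comp C \<Theta> \<Delta> \<Gamma> g f"
  by (simp_all add: elements_def)

lemma category_elements:
  assumes P: "P \<in> Ob (psh C)"
  shows "category (elements C P)"
  by (rule categoryI)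
    (auto simp: category_simps[OF psh_category[OF P]] psh_simps[OF P])

text \<open>The type reached at the end is a variable \<open>B\<close> with an equation as premise,
  so that the rules match however the restricted type happens to be written.\<close>

lemma
  assumes P: "P \<in> Ob (psh C)" and Q: "Q \<in> Ob (psh (elements C P))"
  shows elements_psh_Map: "\<lbrakk>\<Gamma> \<in> Ob C; \<Delta> \<in> Ob C; f \<in> Hom C \<Delta> \<Gamma>; A \<in> FOb P \<Gamma>; B = FMap P \<Gamma> \<Delta> f A;
      a \<in> FOb Q (\<Gamma>, A)\<rbrakk> \<Longrightarrow> FMap Q (\<Gamma>, A) (\<Delta>, B) f a \<in> FOb Q (\<Delta>, B)"
    and elements_psh_Ide: "\<lbrakk>\<Gamma> \<in> Ob C; A \<in> FOb P \<Gamma>; a \<in> FOb Q (\<Gamma>, A)\<rbrakk>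
      \<Longrightarrow> FMap Q (\<Gamma>, A) (\<Gamma>, A) (Ide C \<Gamma>) a = a"
    and elements_psh_Comp: "\<lbrakk>\<Gamma> \<in> Ob C; \<Delta> \<in> Ob C; \<Theta> \<in> Ob C; f \<in> Hom C \<Delta> \<Gamma>; g \<in> Hom C \<Theta> \<Delta>;
      A \<in> FOb P \<Gamma>; B = FMap P \<Delta> \<Theta> g (FMap P \<Gamma> \<Delta> f A); a \<in> FOb Q (\<Gamma>, A)\<rbrakk>
      \<Longrightarrow> FMap Q (\<Gamma>, A) (\<Theta>, B) (Comp C \<Theta> \<Delta> \<Gamma> f g) a
        = FMap Q (\<Delta>, FMap P \<Gamma> \<Delta> f A) (\<Theta>, B) g (FMap Q (\<Gamma>, A) (\<Delta>, FMap P \<Gamma> \<Delta> f A) f a)"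
  using psh_Map[OF Q, of "(\<Gamma>, A)" "(\<Delta>, B)" f a] psh_Ide[OF Q, of "(\<Gamma>, A)" a]
    psh_Comp[OF Q, of "(\<Gamma>, A)" "(\<Delta>, FMap P \<Gamma> \<Delta> f A)" "(\<Theta>, B)" f g a]
  by (simp_all add: psh_simps[OF P])

text \<open>An arrow of the category of elements is an arrow \<open>f\<close> together with a type
  \<open>A\<close> over its codomain, the type over its domain being determined; so the laws can be
  indexed by \<open>f\<close> and \<open>A\<close> alone.\<close>

lemma mk_functor_elements_pshI:
  assumes P: "P \<in> Ob (psh C)"
    and "\<And>\<Gamma> \<Delta> f A. \<lbrakk>\<Gamma> \<in> Ob C; \<Delta> \<in> Ob C; f \<in> Hom C \<Delta> \<Gamma>; A \<in> FOb P \<Gamma>\<rbrakk>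
      \<Longrightarrow> Q1 (\<Gamma>, A) (\<Delta>, FMap P \<Gamma> \<Delta> f A) f \<in> Q0 (\<Gamma>, A) \<rightarrow>\<^sub>E Q0 (\<Delta>, FMap P \<Gamma> \<Delta> f A)"
    and "\<And>\<Gamma> A a. \<lbrakk>\<Gamma> \<in> Ob C; A \<in> FOb P \<Gamma>; a \<in> Q0 (\<Gamma>, A)\<rbrakk> \<Longrightarrow> Q1 (\<Gamma>, A) (\<Gamma>, A) (Ide C \<Gamma>) a = a"
    and "\<And>\<Gamma> \<Delta> \<Theta> f g A a. \<lbrakk>\<Gamma> \<in> Ob C; \<Delta> \<in> Ob C; \<Theta> \<in> Ob C; f \<in> Hom C \<Delta> \<Gamma>; g \<in> Hom C \<Theta> \<Delta>;
        A \<in> FOb P \<Gamma>; a \<in> Q0 (\<Gamma>, A)\<rbrakk>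
      \<Longrightarrow> Q1 (\<Gamma>, A) (\<Theta>, FMap P \<Delta> \<Theta> g (FMap P \<Gamma> \<Delta> f A)) (Comp C \<Theta> \<Delta> \<Gamma> f g) a
        = Q1 (\<Delta>, FMap P \<Gamma> \<Delta> f A) (\<Theta>, FMap P \<Delta> \<Theta> g (FMap P \<Gamma> \<Delta> f A)) g
            (Q1 (\<Gamma>, A) (\<Delta>, FMap P \<Gamma> \<Delta> f A) f a)"
  shows "mk_functor (op_cat (elements C P)) Q0 Q1 \<in> Ob (psh (elements C P))"
proof (rule mk_functor_pshI)
  show "category (elements C P)" using P by (rule category_elements)
  show "Q1 \<Gamma>A \<Delta>B f \<in> Q0 \<Gamma>A \<rightarrow>\<^sub>E Q0 \<Delta>B"
    if "\<Gamma>A \<in> Ob (elements C P)" "\<Delta>B \<in> Ob (elements C P)" "f \<in> Hom (elements C P) \<Delta>B \<Gamma>A" for \<Gamma>A \<Delta>B f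
    using that assms(2) by (cases \<Gamma>A; cases \<Delta>B) auto
qed (use assms(3,4) in auto)

lemma elements_fun_Ob [simp]:
  "\<lbrakk>\<Gamma> \<in> Ob C; A \<in> FOb P \<Gamma>\<rbrakk> \<Longrightarrow> FOb (elements_fun C P F \<phi>) (\<Gamma>, A) = (FOb F \<Gamma>, \<phi> \<Gamma> A)"
  and elements_fun_Map [simp]:
  "\<lbrakk>\<Gamma> \<in> Ob C; A \<in> FOb P \<Gamma>; \<Delta> \<in> Ob C; B \<in> FOb P \<Delta>; f \<in> Hom C \<Delta> \<Gamma>; FMap P \<Gamma> \<Delta> f A = B\<rbrakk>
    \<Longrightarrow> FMap (elements_fun C P F \<phi>) (\<Delta>, B) (\<Gamma>, A) f = FMap F \<Delta> \<Gamma> f"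
  by (simp_all add: elements_fun_def)

section \<open>Natural models\<close>

text \<open>The part of \<open>natural_model\<close> without representability, for use while
  representing pullbacks are still being constructed. It is polymorphic in the record extension,
  hence common to plain and structured models.\<close>

definition premodel :: "('u, 'z) natmod_scheme \<Rightarrow> bool" where
  "premodel M \<longleftrightarrow> category (nm_cat M) \<and> nm_Ty M \<in> Ob (psh (nm_cat M)) \<and>
     nm_Tm M \<in> Ob (psh (nm_cat M)) \<and> nm_p M \<in> Hom (psh (nm_cat M)) (nm_Tm M) (nm_Ty M)"

lemma
  assumes "premodel M"
  shows premodel_category: "category (nm_cat M)"
    and premodel_Ty: "nm_Ty M \<in> Ob (psh (nm_cat M))"
    and premodel_Tm: "nm_Tm M \<in> Ob (psh (nm_cat M))"
    and premodel_p: "nm_p M \<in> Hom (psh (nm_cat M)) (nm_Tm M) (nm_Ty M)"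
  using assms by (simp_all add: premodel_def)

lemma natural_model_premodel: "natural_model M \<Longrightarrow> premodel M"
  by (simp add: natural_model_def premodel_def representable_map_def)

text \<open>The Yoneda lemma, in two directions. A cone from the representable at
  \<open>\<Delta>\<close> is an arrow \<open>f\<close> with a term \<open>a\<close> of matching
  type, so testing on representables gives the right-hand side. Conversely, a cone from a presheaf
  \<open>T\<close> gives such a pair for each element of \<open>T\<close>, and the pointwise
  solutions form a map of presheaves because each is unique.\<close>

lemma representing_pullback_iff:
  assumes M: "premodel M"
  shows "representing_pullback M \<Gamma> A E \<pi> q \<longleftrightarrow>
    \<Gamma> \<in> Ob (nm_cat M) \<and> A \<in> FOb (nm_Ty M) \<Gamma> \<and> E \<in> Ob (nm_cat M) \<and> \<pi> \<in> Hom (nm_cat M) E \<Gamma> \<and>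
    q \<in> FOb (nm_Tm M) E \<and> nm_p M E q = FMap (nm_Ty M) \<Gamma> E \<pi> A \<and>
    (\<forall>\<Delta>\<in>Ob (nm_cat M). \<forall>f\<in>Hom (nm_cat M) \<Delta> \<Gamma>. \<forall>a\<in>FOb (nm_Tm M) \<Delta>.
      nm_p M \<Delta> a = FMap (nm_Ty M) \<Gamma> \<Delta> f A \<longrightarrow>
      (\<exists>!g. g \<in> Hom (nm_cat M) \<Delta> E \<and> Comp (nm_cat M) \<Delta> E \<Gamma> \<pi> g = f \<and> FMap (nm_Tm M) E \<Delta> g q = a))"
    (is "?l \<longleftrightarrow> ?r")
proof -
  define C Ty Tm p where "C = nm_cat M" and "Ty = nm_Ty M" and "Tm = nm_Tm M" and "p = nm_p M"
  note folds = C_def[symmetric] Ty_def[symmetric] Tm_def[symmetric] p_def[symmetric]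
  have C: "category C" and Ty: "Ty \<in> Ob (psh C)" and Tm: "Tm \<in> Ob (psh C)"
    and p: "p \<in> Hom (psh C) Tm Ty"
    using M by (simp_all add: premodel_def C_def Ty_def Tm_def p_def)
  note [simp] = category_simps[OF C] psh_simps[OF Ty] psh_simps[OF Tm] psh_Hom_in[OF p]
    psh_Hom_natural[OF p] yoneda_psh[OF C]
  \<comment> \<open>Composites of presheaf maps stay folded unless asked for, keeping the cone
    equations in the form used by \<open>is_pullback\<close>.\<close>
  note [simp del] = psh_Comp_apply
  \<comment> \<open>Commutativity of the square is an equation between maps out of the representable
    at \<open>E\<close>, so it is decided at the identity of \<open>E\<close>.\<close>
  have commutes: "Comp (psh C) (yoneda C E) (yoneda C \<Gamma>) Ty (yoneda_elem C Ty \<Gamma> A) (yoneda_map C E \<Gamma> \<pi>)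
      = Comp (psh C) (yoneda C E) Tm Ty p (yoneda_elem C Tm E q) \<longleftrightarrow> p E q = FMap Ty \<Gamma> E \<pi> A"
    if "\<Gamma> \<in> Ob C" "A \<in> FOb Ty \<Gamma>" "E \<in> Ob C" "\<pi> \<in> Hom C E \<Gamma>" "q \<in> FOb Tm E"
    for \<Gamma> A E \<pi> q
  proof
    assume "Comp (psh C) (yoneda C E) (yoneda C \<Gamma>) Ty (yoneda_elem C Ty \<Gamma> A) (yoneda_map C E \<Gamma> \<pi>)
      = Comp (psh C) (yoneda C E) Tm Ty p (yoneda_elem C Tm E q)"
    from fun_cong[OF fun_cong[OF this], of E "Ide C E"] show "p E q = FMap Ty \<Gamma> E \<pi> A"
      using that by (simp add: yoneda_map_def psh_Comp_apply)
  qed (use that in \<open>auto simp: yoneda_map_def psh_Comp_apply intro!: restrict_ext\<close>)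
  show ?thesis
    unfolding folds
  proof
    assume ?l
    then have *: "\<Gamma> \<in> Ob C" "A \<in> FOb Ty \<Gamma>" "E \<in> Ob C" "\<pi> \<in> Hom C E \<Gamma>" "q \<in> FOb Tm E"
      and pb: "is_pullback (psh C) (yoneda C E) (yoneda C \<Gamma>) Tm Ty (yoneda_map C E \<Gamma> \<pi>)
        (yoneda_elem C Tm E q) (yoneda_elem C Ty \<Gamma> A) p"
      by (simp_all add: representing_pullback_def folds)
    have univ: "\<exists>!m. m \<in> Hom (psh C) T (yoneda C E) \<and>
        Comp (psh C) T (yoneda C E) (yoneda C \<Gamma>) (yoneda_map C E \<Gamma> \<pi>) m = h \<and>
        Comp (psh C) T (yoneda C E) Tm (yoneda_elem C Tm E q) m = k"
      if "T \<in> Ob (psh C)" "h \<in> Hom (psh C) T (yoneda C \<Gamma>)" "k \<in> Hom (psh C) T Tm"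
        "Comp (psh C) T (yoneda C \<Gamma>) Ty (yoneda_elem C Ty \<Gamma> A) h = Comp (psh C) T Tm Ty p k" for T h k
      using pb that unfolding is_pullback_def by blast
    have "\<exists>!g. g \<in> Hom C \<Delta> E \<and> Comp C \<Delta> E \<Gamma> \<pi> g = f \<and> FMap Tm E \<Delta> g q = a"
      if \<Delta>: "\<Delta> \<in> Ob C" "f \<in> Hom C \<Delta> \<Gamma>" "a \<in> FOb Tm \<Delta>" "p \<Delta> a = FMap Ty \<Gamma> \<Delta> f A" for \<Delta> f a
    proof -
      let ?P = "\<lambda>m. m \<in> Hom (psh C) (yoneda C \<Delta>) (yoneda C E) \<and>
        Comp (psh C) (yoneda C \<Delta>) (yoneda C E) (yoneda C \<Gamma>) (yoneda_map C E \<Gamma> \<pi>) m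
          = yoneda_map C \<Delta> \<Gamma> f \<and>
        Comp (psh C) (yoneda C \<Delta>) (yoneda C E) Tm (yoneda_elem C Tm E q) m = yoneda_elem C Tm \<Delta> a"
      have ex1: "\<exists>!m. ?P m"
      proof (rule univ)
        show "yoneda_map C \<Delta> \<Gamma> f \<in> Hom (psh C) (yoneda C \<Delta>) (yoneda C \<Gamma>)"
          using \<Delta> * yoneda_elem_Hom[of "yoneda C \<Gamma>" C \<Delta> f] by (simp add: yoneda_map_eq_yoneda_elem C)
        show "yoneda_elem C Tm \<Delta> a \<in> Hom (psh C) (yoneda C \<Delta>) Tm"
          using \<Delta> Tm by (simp add: yoneda_elem_Hom)
        show "Comp (psh C) (yoneda C \<Delta>) (yoneda C \<Gamma>) Ty (yoneda_elem C Ty \<Gamma> A) (yoneda_map C \<Delta> \<Gamma> f)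
          = Comp (psh C) (yoneda C \<Delta>) Tm Ty p (yoneda_elem C Tm \<Delta> a)"
          using \<Delta> * by (simp add: commutes)
      qed (use \<Delta> in simp)
      \<comment> \<open>For mediating maps induced by an arrow \<open>g\<close>, the cone equations
        are the equations for \<open>g\<close>: evaluation at the identity of
        \<open>\<Delta>\<close> gives one direction, functoriality of restriction the other.\<close>
      have P_iff: "?P (yoneda_map C \<Delta> E g) \<longleftrightarrow> Comp C \<Delta> E \<Gamma> \<pi> g = f \<and> FMap Tm E \<Delta> g q = a"
        if g: "g \<in> Hom C \<Delta> E" for g
      proof
        assume P: "?P (yoneda_map C \<Delta> E g)"
        have "Comp (psh C) (yoneda C \<Delta>) (yoneda C E) (yoneda C \<Gamma>) (yoneda_map C E \<Gamma> \<pi>)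
          (yoneda_map C \<Delta> E g) \<Delta> (Ide C \<Delta>) = yoneda_map C \<Delta> \<Gamma> f \<Delta> (Ide C \<Delta>)"
          "Comp (psh C) (yoneda C \<Delta>) (yoneda C E) Tm (yoneda_elem C Tm E q)
          (yoneda_map C \<Delta> E g) \<Delta> (Ide C \<Delta>) = yoneda_elem C Tm \<Delta> a \<Delta> (Ide C \<Delta>)"
          using P by simp_all
        then show "Comp C \<Delta> E \<Gamma> \<pi> g = f \<and> FMap Tm E \<Delta> g q = a"
          using \<Delta> * g by (simp add: psh_Comp_apply yoneda_map_def)
      next
        assume "Comp C \<Delta> E \<Gamma> \<pi> g = f \<and> FMap Tm E \<Delta> g q = a"
        then show "?P (yoneda_map C \<Delta> E g)"
          using \<Delta> * g yoneda_elem_Hom[of "yoneda C E" C \<Delta> g]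
          by (auto simp: psh_Comp_apply yoneda_map_eq_yoneda_elem C yoneda_elem_def intro!: restrict_ext)
      qed
      obtain m where m: "?P m" and m_unique: "\<And>m'. ?P m' \<Longrightarrow> m' = m"
        using ex1 by blast
      \<comment> \<open>By the Yoneda lemma every mediating map is composition with the arrow that
        it assigns to the identity.\<close>
      define g where "g = m \<Delta> (Ide C \<Delta>)"
      have g: "g \<in> Hom C \<Delta> E" "m = yoneda_map C \<Delta> E g"
        using yoneda_lemma[of "yoneda C E" C \<Delta> m] m \<Delta> *
        by (simp_all add: g_def yoneda_map_eq_yoneda_elem C)
      show ?thesis
      proof (rule ex1I[of _ g])
        show "g \<in> Hom C \<Delta> E \<and> Comp C \<Delta> E \<Gamma> \<pi> g = f \<and> FMap Tm E \<Delta> g q = a"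
          using m g P_iff[of g] by simp
        fix g' assume g': "g' \<in> Hom C \<Delta> E \<and> Comp C \<Delta> E \<Gamma> \<pi> g' = f \<and> FMap Tm E \<Delta> g' q = a"
        then have "yoneda_map C \<Delta> E g' = m"
          using m_unique P_iff[of g'] by blast
        then have "yoneda_map C \<Delta> E g' \<Delta> (Ide C \<Delta>) = g" by (simp add: g_def)
        then show "g' = g" using g' \<Delta> * by (simp add: yoneda_map_def)
      qed
    qed
    then show "\<Gamma> \<in> Ob C \<and> A \<in> FOb Ty \<Gamma> \<and> E \<in> Ob C \<and> \<pi> \<in> Hom C E \<Gamma> \<and> q \<in> FOb Tm E \<and>
      p E q = FMap Ty \<Gamma> E \<pi> A \<and>
      (\<forall>\<Delta>\<in>Ob C. \<forall>f\<in>Hom C \<Delta> \<Gamma>. \<forall>a\<in>FOb Tm \<Delta>. p \<Delta> a = FMap Ty \<Gamma> \<Delta> f A \<longrightarrow>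
        (\<exists>!g. g \<in> Hom C \<Delta> E \<and> Comp C \<Delta> E \<Gamma> \<pi> g = f \<and> FMap Tm E \<Delta> g q = a))"
      using * pb commutes[OF *] by (simp add: is_pullback_def)
  next
    assume r: "\<Gamma> \<in> Ob C \<and> A \<in> FOb Ty \<Gamma> \<and> E \<in> Ob C \<and> \<pi> \<in> Hom C E \<Gamma> \<and> q \<in> FOb Tm E \<and>
      p E q = FMap Ty \<Gamma> E \<pi> A \<and>
      (\<forall>\<Delta>\<in>Ob C. \<forall>f\<in>Hom C \<Delta> \<Gamma>. \<forall>a\<in>FOb Tm \<Delta>. p \<Delta> a = FMap Ty \<Gamma> \<Delta> f A \<longrightarrow>
        (\<exists>!g. g \<in> Hom C \<Delta> E \<and> Comp C \<Delta> E \<Gamma> \<pi> g = f \<and> FMap Tm E \<Delta> g q = a))"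
    then have *: "\<Gamma> \<in> Ob C" "A \<in> FOb Ty \<Gamma>" "E \<in> Ob C" "\<pi> \<in> Hom C E \<Gamma>" "q \<in> FOb Tm E"
      "p E q = FMap Ty \<Gamma> E \<pi> A"
      and ex1: "\<And>\<Delta> f a. \<lbrakk>\<Delta> \<in> Ob C; f \<in> Hom C \<Delta> \<Gamma>; a \<in> FOb Tm \<Delta>; p \<Delta> a = FMap Ty \<Gamma> \<Delta> f A\<rbrakk>
        \<Longrightarrow> \<exists>!g. g \<in> Hom C \<Delta> E \<and> Comp C \<Delta> E \<Gamma> \<pi> g = f \<and> FMap Tm E \<Delta> g q = a"
      by blast+
    have "\<exists>!m. m \<in> Hom (psh C) T (yoneda C E) \<and>
        Comp (psh C) T (yoneda C E) (yoneda C \<Gamma>) (yoneda_map C E \<Gamma> \<pi>) m = h \<and>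
        Comp (psh C) T (yoneda C E) Tm (yoneda_elem C Tm E q) m = k"
      if T: "T \<in> Ob (psh C)" and h: "h \<in> Hom (psh C) T (yoneda C \<Gamma>)" and k: "k \<in> Hom (psh C) T Tm"
        and hk: "Comp (psh C) T (yoneda C \<Gamma>) Ty (yoneda_elem C Ty \<Gamma> A) h = Comp (psh C) T Tm Ty p k"
      for T h k
    proof -
      have h_in [simp]: "h \<Delta> t \<in> Hom C \<Delta> \<Gamma>" if "\<Delta> \<in> Ob C" "t \<in> FOb T \<Delta>" for \<Delta> t
        using psh_Hom_in[OF h that] that by simp
      note [simp] = psh_Hom_in[OF k] psh_Map[OF T]
      have ex1_hk: "\<exists>!g. g \<in> Hom C \<Delta> E \<and> Comp C \<Delta> E \<Gamma> \<pi> g = h \<Delta> t \<and> FMap Tm E \<Delta> g q = k \<Delta> t"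
        if "\<Delta> \<in> Ob C" "t \<in> FOb T \<Delta>" for \<Delta> t
        using that fun_cong[OF fun_cong[OF hk], of \<Delta> t] by (intro ex1) (simp_all add: psh_Comp_apply)
      then obtain m where m: "\<And>\<Delta> t. \<lbrakk>\<Delta> \<in> Ob C; t \<in> FOb T \<Delta>\<rbrakk> \<Longrightarrow>
          m \<Delta> t \<in> Hom C \<Delta> E \<and> Comp C \<Delta> E \<Gamma> \<pi> (m \<Delta> t) = h \<Delta> t \<and> FMap Tm E \<Delta> (m \<Delta> t) q = k \<Delta> t"
        by metis
      have m_eq: "g = m \<Delta> t" if "\<Delta> \<in> Ob C" "t \<in> FOb T \<Delta>" "g \<in> Hom C \<Delta> E"
        "Comp C \<Delta> E \<Gamma> \<pi> g = h \<Delta> t" "FMap Tm E \<Delta> g q = k \<Delta> t" for \<Delta> t g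
        using ex1_hk[OF that(1,2)] m[OF that(1,2)] that(3-5) by blast
      define m' where "m' = (\<lambda>\<Delta>\<in>Ob C. \<lambda>t\<in>FOb T \<Delta>. m \<Delta> t)"
      have m': "m' \<in> Hom (psh C) T (yoneda C E)"
        unfolding psh_Hom_iff
      proof (intro conjI ballI)
        fix \<Delta> \<Theta> f t assume f: "\<Delta> \<in> Ob C" "\<Theta> \<in> Ob C" "f \<in> Hom C \<Theta> \<Delta>" "t \<in> FOb T \<Delta>"
        \<comment> \<open>Restricting the solution for \<open>t\<close> along \<open>f\<close>
          solves the equations for the restriction of \<open>t\<close>. By uniqueness it is the
          solution there, which is naturality.\<close>
        have "Comp C \<Theta> \<Delta> E (m \<Delta> t) f = m \<Theta> (FMap T \<Delta> \<Theta> f t)"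
          by (rule m_eq) (use f * m psh_Hom_natural[OF h, of \<Delta> \<Theta> f t] psh_Hom_natural[OF k, of \<Delta> \<Theta> f t]
            in \<open>simp_all add: category_assoc[OF C, symmetric] del: category_assoc[OF C]\<close>)
        then show "m' \<Theta> (FMap T \<Delta> \<Theta> f t) = FMap (yoneda C E) \<Delta> \<Theta> f (m' \<Delta> t)"
          using f m by (simp add: m'_def)
      qed (use m in \<open>auto simp: m'_def\<close>)
      show ?thesis
      proof (rule ex1I[of _ m'])
        show "m' \<in> Hom (psh C) T (yoneda C E) \<and>
          Comp (psh C) T (yoneda C E) (yoneda C \<Gamma>) (yoneda_map C E \<Gamma> \<pi>) m' = h \<and>
          Comp (psh C) T (yoneda C E) Tm (yoneda_elem C Tm E q) m' = k"
          unfolding psh_Comp_apply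
          by (intro conjI m' psh_Hom_restrict_eqI[OF h] psh_Hom_restrict_eqI[OF k])
            (use m in \<open>simp_all add: m'_def yoneda_map_def\<close>)
        fix n assume n: "n \<in> Hom (psh C) T (yoneda C E) \<and>
          Comp (psh C) T (yoneda C E) (yoneda C \<Gamma>) (yoneda_map C E \<Gamma> \<pi>) n = h \<and>
          Comp (psh C) T (yoneda C E) Tm (yoneda_elem C Tm E q) n = k"
        show "n = m'"
        proof (rule psh_Hom_eqI[OF _ m'])
          show "n \<in> Hom (psh C) T (yoneda C E)" using n by blast
          fix \<Delta> t assume \<Delta>: "\<Delta> \<in> Ob C" "t \<in> FOb T \<Delta>"
          have n_in: "n \<Delta> t \<in> Hom C \<Delta> E"
            using psh_Hom_in[of n C T "yoneda C E" \<Delta> t] n \<Delta> by simp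
          have "Comp (psh C) T (yoneda C E) (yoneda C \<Gamma>) (yoneda_map C E \<Gamma> \<pi>) n \<Delta> t = h \<Delta> t"
            "Comp (psh C) T (yoneda C E) Tm (yoneda_elem C Tm E q) n \<Delta> t = k \<Delta> t"
            using n by simp_all
          then have "n \<Delta> t = m \<Delta> t"
            using \<Delta> n_in * by (intro m_eq) (simp_all add: psh_Comp_apply yoneda_map_def)
          then show "n \<Delta> t = m' \<Delta> t" using \<Delta> by (simp add: m'_def)
        qed
      qed
    qed
    then have "is_pullback (psh C) (yoneda C E) (yoneda C \<Gamma>) Tm Ty (yoneda_map C E \<Gamma> \<pi>)
        (yoneda_elem C Tm E q) (yoneda_elem C Ty \<Gamma> A) p"
      unfolding is_pullback_def
      using * Ty Tm p commutes[OF *(1-5)] yoneda_elem_Hom[OF Ty *(1,2)] yoneda_elem_Hom[OF Tm *(3,5)]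
        yoneda_elem_Hom[OF yoneda_psh[OF C *(1)] *(3), of \<pi>]
      by (simp add: yoneda_map_eq_yoneda_elem C)
    then show ?l
      using * by (simp add: representing_pullback_def folds)
  qed
qed

text \<open>Representability is stated for maps of presheaves and unspecified legs \<open>u\<close>
  and \<open>v\<close>. The Yoneda lemma replaces the map into \<open>Ty\<close> by a type, and the
  legs by a projection and a term.\<close>

lemma natural_model_iff:
  assumes M: "premodel M"
  shows "natural_model M \<longleftrightarrow>
    (\<forall>\<Gamma>\<in>Ob (nm_cat M). \<forall>A\<in>FOb (nm_Ty M) \<Gamma>. \<exists>E \<pi> q. representing_pullback M \<Gamma> A E \<pi> q)"
proof -
  define C Ty Tm p where "C = nm_cat M" and "Ty = nm_Ty M" and "Tm = nm_Tm M" and "p = nm_p M"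
  note folds = C_def[symmetric] Ty_def[symmetric] Tm_def[symmetric] p_def[symmetric]
  have C: "category C" and Ty: "Ty \<in> Ob (psh C)" and Tm: "Tm \<in> Ob (psh C)"
    and p: "p \<in> Hom (psh C) Tm Ty"
    using M by (simp_all add: premodel_def C_def Ty_def Tm_def p_def)
  show ?thesis
    unfolding folds
  proof (intro iffI ballI)
    fix \<Gamma> A assume M: "natural_model M" and \<Gamma>: "\<Gamma> \<in> Ob C" and A: "A \<in> FOb Ty \<Gamma>"
    have "\<exists>E\<in>Ob C. \<exists>u v.
        is_pullback (psh C) (yoneda C E) (yoneda C \<Gamma>) Tm Ty u v (yoneda_elem C Ty \<Gamma> A) p"
      using M \<Gamma> yoneda_elem_Hom[OF Ty \<Gamma> A]
      unfolding natural_model_def representable_map_def folds by blast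
    then obtain E u v where E: "E \<in> Ob C" and
      pb: "is_pullback (psh C) (yoneda C E) (yoneda C \<Gamma>) Tm Ty u v (yoneda_elem C Ty \<Gamma> A) p"
      by blast
    then have u: "u \<in> Hom (psh C) (yoneda C E) (yoneda C \<Gamma>)" and v: "v \<in> Hom (psh C) (yoneda C E) Tm"
      by (simp_all add: is_pullback_def)
    \<comment> \<open>The projection and the generic term are the values of the two legs at the
      identity of \<open>E\<close>.\<close>
    have "u E (Ide C E) \<in> Hom C E \<Gamma>" "u = yoneda_map C E \<Gamma> (u E (Ide C E))"
      using yoneda_lemma[OF yoneda_psh[OF C \<Gamma>] E u] E \<Gamma> C
      by (simp_all add: yoneda_map_eq_yoneda_elem)
    moreover note yoneda_lemma[OF Tm E v]
    ultimately have "representing_pullback M \<Gamma> A E (u E (Ide C E)) (v E (Ide C E))"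
      using pb \<Gamma> A E unfolding representing_pullback_def folds by metis
    then show "\<exists>E \<pi> q. representing_pullback M \<Gamma> A E \<pi> q" by blast
  next
    assume ex: "\<forall>\<Gamma>\<in>Ob C. \<forall>A\<in>FOb Ty \<Gamma>. \<exists>E \<pi> q. representing_pullback M \<Gamma> A E \<pi> q"
    have "\<exists>E\<in>Ob C. \<exists>u v. is_pullback (psh C) (yoneda C E) (yoneda C \<Gamma>) Tm Ty u v \<tau> p"
      if \<Gamma>: "\<Gamma> \<in> Ob C" and \<tau>: "\<tau> \<in> Hom (psh C) (yoneda C \<Gamma>) Ty" for \<Gamma> \<tau>
    proof -
      note y = yoneda_lemma[OF Ty \<Gamma> \<tau>]
      obtain E \<pi> q where "representing_pullback M \<Gamma> (\<tau> \<Gamma> (Ide C \<Gamma>)) E \<pi> q"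
        using ex \<Gamma> y(1) by blast
      then show ?thesis
        unfolding representing_pullback_def folds y(2)[symmetric] by blast
    qed
    then show "natural_model M"
      using C Ty Tm p unfolding natural_model_def representable_map_def folds by blast
  qed
qed

section \<open>Pseudo maps and their transformations\<close>

lemma pseudo_maps_iff:
  "h \<in> pseudo_maps M N \<longleftrightarrow>
    is_functor (nm_cat M) (nm_cat N) (nmm_fun h) \<and>
    nmm_Ty h \<in> Hom (psh (nm_cat M)) (nm_Ty M) (pull_psh (nm_cat M) (nmm_fun h) (nm_Ty N)) \<and>
    nmm_Tm h \<in> Hom (psh (nm_cat M)) (nm_Tm M) (pull_psh (nm_cat M) (nmm_fun h) (nm_Tm N)) \<and>
    (\<forall>\<Gamma>\<in>Ob (nm_cat M). \<forall>a\<in>FOb (nm_Tm M) \<Gamma>.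
      nm_p N (FOb (nmm_fun h) \<Gamma>) (nmm_Tm h \<Gamma> a) = nmm_Ty h \<Gamma> (nm_p M \<Gamma> a)) \<and>
    (\<forall>\<Gamma> A E \<pi> q. representing_pullback M \<Gamma> A E \<pi> q \<longrightarrow>
      representing_pullback N (FOb (nmm_fun h) \<Gamma>) (nmm_Ty h \<Gamma> A) (FOb (nmm_fun h) E)
        (FMap (nmm_fun h) E \<Gamma> \<pi>) (nmm_Tm h E q))"
proof -
  have restrict_iff: "(\<lambda>x\<in>A. \<lambda>y\<in>B x. f x y) = (\<lambda>x\<in>A. \<lambda>y\<in>B x. g x y) \<longleftrightarrow> (\<forall>x\<in>A. \<forall>y\<in>B x. f x y = g x y)"
    for A :: "'u set" and B :: "'u \<Rightarrow> 'u set" and f g :: "'u \<Rightarrow> 'u \<Rightarrow> 'u"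
    by (auto simp: restrict_def fun_eq_iff)
  have *: "(\<forall>x\<in>X. \<forall>y\<in>Y x. restrict f X x y = g x y) \<longleftrightarrow> (\<forall>x\<in>X. \<forall>y\<in>Y x. f x y = g x y)"
    for X :: "'u set" and Y :: "'u \<Rightarrow> 'u set" and f g :: "'u \<Rightarrow> 'u \<Rightarrow> 'u"
    by simp
  show ?thesis
    unfolding pseudo_maps_def mem_Collect_eq Let_def psh_Comp_apply restrict_iff
    by (auto simp: pull_psh_map_def)
qed

lemma
  assumes "h \<in> pseudo_maps M N"
  shows pseudo_maps_functor: "is_functor (nm_cat M) (nm_cat N) (nmm_fun h)"
    and pseudo_maps_Ty: "nmm_Ty h \<in> Hom (psh (nm_cat M)) (nm_Ty M) (pull_psh (nm_cat M) (nmm_fun h) (nm_Ty N))"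
    and pseudo_maps_Tm: "nmm_Tm h \<in> Hom (psh (nm_cat M)) (nm_Tm M) (pull_psh (nm_cat M) (nmm_fun h) (nm_Tm N))"
    and pseudo_maps_p: "\<lbrakk>\<Gamma> \<in> Ob (nm_cat M); a \<in> FOb (nm_Tm M) \<Gamma>\<rbrakk>
      \<Longrightarrow> nm_p N (FOb (nmm_fun h) \<Gamma>) (nmm_Tm h \<Gamma> a) = nmm_Ty h \<Gamma> (nm_p M \<Gamma> a)"
    and pseudo_maps_representing: "representing_pullback M \<Gamma> A E \<pi> q \<Longrightarrow>
      representing_pullback N (FOb (nmm_fun h) \<Gamma>) (nmm_Ty h \<Gamma> A) (FOb (nmm_fun h) E)
        (FMap (nmm_fun h) E \<Gamma> \<pi>) (nmm_Tm h E q)"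
  using assms by (simp_all only: pseudo_maps_iff)

lemma
  assumes h: "h \<in> pseudo_maps M N" and \<Gamma>: "\<Gamma> \<in> Ob (nm_cat M)"
  shows nmm_Ty_in: "A \<in> FOb (nm_Ty M) \<Gamma> \<Longrightarrow> nmm_Ty h \<Gamma> A \<in> FOb (nm_Ty N) (FOb (nmm_fun h) \<Gamma>)"
    and nmm_Ty_natural: "\<lbrakk>\<Delta> \<in> Ob (nm_cat M); f \<in> Hom (nm_cat M) \<Delta> \<Gamma>; A \<in> FOb (nm_Ty M) \<Gamma>\<rbrakk> \<Longrightarrow>
      nmm_Ty h \<Delta> (FMap (nm_Ty M) \<Gamma> \<Delta> f A)
        = FMap (nm_Ty N) (FOb (nmm_fun h) \<Gamma>) (FOb (nmm_fun h) \<Delta>) (FMap (nmm_fun h) \<Delta> \<Gamma> f) (nmm_Ty h \<Gamma> A)"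
    and nmm_Tm_in: "a \<in> FOb (nm_Tm M) \<Gamma> \<Longrightarrow> nmm_Tm h \<Gamma> a \<in> FOb (nm_Tm N) (FOb (nmm_fun h) \<Gamma>)"
    and nmm_Tm_natural: "\<lbrakk>\<Delta> \<in> Ob (nm_cat M); f \<in> Hom (nm_cat M) \<Delta> \<Gamma>; a \<in> FOb (nm_Tm M) \<Gamma>\<rbrakk> \<Longrightarrow>
      nmm_Tm h \<Delta> (FMap (nm_Tm M) \<Gamma> \<Delta> f a)
        = FMap (nm_Tm N) (FOb (nmm_fun h) \<Gamma>) (FOb (nmm_fun h) \<Delta>) (FMap (nmm_fun h) \<Delta> \<Gamma> f) (nmm_Tm h \<Gamma> a)"
  using \<Gamma> psh_Hom_in[OF pseudo_maps_Ty[OF h], of \<Gamma> A] psh_Hom_natural[OF pseudo_maps_Ty[OF h], of \<Gamma> \<Delta> f A]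
    psh_Hom_in[OF pseudo_maps_Tm[OF h], of \<Gamma> a] psh_Hom_natural[OF pseudo_maps_Tm[OF h], of \<Gamma> \<Delta> f a]
  by simp_all

lemmas pseudo_maps_simps = nmm_Ty_in nmm_Ty_natural nmm_Tm_in nmm_Tm_natural pseudo_maps_p

lemma nm_map_eqI:
  assumes h: "h \<in> pseudo_maps M N" and k: "k \<in> pseudo_maps M L"
    and "nmm_fun h = nmm_fun k"
    and "\<And>\<Gamma> A. \<lbrakk>\<Gamma> \<in> Ob (nm_cat M); A \<in> FOb (nm_Ty M) \<Gamma>\<rbrakk> \<Longrightarrow> nmm_Ty h \<Gamma> A = nmm_Ty k \<Gamma> A"
    and "\<And>\<Gamma> a. \<lbrakk>\<Gamma> \<in> Ob (nm_cat M); a \<in> FOb (nm_Tm M) \<Gamma>\<rbrakk> \<Longrightarrow> nmm_Tm h \<Gamma> a = nmm_Tm k \<Gamma> a"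
  shows "h = k"
  using assms(3) psh_Hom_eqI[OF pseudo_maps_Ty[OF h] pseudo_maps_Ty[OF k] assms(4)]
    psh_Hom_eqI[OF pseudo_maps_Tm[OF h] pseudo_maps_Tm[OF k] assms(5)]
  by (cases h; cases k) simp

lemma nm_id_simps [simp]:
  "nmm_fun (nm_id M) = id_fun (nm_cat M)"
  "\<lbrakk>\<Gamma> \<in> Ob (nm_cat M); A \<in> FOb (nm_Ty M) \<Gamma>\<rbrakk> \<Longrightarrow> nmm_Ty (nm_id M) \<Gamma> A = A"
  "\<lbrakk>\<Gamma> \<in> Ob (nm_cat M); a \<in> FOb (nm_Tm M) \<Gamma>\<rbrakk> \<Longrightarrow> nmm_Tm (nm_id M) \<Gamma> a = a"
  by (simp_all add: nm_id_def)

lemma nm_comp_simps [simp]: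
  "nmm_fun (nm_comp M k h) = comp_fun (nm_cat M) (nmm_fun k) (nmm_fun h)"
  "\<lbrakk>\<Gamma> \<in> Ob (nm_cat M); A \<in> FOb (nm_Ty M) \<Gamma>\<rbrakk>
    \<Longrightarrow> nmm_Ty (nm_comp M k h) \<Gamma> A = nmm_Ty k (FOb (nmm_fun h) \<Gamma>) (nmm_Ty h \<Gamma> A)"
  "\<lbrakk>\<Gamma> \<in> Ob (nm_cat M); a \<in> FOb (nm_Tm M) \<Gamma>\<rbrakk>
    \<Longrightarrow> nmm_Tm (nm_comp M k h) \<Gamma> a = nmm_Tm k (FOb (nmm_fun h) \<Gamma>) (nmm_Tm h \<Gamma> a)"
  by (simp_all add: nm_comp_def compose_def)

lemma nm_id_pseudo_maps:
  assumes M: "premodel M"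
  shows "nm_id M \<in> pseudo_maps M M"
  unfolding pseudo_maps_iff
proof (intro conjI ballI allI impI)
  show "nmm_Ty (nm_id M) \<in> Hom (psh (nm_cat M)) (nm_Ty M)
      (pull_psh (nm_cat M) (nmm_fun (nm_id M)) (nm_Ty M))"
    "nmm_Tm (nm_id M) \<in> Hom (psh (nm_cat M)) (nm_Tm M)
      (pull_psh (nm_cat M) (nmm_fun (nm_id M)) (nm_Tm M))"
    by (auto simp: psh_Hom_iff nm_id_def psh_simps[OF premodel_Ty[OF M]] psh_simps[OF premodel_Tm[OF M]])
  fix \<Gamma> A E \<pi> q assume "representing_pullback M \<Gamma> A E \<pi> q"
  then show "representing_pullback M (FOb (nmm_fun (nm_id M)) \<Gamma>) (nmm_Ty (nm_id M) \<Gamma> A)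
      (FOb (nmm_fun (nm_id M)) E) (FMap (nmm_fun (nm_id M)) E \<Gamma> \<pi>) (nmm_Tm (nm_id M) E q)"
    by (simp add: representing_pullback_def)
qed (simp_all add: is_functor_id_fun premodel_category M psh_Hom_in[OF premodel_p])

lemma nm_comp_pseudo_maps:
  assumes h: "h \<in> pseudo_maps M N" and k: "k \<in> pseudo_maps N L"
    and M: "premodel M"
  shows "nm_comp M k h \<in> pseudo_maps M L"
  unfolding pseudo_maps_iff
proof (intro conjI ballI allI impI)
  note [simp] = functor_simps[OF pseudo_maps_functor[OF h]] pseudo_maps_simps[OF h]
    pseudo_maps_simps[OF k] psh_simps[OF premodel_Ty[OF M]] psh_simps[OF premodel_Tm[OF M]]
    psh_Hom_in[OF premodel_p[OF M]]
  show "is_functor (nm_cat M) (nm_cat L) (nmm_fun (nm_comp M k h))"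
    using is_functor_comp_fun[OF pseudo_maps_functor[OF h] pseudo_maps_functor[OF k]] by simp
  show "nmm_Ty (nm_comp M k h) \<in> Hom (psh (nm_cat M)) (nm_Ty M)
      (pull_psh (nm_cat M) (nmm_fun (nm_comp M k h)) (nm_Ty L))"
    "nmm_Tm (nm_comp M k h) \<in> Hom (psh (nm_cat M)) (nm_Tm M)
      (pull_psh (nm_cat M) (nmm_fun (nm_comp M k h)) (nm_Tm L))"
    by (auto simp: psh_Hom_iff nm_comp_def compose_def)
  show "nm_p L (FOb (nmm_fun (nm_comp M k h)) \<Gamma>) (nmm_Tm (nm_comp M k h) \<Gamma> a)
      = nmm_Ty (nm_comp M k h) \<Gamma> (nm_p M \<Gamma> a)"
    if "\<Gamma> \<in> Ob (nm_cat M)" "a \<in> FOb (nm_Tm M) \<Gamma>" for \<Gamma> a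
    using that by simp
  show "representing_pullback L (FOb (nmm_fun (nm_comp M k h)) \<Gamma>) (nmm_Ty (nm_comp M k h) \<Gamma> A)
      (FOb (nmm_fun (nm_comp M k h)) E) (FMap (nmm_fun (nm_comp M k h)) E \<Gamma> \<pi>) (nmm_Tm (nm_comp M k h) E q)"
    if pb: "representing_pullback M \<Gamma> A E \<pi> q" for \<Gamma> A E \<pi> q
    using pseudo_maps_representing[OF k pseudo_maps_representing[OF h pb]] pb
    by (simp add: representing_pullback_def[of M])
qed

lemma nm_comp_nm_id:
  assumes h: "h \<in> pseudo_maps M N" and M: "premodel M" and N: "premodel N"
  shows "nm_comp M h (nm_id M) = h" "nm_comp M (nm_id N) h = h"
proof -
  note [simp] = pseudo_maps_simps[OF h] functor_simps[OF pseudo_maps_functor[OF h]]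
    comp_fun_id_fun[OF pseudo_maps_functor[OF h]]
  show "nm_comp M h (nm_id M) = h"
    by (rule nm_map_eqI[OF nm_comp_pseudo_maps[OF nm_id_pseudo_maps[OF M] h M] h]) simp_all
  show "nm_comp M (nm_id N) h = h"
    by (rule nm_map_eqI[OF nm_comp_pseudo_maps[OF h nm_id_pseudo_maps[OF N] M] h]) simp_all
qed

lemma nm_comp_assoc:
  assumes h: "h \<in> pseudo_maps M N" and k: "k \<in> pseudo_maps N L" and l: "l \<in> pseudo_maps L K"
    and M: "premodel M" and N: "premodel N"
  shows "nm_comp M (nm_comp N l k) h = nm_comp M l (nm_comp M k h)"
  by (rule nm_map_eqI[OF nm_comp_pseudo_maps[OF h nm_comp_pseudo_maps[OF k l N] M]
        nm_comp_pseudo_maps[OF nm_comp_pseudo_maps[OF h k M] l M]])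
    (simp_all add: comp_fun_assoc[OF pseudo_maps_functor[OF h] pseudo_maps_functor[OF k]
        pseudo_maps_functor[OF l]] pseudo_maps_simps[OF h] functor_simps[OF pseudo_maps_functor[OF h]])

lemma nm_transformations_iff:
  "\<alpha> \<in> nm_transformations M N h k \<longleftrightarrow>
     \<alpha> \<in> nat_trans (nm_cat M) (nm_cat N) (nmm_fun h) (nmm_fun k) \<and>
     (\<forall>\<Gamma>\<in>Ob (nm_cat M). \<forall>A\<in>FOb (nm_Ty M) \<Gamma>.
        FMap (nm_Ty N) (FOb (nmm_fun k) \<Gamma>) (FOb (nmm_fun h) \<Gamma>) (\<alpha> \<Gamma>) (nmm_Ty k \<Gamma> A) = nmm_Ty h \<Gamma> A) \<and>
     (\<forall>\<Gamma>\<in>Ob (nm_cat M). \<forall>a\<in>FOb (nm_Tm M) \<Gamma>.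
        FMap (nm_Tm N) (FOb (nmm_fun k) \<Gamma>) (FOb (nmm_fun h) \<Gamma>) (\<alpha> \<Gamma>) (nmm_Tm k \<Gamma> a) = nmm_Tm h \<Gamma> a)"
  by (auto simp: nm_transformations_def)

interpretation NatMod: cat2_over_Cat "{M :: 'u natmod. natural_model M}" nm_cat pseudo_maps nmm_fun
  nm_transformations nm_id nm_comp
proof (unfold_locales; (unfold mem_Collect_eq)?)
  fix M N L K :: "'u natmod"
  show "nm_id M \<in> pseudo_maps M M" if "natural_model M"
    using that by (simp add: nm_id_pseudo_maps natural_model_premodel)
  show "nm_comp M k h \<in> pseudo_maps M L"
    if "natural_model M" "natural_model N" "natural_model L" "h \<in> pseudo_maps M N" "k \<in> pseudo_maps N L"
    for h k
    using that by (simp add: nm_comp_pseudo_maps natural_model_premodel)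
  show "nm_comp M h (nm_id M) = h" "nm_comp M (nm_id N) h = h"
    if "natural_model M" "natural_model N" "h \<in> pseudo_maps M N" for h
    using that by (simp_all add: nm_comp_nm_id natural_model_premodel)
  show "nm_comp M (nm_comp N l k) h = nm_comp M l (nm_comp M k h)"
    if "natural_model M" "natural_model N" "h \<in> pseudo_maps M N" "k \<in> pseudo_maps N L" "l \<in> pseudo_maps L K"
    for h k l
    using that by (simp add: nm_comp_assoc natural_model_premodel)
  fix h h' h'' k k' \<alpha> \<beta>
  assume M: "natural_model M" and N: "natural_model N" and h: "h \<in> pseudo_maps M N"
  note [simp] = pseudo_maps_simps[OF h] functor_simps[OF pseudo_maps_functor[OF h]]
    psh_simps[OF premodel_Ty[OF natural_model_premodel[OF M]]]
    psh_simps[OF premodel_Tm[OF natural_model_premodel[OF M]]]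
    psh_simps[OF premodel_Ty[OF natural_model_premodel[OF N]]]
    psh_simps[OF premodel_Tm[OF natural_model_premodel[OF N]]]
  have N_cat: "category (nm_cat N)" using N by (simp add: natural_model_def)
  show "Ide (fun_cat (nm_cat M) (nm_cat N)) (nmm_fun h) \<in> nm_transformations M N h h"
    using category_Ide[OF category_fun_cat[OF N_cat], of "nmm_fun h" "nm_cat M"] pseudo_maps_functor[OF h]
    by (simp add: nm_transformations_iff)
  assume h': "h' \<in> pseudo_maps M N" and \<alpha>: "\<alpha> \<in> nm_transformations M N h h'"
  note [simp] = pseudo_maps_simps[OF h'] functor_simps[OF pseudo_maps_functor[OF h']]
  have \<alpha>_nt: "\<alpha> \<in> nat_trans (nm_cat M) (nm_cat N) (nmm_fun h) (nmm_fun h')"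
    using \<alpha> by (simp add: nm_transformations_iff)
  note [simp] = nat_trans_Hom[OF \<alpha>_nt]
  show "Comp (fun_cat (nm_cat M) (nm_cat N)) (nmm_fun h) (nmm_fun h') (nmm_fun h'') \<beta> \<alpha>
      \<in> nm_transformations M N h h''"
    if h'': "h'' \<in> pseudo_maps M N" and \<beta>: "\<beta> \<in> nm_transformations M N h' h''"
  proof -
    have \<beta>_nt: "\<beta> \<in> nat_trans (nm_cat M) (nm_cat N) (nmm_fun h') (nmm_fun h'')"
      using \<beta> by (simp add: nm_transformations_iff)
    note [simp] = pseudo_maps_simps[OF h''] functor_simps[OF pseudo_maps_functor[OF h'']]
      nat_trans_Hom[OF \<beta>_nt]
    show ?thesis
      using category_Comp[OF category_fun_cat[OF N_cat], of "nmm_fun h" "nm_cat M" "nmm_fun h'" "nmm_fun h''" \<alpha> \<beta>]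
        pseudo_maps_functor[OF h] pseudo_maps_functor[OF h'] pseudo_maps_functor[OF h''] \<alpha>_nt \<beta>_nt \<alpha> \<beta>
      by (simp add: nm_transformations_iff)
  qed
  show "hcomp (nm_cat M) (nm_cat L) (nmm_fun k) (nmm_fun k') (nmm_fun h) (nmm_fun h') \<beta> \<alpha>
      \<in> nm_transformations M L (nm_comp M k h) (nm_comp M k' h')"
    if L: "natural_model L" and k: "k \<in> pseudo_maps N L" and k': "k' \<in> pseudo_maps N L"
      and \<beta>: "\<beta> \<in> nm_transformations N L k k'"
  proof -
    have \<beta>_nt: "\<beta> \<in> nat_trans (nm_cat N) (nm_cat L) (nmm_fun k) (nmm_fun k')"
      using \<beta> by (simp add: nm_transformations_iff)
    \<comment> \<open>Restriction along the horizontal composite is restriction along a component of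
      \<open>\<beta>\<close>, then along the image of \<open>\<alpha> \<Gamma>\<close> under
      \<open>k\<close>. Naturality of \<open>k\<close> is oriented so as to pull \<open>k\<close>
      out of the latter, after which the condition on \<open>\<alpha>\<close> applies.\<close>
    note [simp] = functor_simps[OF pseudo_maps_functor[OF k]]
      functor_simps[OF pseudo_maps_functor[OF k']] nat_trans_Hom[OF \<beta>_nt]
      psh_simps[OF premodel_Ty[OF natural_model_premodel[OF L]]]
      psh_simps[OF premodel_Tm[OF natural_model_premodel[OF L]]]
      nmm_Ty_in[OF k] nmm_Ty_in[OF k'] nmm_Tm_in[OF k] nmm_Tm_in[OF k']
      nmm_Ty_natural[OF k, symmetric] nmm_Tm_natural[OF k, symmetric]
    show ?thesis
      using hcomp_nat_trans[OF pseudo_maps_functor[OF h] pseudo_maps_functor[OF h']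
          pseudo_maps_functor[OF k] pseudo_maps_functor[OF k'] \<alpha>_nt \<beta>_nt] \<alpha> \<beta>
      by (simp add: nm_transformations_iff hcomp_def)
  qed
qed (simp_all add: pseudo_maps_functor nm_transformations_iff)

lemma NatMod_ps_eq: "NatMod_ps = NatMod.the_cat2"
  by (simp add: NatMod_ps_def NatMod.the_cat2_def nm_hom_cat_def NatMod.hom_cat_def fun_eq_iff)

section \<open>Categories with families\<close>

text \<open>Counterpart of \<open>premodel\<close>: the part of a CwF that mentions no chosen
  extensions. It is the setting in which arbitrary context extensions are compared.\<close>

definition precwf :: "'u cwf \<Rightarrow> bool" where
  "precwf W \<longleftrightarrow> category (cwf_cat W) \<and> cwf_Ty W \<in> Ob (psh (cwf_cat W)) \<and>
     cwf_Tm W \<in> Ob (psh (elements (cwf_cat W) (cwf_Ty W)))"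

lemma
  assumes "precwf W"
  shows precwf_category: "category (cwf_cat W)"
    and precwf_Ty: "cwf_Ty W \<in> Ob (psh (cwf_cat W))"
    and precwf_Tm: "cwf_Tm W \<in> Ob (psh (elements (cwf_cat W) (cwf_Ty W)))"
  using assms by (simp_all add: precwf_def)

lemma precwf_Tm_simps:
  assumes W: "precwf W"
  shows "\<lbrakk>\<Gamma> \<in> Ob (cwf_cat W); \<Delta> \<in> Ob (cwf_cat W); f \<in> Hom (cwf_cat W) \<Delta> \<Gamma>; A \<in> FOb (cwf_Ty W) \<Gamma>;
      B = FMap (cwf_Ty W) \<Gamma> \<Delta> f A; a \<in> FOb (cwf_Tm W) (\<Gamma>, A)\<rbrakk>
      \<Longrightarrow> FMap (cwf_Tm W) (\<Gamma>, A) (\<Delta>, B) f a \<in> FOb (cwf_Tm W) (\<Delta>, B)"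
    and "\<lbrakk>\<Gamma> \<in> Ob (cwf_cat W); A \<in> FOb (cwf_Ty W) \<Gamma>; a \<in> FOb (cwf_Tm W) (\<Gamma>, A)\<rbrakk>
      \<Longrightarrow> FMap (cwf_Tm W) (\<Gamma>, A) (\<Gamma>, A) (Ide (cwf_cat W) \<Gamma>) a = a"
    and "\<lbrakk>\<Gamma> \<in> Ob (cwf_cat W); \<Delta> \<in> Ob (cwf_cat W); \<Theta> \<in> Ob (cwf_cat W); f \<in> Hom (cwf_cat W) \<Delta> \<Gamma>;
      g \<in> Hom (cwf_cat W) \<Theta> \<Delta>; A \<in> FOb (cwf_Ty W) \<Gamma>;
      B = FMap (cwf_Ty W) \<Delta> \<Theta> g (FMap (cwf_Ty W) \<Gamma> \<Delta> f A); a \<in> FOb (cwf_Tm W) (\<Gamma>, A)\<rbrakk>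
      \<Longrightarrow> FMap (cwf_Tm W) (\<Gamma>, A) (\<Theta>, B) (Comp (cwf_cat W) \<Theta> \<Delta> \<Gamma> f g) a
        = FMap (cwf_Tm W) (\<Delta>, FMap (cwf_Ty W) \<Gamma> \<Delta> f A) (\<Theta>, B) g
            (FMap (cwf_Tm W) (\<Gamma>, A) (\<Delta>, FMap (cwf_Ty W) \<Gamma> \<Delta> f A) f a)"
  by (fact elements_psh_Map[OF precwf_Ty precwf_Tm, OF W W]
    elements_psh_Ide[OF precwf_Ty precwf_Tm, OF W W]
    elements_psh_Comp[OF precwf_Ty precwf_Tm, OF W W])+

lemma is_cwf_iff: "is_cwf W \<longleftrightarrow> precwf W \<and>
    (\<forall>\<Gamma>\<in>Ob (cwf_cat W). \<forall>A\<in>FOb (cwf_Ty W) \<Gamma>.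
      context_extension W \<Gamma> A (cwf_ctx W \<Gamma> A) (cwf_pr W \<Gamma> A) (cwf_var W \<Gamma> A))"
  by (simp add: is_cwf_def precwf_def)

lemma is_cwf_precwf: "is_cwf W \<Longrightarrow> precwf W"
  by (simp add: is_cwf_iff)

section \<open>Uniqueness and transport of context extensions\<close>

lemma
  assumes "context_extension W \<Gamma> A E \<pi> q"
  shows context_extension_data: "\<Gamma> \<in> Ob (cwf_cat W)" "A \<in> FOb (cwf_Ty W) \<Gamma>" "E \<in> Ob (cwf_cat W)"
      "\<pi> \<in> Hom (cwf_cat W) E \<Gamma>" "q \<in> FOb (cwf_Tm W) (E, FMap (cwf_Ty W) \<Gamma> E \<pi> A)"
    and context_extension_universal: "\<lbrakk>\<Delta> \<in> Ob (cwf_cat W); f \<in> Hom (cwf_cat W) \<Delta> \<Gamma>;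
        a \<in> FOb (cwf_Tm W) (\<Delta>, FMap (cwf_Ty W) \<Gamma> \<Delta> f A)\<rbrakk>
      \<Longrightarrow> \<exists>!g. g \<in> Hom (cwf_cat W) \<Delta> E \<and> Comp (cwf_cat W) \<Delta> E \<Gamma> \<pi> g = f \<and>
        FMap (cwf_Tm W) (E, FMap (cwf_Ty W) \<Gamma> E \<pi> A) (\<Delta>, FMap (cwf_Ty W) \<Gamma> \<Delta> f A) g q = a"
  using assms unfolding context_extension_def Let_def by blast+

lemma context_extensionI:
  assumes "\<Gamma> \<in> Ob (cwf_cat W)" "A \<in> FOb (cwf_Ty W) \<Gamma>" "E \<in> Ob (cwf_cat W)"
      "\<pi> \<in> Hom (cwf_cat W) E \<Gamma>" "q \<in> FOb (cwf_Tm W) (E, FMap (cwf_Ty W) \<Gamma> E \<pi> A)"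
    and "\<And>\<Delta> f a. \<lbrakk>\<Delta> \<in> Ob (cwf_cat W); f \<in> Hom (cwf_cat W) \<Delta> \<Gamma>;
        a \<in> FOb (cwf_Tm W) (\<Delta>, FMap (cwf_Ty W) \<Gamma> \<Delta> f A)\<rbrakk>
      \<Longrightarrow> \<exists>!g. g \<in> Hom (cwf_cat W) \<Delta> E \<and> Comp (cwf_cat W) \<Delta> E \<Gamma> \<pi> g = f \<and>
        FMap (cwf_Tm W) (E, FMap (cwf_Ty W) \<Gamma> E \<pi> A) (\<Delta>, FMap (cwf_Ty W) \<Gamma> \<Delta> f A) g q = a"
  shows "context_extension W \<Gamma> A E \<pi> q"
  unfolding context_extension_def Let_def using assms by blast

text \<open>The uniqueness half of the universal property, applied to the term that \<open>g\<close>
  itself induces.\<close>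

lemma context_extension_cancel:
  assumes W: "precwf W" and E: "context_extension W \<Gamma> A E \<pi> q"
    and \<Delta>: "\<Delta> \<in> Ob (cwf_cat W)" and g: "g \<in> Hom (cwf_cat W) \<Delta> E" and g': "g' \<in> Hom (cwf_cat W) \<Delta> E"
    and f: "Comp (cwf_cat W) \<Delta> E \<Gamma> \<pi> g = f" "Comp (cwf_cat W) \<Delta> E \<Gamma> \<pi> g' = f"
    and q: "FMap (cwf_Tm W) (E, FMap (cwf_Ty W) \<Gamma> E \<pi> A) (\<Delta>, FMap (cwf_Ty W) \<Gamma> \<Delta> f A) g q
      = FMap (cwf_Tm W) (E, FMap (cwf_Ty W) \<Gamma> E \<pi> A) (\<Delta>, FMap (cwf_Ty W) \<Gamma> \<Delta> f A) g' q"
  shows "g = g'"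
proof -
  note * = context_extension_data[OF E]
  have "f \<in> Hom (cwf_cat W) \<Delta> \<Gamma>"
    using category_Comp[OF precwf_category[OF W] \<Delta> *(3,1) g *(4)] f by simp
  moreover have "FMap (cwf_Tm W) (E, FMap (cwf_Ty W) \<Gamma> E \<pi> A) (\<Delta>, FMap (cwf_Ty W) \<Gamma> \<Delta> f A) g q
      \<in> FOb (cwf_Tm W) (\<Delta>, FMap (cwf_Ty W) \<Gamma> \<Delta> f A)"
    unfolding f(1)[symmetric]
    by (rule precwf_Tm_simps(1)[OF W]) (use * \<Delta> g in \<open>simp_all add: psh_simps[OF precwf_Ty[OF W]]\<close>)
  ultimately show ?thesis
    using context_extension_universal[OF E \<Delta>, of f] f g g' q by metis
qed

text \<open>As always for universal objects, each extension maps to the other, and the composites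
  are identities by cancellation against the projection and the generic term.\<close>

lemma context_extension_unique:
  assumes W: "precwf W" and E: "context_extension W \<Gamma> A E \<pi> q" and E': "context_extension W \<Gamma> A E' \<pi>' q'"
  obtains u v where "u \<in> Hom (cwf_cat W) E' E" "v \<in> Hom (cwf_cat W) E E'"
    "Comp (cwf_cat W) E E' E u v = Ide (cwf_cat W) E" "Comp (cwf_cat W) E' E E' v u = Ide (cwf_cat W) E'"
    "Comp (cwf_cat W) E' E \<Gamma> \<pi> u = \<pi>'"
    "FMap (cwf_Tm W) (E, FMap (cwf_Ty W) \<Gamma> E \<pi> A) (E', FMap (cwf_Ty W) \<Gamma> E' \<pi>' A) u q = q'"
proof -
  \<comment> \<open>Stated for arbitrary extensions, so that exchanging the two covers both
    composites.\<close>
  have retract: "Comp (cwf_cat W) E E' E u v = Ide (cwf_cat W) E"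
    if E: "context_extension W \<Gamma> A E \<pi> q" and E': "context_extension W \<Gamma> A E' \<pi>' q'"
      and u: "u \<in> Hom (cwf_cat W) E' E" "Comp (cwf_cat W) E' E \<Gamma> \<pi> u = \<pi>'"
        "FMap (cwf_Tm W) (E, FMap (cwf_Ty W) \<Gamma> E \<pi> A) (E', FMap (cwf_Ty W) \<Gamma> E' \<pi>' A) u q = q'"
      and v: "v \<in> Hom (cwf_cat W) E E'" "Comp (cwf_cat W) E E' \<Gamma> \<pi>' v = \<pi>"
        "FMap (cwf_Tm W) (E', FMap (cwf_Ty W) \<Gamma> E' \<pi>' A) (E, FMap (cwf_Ty W) \<Gamma> E \<pi> A) v q' = q"
    for E \<pi> q E' \<pi>' q' u v
  proof -
    note * [simp] = context_extension_data[OF E] context_extension_data[OF E']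
    note [simp] = u v
    have [simp]: "FMap (cwf_Ty W) E E' u (FMap (cwf_Ty W) \<Gamma> E \<pi> A) = FMap (cwf_Ty W) \<Gamma> E' \<pi>' A"
      "FMap (cwf_Ty W) E' E v (FMap (cwf_Ty W) \<Gamma> E' \<pi>' A) = FMap (cwf_Ty W) \<Gamma> E \<pi> A"
      using psh_Comp[OF precwf_Ty[OF W], of \<Gamma> E E' \<pi> u A] psh_Comp[OF precwf_Ty[OF W], of \<Gamma> E' E \<pi>' v A]
      by simp_all
    show ?thesis
    proof (rule context_extension_cancel[OF W E])
      show "Comp (cwf_cat W) E E \<Gamma> \<pi> (Comp (cwf_cat W) E E' E u v) = \<pi>"
        by (simp add: category_assoc[OF precwf_category[OF W], symmetric])
    qed (simp_all add: category_simps[OF precwf_category[OF W]] precwf_Tm_simps[OF W]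
        psh_Map[OF precwf_Ty[OF W]])
  qed
  obtain u where u: "u \<in> Hom (cwf_cat W) E' E" "Comp (cwf_cat W) E' E \<Gamma> \<pi> u = \<pi>'"
    "FMap (cwf_Tm W) (E, FMap (cwf_Ty W) \<Gamma> E \<pi> A) (E', FMap (cwf_Ty W) \<Gamma> E' \<pi>' A) u q = q'"
    using context_extension_universal[OF E context_extension_data(3-5)[OF E']] by blast
  obtain v where v: "v \<in> Hom (cwf_cat W) E E'" "Comp (cwf_cat W) E E' \<Gamma> \<pi>' v = \<pi>"
    "FMap (cwf_Tm W) (E', FMap (cwf_Ty W) \<Gamma> E' \<pi>' A) (E, FMap (cwf_Ty W) \<Gamma> E \<pi> A) v q' = q"
    using context_extension_universal[OF E' context_extension_data(3-5)[OF E]] by blast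
  show ?thesis
    by (rule that[OF u(1) v(1) retract[OF E E' u v] retract[OF E' E v u] u(2,3)])
qed

text \<open>Composition with the isomorphism \<open>u\<close> turns arrows into \<open>E'\<close>
  bijectively into arrows into \<open>E\<close>, and turns the conditions for \<open>\<pi>'\<close>
  and \<open>q'\<close> into those for \<open>\<pi>\<close> and \<open>q\<close>.\<close>

lemma context_extension_transport:
  assumes W: "precwf W" and E: "context_extension W \<Gamma> A E \<pi> q"
    and E'_Ob: "E' \<in> Ob (cwf_cat W)"
    and u: "u \<in> Hom (cwf_cat W) E' E" and v: "v \<in> Hom (cwf_cat W) E E'"
    and uv: "Comp (cwf_cat W) E E' E u v = Ide (cwf_cat W) E"
    and vu: "Comp (cwf_cat W) E' E E' v u = Ide (cwf_cat W) E'"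
    and \<pi>': "Comp (cwf_cat W) E' E \<Gamma> \<pi> u = \<pi>'"
    and q': "FMap (cwf_Tm W) (E, FMap (cwf_Ty W) \<Gamma> E \<pi> A) (E', FMap (cwf_Ty W) \<Gamma> E' \<pi>' A) u q = q'"
  shows "context_extension W \<Gamma> A E' \<pi>' q'"
proof (rule context_extensionI)
  have C: "category (cwf_cat W)" using W by (rule precwf_category)
  note [simp] = context_extension_data[OF E] E'_Ob u v psh_Map[OF precwf_Ty[OF W]]
  show \<pi>'_Hom [simp]: "\<pi>' \<in> Hom (cwf_cat W) E' \<Gamma>"
    unfolding \<pi>'[symmetric] by (simp add: category_simps[OF C])
  have uA [simp]: "FMap (cwf_Ty W) E E' u (FMap (cwf_Ty W) \<Gamma> E \<pi> A) = FMap (cwf_Ty W) \<Gamma> E' \<pi>' A"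
    using psh_Comp[OF precwf_Ty[OF W], of \<Gamma> E E' \<pi> u A] \<pi>' by simp
  show "q' \<in> FOb (cwf_Tm W) (E', FMap (cwf_Ty W) \<Gamma> E' \<pi>' A)"
    unfolding q'[symmetric] by (rule precwf_Tm_simps(1)[OF W]) simp_all
  fix \<Delta> f a
  assume f: "\<Delta> \<in> Ob (cwf_cat W)" "f \<in> Hom (cwf_cat W) \<Delta> \<Gamma>"
    "a \<in> FOb (cwf_Tm W) (\<Delta>, FMap (cwf_Ty W) \<Gamma> \<Delta> f A)"
  have iff: "Comp (cwf_cat W) \<Delta> E' \<Gamma> \<pi>' g = f \<and>
      FMap (cwf_Tm W) (E', FMap (cwf_Ty W) \<Gamma> E' \<pi>' A) (\<Delta>, FMap (cwf_Ty W) \<Gamma> \<Delta> f A) g q' = a \<longleftrightarrow>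
    Comp (cwf_cat W) \<Delta> E \<Gamma> \<pi> (Comp (cwf_cat W) \<Delta> E' E u g) = f \<and>
      FMap (cwf_Tm W) (E, FMap (cwf_Ty W) \<Gamma> E \<pi> A) (\<Delta>, FMap (cwf_Ty W) \<Gamma> \<Delta> f A)
        (Comp (cwf_cat W) \<Delta> E' E u g) q = a"
    if g: "g \<in> Hom (cwf_cat W) \<Delta> E'" for g
  proof -
    have 1: "Comp (cwf_cat W) \<Delta> E \<Gamma> \<pi> (Comp (cwf_cat W) \<Delta> E' E u g) = Comp (cwf_cat W) \<Delta> E' \<Gamma> \<pi>' g"
      using f g \<pi>' by (simp add: category_assoc[OF C, symmetric])
    \<comment> \<open>Compared only when \<open>g\<close> lies over \<open>f\<close>: otherwise
      \<open>g\<close> need not be an arrow of the category of elements between the types shown, and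
      the presheaf laws say nothing about the restriction of \<open>q'\<close>.\<close>
    have 2: "FMap (cwf_Tm W) (E, FMap (cwf_Ty W) \<Gamma> E \<pi> A) (\<Delta>, FMap (cwf_Ty W) \<Gamma> \<Delta> f A)
          (Comp (cwf_cat W) \<Delta> E' E u g) q
        = FMap (cwf_Tm W) (E', FMap (cwf_Ty W) \<Gamma> E' \<pi>' A) (\<Delta>, FMap (cwf_Ty W) \<Gamma> \<Delta> f A) g q'"
      if "Comp (cwf_cat W) \<Delta> E' \<Gamma> \<pi>' g = f"
      unfolding that[symmetric]
      by (subst precwf_Tm_simps(3)[OF W])
        (use f g in \<open>simp_all add: q' psh_Comp[OF precwf_Ty[OF W]]\<close>)
    show ?thesis using 1 2 by auto
  qed
  obtain g where g: "g \<in> Hom (cwf_cat W) \<Delta> E" "Comp (cwf_cat W) \<Delta> E \<Gamma> \<pi> g = f"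
    "FMap (cwf_Tm W) (E, FMap (cwf_Ty W) \<Gamma> E \<pi> A) (\<Delta>, FMap (cwf_Ty W) \<Gamma> \<Delta> f A) g q = a"
    and g_unique: "\<And>g'. \<lbrakk>g' \<in> Hom (cwf_cat W) \<Delta> E; Comp (cwf_cat W) \<Delta> E \<Gamma> \<pi> g' = f;
      FMap (cwf_Tm W) (E, FMap (cwf_Ty W) \<Gamma> E \<pi> A) (\<Delta>, FMap (cwf_Ty W) \<Gamma> \<Delta> f A) g' q = a\<rbrakk> \<Longrightarrow> g' = g"
    using context_extension_universal[OF E f] by blast
  have ug: "Comp (cwf_cat W) \<Delta> E' E u (Comp (cwf_cat W) \<Delta> E E' v g) = g"
    by (rule category_cancel[OF C]) (use f g uv in simp_all)
  show "\<exists>!g. g \<in> Hom (cwf_cat W) \<Delta> E' \<and> Comp (cwf_cat W) \<Delta> E' \<Gamma> \<pi>' g = f \<and>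
      FMap (cwf_Tm W) (E', FMap (cwf_Ty W) \<Gamma> E' \<pi>' A) (\<Delta>, FMap (cwf_Ty W) \<Gamma> \<Delta> f A) g q' = a"
  proof (rule ex1I[of _ "Comp (cwf_cat W) \<Delta> E E' v g"])
    have "Comp (cwf_cat W) \<Delta> E E' v g \<in> Hom (cwf_cat W) \<Delta> E'"
      using f g by (simp add: category_Comp[OF C])
    then show "Comp (cwf_cat W) \<Delta> E E' v g \<in> Hom (cwf_cat W) \<Delta> E' \<and>
        Comp (cwf_cat W) \<Delta> E' \<Gamma> \<pi>' (Comp (cwf_cat W) \<Delta> E E' v g) = f \<and>
        FMap (cwf_Tm W) (E', FMap (cwf_Ty W) \<Gamma> E' \<pi>' A) (\<Delta>, FMap (cwf_Ty W) \<Gamma> \<Delta> f A)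
          (Comp (cwf_cat W) \<Delta> E E' v g) q' = a"
      using iff[of "Comp (cwf_cat W) \<Delta> E E' v g"] g ug by simp
    fix g' assume g': "g' \<in> Hom (cwf_cat W) \<Delta> E' \<and> Comp (cwf_cat W) \<Delta> E' \<Gamma> \<pi>' g' = f \<and>
        FMap (cwf_Tm W) (E', FMap (cwf_Ty W) \<Gamma> E' \<pi>' A) (\<Delta>, FMap (cwf_Ty W) \<Gamma> \<Delta> f A) g' q' = a"
    then have "Comp (cwf_cat W) \<Delta> E' E u g' = g"
      using iff[of g'] f by (intro g_unique) (simp_all add: category_Comp[OF C])
    moreover have "Comp (cwf_cat W) \<Delta> E E' v (Comp (cwf_cat W) \<Delta> E' E u g') = g'"
      by (rule category_cancel[OF C]) (use f g' vu in simp_all)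
    ultimately show "g' = Comp (cwf_cat W) \<Delta> E E' v g" by simp
  qed
qed (use context_extension_data[OF E] E'_Ob in simp_all)

section \<open>Maps of CwFs and their transformations\<close>

lemma cwf_premaps_iff:
  assumes W: "precwf W"
  shows "h \<in> cwf_premaps W V \<longleftrightarrow>
    is_functor (cwf_cat W) (cwf_cat V) (cwfm_fun h) \<and>
    cwfm_Ty h \<in> Hom (psh (cwf_cat W)) (cwf_Ty W) (pull_psh (cwf_cat W) (cwfm_fun h) (cwf_Ty V)) \<and>
    cwfm_Tm h \<in> extensional (Ob (elements (cwf_cat W) (cwf_Ty W))) \<and>
    (\<forall>\<Gamma>\<in>Ob (cwf_cat W). \<forall>A\<in>FOb (cwf_Ty W) \<Gamma>.
      cwfm_Tm h (\<Gamma>, A) \<in> FOb (cwf_Tm W) (\<Gamma>, A) \<rightarrow>\<^sub>E FOb (cwf_Tm V) (FOb (cwfm_fun h) \<Gamma>, cwfm_Ty h \<Gamma> A)) \<and>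
    (\<forall>\<Gamma>\<in>Ob (cwf_cat W). \<forall>\<Delta>\<in>Ob (cwf_cat W). \<forall>f\<in>Hom (cwf_cat W) \<Delta> \<Gamma>.
      \<forall>A\<in>FOb (cwf_Ty W) \<Gamma>. \<forall>a\<in>FOb (cwf_Tm W) (\<Gamma>, A).
      cwfm_Tm h (\<Delta>, FMap (cwf_Ty W) \<Gamma> \<Delta> f A) (FMap (cwf_Tm W) (\<Gamma>, A) (\<Delta>, FMap (cwf_Ty W) \<Gamma> \<Delta> f A) f a)
      = FMap (cwf_Tm V) (FOb (cwfm_fun h) \<Gamma>, cwfm_Ty h \<Gamma> A)
          (FOb (cwfm_fun h) \<Delta>, cwfm_Ty h \<Delta> (FMap (cwf_Ty W) \<Gamma> \<Delta> f A))
          (FMap (cwfm_fun h) \<Delta> \<Gamma> f) (cwfm_Tm h (\<Gamma>, A) a))"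
  unfolding cwf_premaps_def Let_def mem_Collect_eq
    psh_Hom_iff[of "cwfm_Tm h" "elements (cwf_cat W) (cwf_Ty W)"]
  by (intro conj_cong refl) (auto simp: psh_Map[OF precwf_Ty[OF W]])

lemma
  assumes W: "precwf W" and h: "h \<in> cwf_premaps W V"
  shows cwf_premaps_functor: "is_functor (cwf_cat W) (cwf_cat V) (cwfm_fun h)"
    and cwf_premaps_Ty: "cwfm_Ty h \<in> Hom (psh (cwf_cat W)) (cwf_Ty W) (pull_psh (cwf_cat W) (cwfm_fun h) (cwf_Ty V))"
    and cwfm_Tm_extensional: "cwfm_Tm h \<in> extensional (Ob (elements (cwf_cat W) (cwf_Ty W)))"
    and cwfm_Tm_PiE: "\<lbrakk>\<Gamma> \<in> Ob (cwf_cat W); A \<in> FOb (cwf_Ty W) \<Gamma>\<rbrakk> \<Longrightarrow>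
      cwfm_Tm h (\<Gamma>, A) \<in> FOb (cwf_Tm W) (\<Gamma>, A) \<rightarrow>\<^sub>E FOb (cwf_Tm V) (FOb (cwfm_fun h) \<Gamma>, cwfm_Ty h \<Gamma> A)"
    and cwfm_Tm_in: "\<lbrakk>\<Gamma> \<in> Ob (cwf_cat W); A \<in> FOb (cwf_Ty W) \<Gamma>; a \<in> FOb (cwf_Tm W) (\<Gamma>, A)\<rbrakk> \<Longrightarrow>
      cwfm_Tm h (\<Gamma>, A) a \<in> FOb (cwf_Tm V) (FOb (cwfm_fun h) \<Gamma>, cwfm_Ty h \<Gamma> A)"
    and cwfm_Tm_natural: "\<lbrakk>\<Gamma> \<in> Ob (cwf_cat W); \<Delta> \<in> Ob (cwf_cat W); f \<in> Hom (cwf_cat W) \<Delta> \<Gamma>;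
        A \<in> FOb (cwf_Ty W) \<Gamma>; B = FMap (cwf_Ty W) \<Gamma> \<Delta> f A; a \<in> FOb (cwf_Tm W) (\<Gamma>, A)\<rbrakk> \<Longrightarrow>
      cwfm_Tm h (\<Delta>, B) (FMap (cwf_Tm W) (\<Gamma>, A) (\<Delta>, B) f a)
        = FMap (cwf_Tm V) (FOb (cwfm_fun h) \<Gamma>, cwfm_Ty h \<Gamma> A) (FOb (cwfm_fun h) \<Delta>, cwfm_Ty h \<Delta> B)
            (FMap (cwfm_fun h) \<Delta> \<Gamma> f) (cwfm_Tm h (\<Gamma>, A) a)"
  using h unfolding cwf_premaps_iff[OF W] by auto

lemma
  assumes W: "precwf W" and h: "h \<in> cwf_premaps W V" and \<Gamma>: "\<Gamma> \<in> Ob (cwf_cat W)"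
  shows cwfm_Ty_in: "A \<in> FOb (cwf_Ty W) \<Gamma> \<Longrightarrow> cwfm_Ty h \<Gamma> A \<in> FOb (cwf_Ty V) (FOb (cwfm_fun h) \<Gamma>)"
    and cwfm_Ty_natural: "\<lbrakk>\<Delta> \<in> Ob (cwf_cat W); f \<in> Hom (cwf_cat W) \<Delta> \<Gamma>; A \<in> FOb (cwf_Ty W) \<Gamma>\<rbrakk> \<Longrightarrow>
      cwfm_Ty h \<Delta> (FMap (cwf_Ty W) \<Gamma> \<Delta> f A)
        = FMap (cwf_Ty V) (FOb (cwfm_fun h) \<Gamma>) (FOb (cwfm_fun h) \<Delta>) (FMap (cwfm_fun h) \<Delta> \<Gamma> f) (cwfm_Ty h \<Gamma> A)"
  using \<Gamma> psh_Hom_in[OF cwf_premaps_Ty[OF W h], of \<Gamma> A]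
    psh_Hom_natural[OF cwf_premaps_Ty[OF W h], of \<Gamma> \<Delta> f A]
  by simp_all

lemmas cwf_premaps_simps = cwfm_Ty_in cwfm_Ty_natural cwfm_Tm_in cwfm_Tm_natural

lemma cwf_map_eqI:
  assumes W: "precwf W" and h: "h \<in> cwf_premaps W V" and k: "k \<in> cwf_premaps W U"
    and "cwfm_fun h = cwfm_fun k"
    and "\<And>\<Gamma> A. \<lbrakk>\<Gamma> \<in> Ob (cwf_cat W); A \<in> FOb (cwf_Ty W) \<Gamma>\<rbrakk> \<Longrightarrow> cwfm_Ty h \<Gamma> A = cwfm_Ty k \<Gamma> A"
    and "\<And>\<Gamma> A a. \<lbrakk>\<Gamma> \<in> Ob (cwf_cat W); A \<in> FOb (cwf_Ty W) \<Gamma>; a \<in> FOb (cwf_Tm W) (\<Gamma>, A)\<rbrakk>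
      \<Longrightarrow> cwfm_Tm h (\<Gamma>, A) a = cwfm_Tm k (\<Gamma>, A) a"
  shows "h = k"
proof -
  have "cwfm_Tm h (\<Gamma>, A) = cwfm_Tm k (\<Gamma>, A)" if "\<Gamma> \<in> Ob (cwf_cat W)" "A \<in> FOb (cwf_Ty W) \<Gamma>" for \<Gamma> A
    using cwfm_Tm_PiE[OF W h that] cwfm_Tm_PiE[OF W k that] assms(6)[OF that]
    by (auto simp: PiE_iff intro!: extensionalityI[of _ "FOb (cwf_Tm W) (\<Gamma>, A)"])
  then have "cwfm_Tm h = cwfm_Tm k"
    by (intro extensionalityI[OF cwfm_Tm_extensional[OF W h] cwfm_Tm_extensional[OF W k]]) auto
  then show ?thesis
    using assms(4) psh_Hom_eqI[OF cwf_premaps_Ty[OF W h] cwf_premaps_Ty[OF W k] assms(5)]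
    by (cases h; cases k) simp
qed

text \<open>Quantifies over all extensions, as \<open>pseudo_maps\<close> does over all representing
  pullbacks. In this form preservation refers to no choice, and it composes.\<close>

definition preserves_extensions :: "'u cwf \<Rightarrow> 'u cwf \<Rightarrow> 'u cwf_map \<Rightarrow> bool" where
  "preserves_extensions W V h \<longleftrightarrow> (\<forall>\<Gamma> A E \<pi> q. context_extension W \<Gamma> A E \<pi> q \<longrightarrow>
     context_extension V (FOb (cwfm_fun h) \<Gamma>) (cwfm_Ty h \<Gamma> A) (FOb (cwfm_fun h) E)
       (FMap (cwfm_fun h) E \<Gamma> \<pi>) (cwfm_Tm h (E, FMap (cwf_Ty W) \<Gamma> E \<pi> A) q))"

text \<open>Any two extensions of \<open>\<Gamma>\<close> by \<open>A\<close> are isomorphic, so preserving the chosen one suffices.\<close>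

lemma weak_cwf_maps_iff:
  assumes W: "is_cwf W" and V: "is_cwf V"
  shows "h \<in> weak_cwf_maps W V \<longleftrightarrow> h \<in> cwf_premaps W V \<and> preserves_extensions W V h"
proof
  assume "h \<in> cwf_premaps W V \<and> preserves_extensions W V h"
  then show "h \<in> weak_cwf_maps W V"
    using W unfolding weak_cwf_maps_def preserves_extensions_def is_cwf_iff Let_def by blast
next
  assume "h \<in> weak_cwf_maps W V"
  then have h: "h \<in> cwf_premaps W V"
    and chosen: "\<And>\<Gamma> A. \<lbrakk>\<Gamma> \<in> Ob (cwf_cat W); A \<in> FOb (cwf_Ty W) \<Gamma>\<rbrakk> \<Longrightarrow>
      context_extension V (FOb (cwfm_fun h) \<Gamma>) (cwfm_Ty h \<Gamma> A) (FOb (cwfm_fun h) (cwf_ctx W \<Gamma> A))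
        (FMap (cwfm_fun h) (cwf_ctx W \<Gamma> A) \<Gamma> (cwf_pr W \<Gamma> A))
        (cwfm_Tm h (cwf_ctx W \<Gamma> A, FMap (cwf_Ty W) \<Gamma> (cwf_ctx W \<Gamma> A) (cwf_pr W \<Gamma> A) A) (cwf_var W \<Gamma> A))"
    by (auto simp: weak_cwf_maps_def Let_def)
  have W': "precwf W" and V': "precwf V" using W V by (simp_all add: is_cwf_precwf)
  have F: "is_functor (cwf_cat W) (cwf_cat V) (cwfm_fun h)"
    using W' h by (rule cwf_premaps_functor)
  have "context_extension V (FOb (cwfm_fun h) \<Gamma>) (cwfm_Ty h \<Gamma> A) (FOb (cwfm_fun h) E)
       (FMap (cwfm_fun h) E \<Gamma> \<pi>) (cwfm_Tm h (E, FMap (cwf_Ty W) \<Gamma> E \<pi> A) q)"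
    if E: "context_extension W \<Gamma> A E \<pi> q" for \<Gamma> A E \<pi> q
  proof -
    define E0 \<pi>0 q0 where "E0 = cwf_ctx W \<Gamma> A" and "\<pi>0 = cwf_pr W \<Gamma> A" and "q0 = cwf_var W \<Gamma> A"
    note * [simp] = context_extension_data[OF E]
    have E0: "context_extension W \<Gamma> A E0 \<pi>0 q0"
      using W by (simp add: is_cwf_iff E0_def \<pi>0_def q0_def)
    note [simp] = context_extension_data[OF E0] functor_Ob[OF F] functor_Hom[OF F]
    obtain u v where uv: "u \<in> Hom (cwf_cat W) E E0" "v \<in> Hom (cwf_cat W) E0 E"
      "Comp (cwf_cat W) E0 E E0 u v = Ide (cwf_cat W) E0" "Comp (cwf_cat W) E E0 E v u = Ide (cwf_cat W) E"
      "Comp (cwf_cat W) E E0 \<Gamma> \<pi>0 u = \<pi>"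
      "FMap (cwf_Tm W) (E0, FMap (cwf_Ty W) \<Gamma> E0 \<pi>0 A) (E, FMap (cwf_Ty W) \<Gamma> E \<pi> A) u q0 = q"
      by (rule context_extension_unique[OF W' E0 E])
    note [simp] = uv(1,2)
    have uA: "FMap (cwf_Ty W) E0 E u (FMap (cwf_Ty W) \<Gamma> E0 \<pi>0 A) = FMap (cwf_Ty W) \<Gamma> E \<pi> A"
      using psh_Comp[OF precwf_Ty[OF W'], of \<Gamma> E0 E \<pi>0 u A] uv(5) by simp
    show ?thesis
    proof (rule context_extension_transport[OF V'])
      show "context_extension V (FOb (cwfm_fun h) \<Gamma>) (cwfm_Ty h \<Gamma> A) (FOb (cwfm_fun h) E0)
        (FMap (cwfm_fun h) E0 \<Gamma> \<pi>0) (cwfm_Tm h (E0, FMap (cwf_Ty W) \<Gamma> E0 \<pi>0 A) q0)"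
        unfolding E0_def \<pi>0_def q0_def by (rule chosen) simp_all
      show "Comp (cwf_cat V) (FOb (cwfm_fun h) E0) (FOb (cwfm_fun h) E) (FOb (cwfm_fun h) E0)
          (FMap (cwfm_fun h) E E0 u) (FMap (cwfm_fun h) E0 E v) = Ide (cwf_cat V) (FOb (cwfm_fun h) E0)"
        "Comp (cwf_cat V) (FOb (cwfm_fun h) E) (FOb (cwfm_fun h) E0) (FOb (cwfm_fun h) E)
          (FMap (cwfm_fun h) E0 E v) (FMap (cwfm_fun h) E E0 u) = Ide (cwf_cat V) (FOb (cwfm_fun h) E)"
        "Comp (cwf_cat V) (FOb (cwfm_fun h) E) (FOb (cwfm_fun h) E0) (FOb (cwfm_fun h) \<Gamma>)
          (FMap (cwfm_fun h) E0 \<Gamma> \<pi>0) (FMap (cwfm_fun h) E E0 u) = FMap (cwfm_fun h) E \<Gamma> \<pi>"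
        by (simp_all add: functor_Comp[OF F, symmetric] functor_Ide[OF F] uv(3-5))
      \<comment> \<open>Naturality of the term map at \<open>u\<close> identifies the transported
        generic term with the image of \<open>q\<close>.\<close>
      have "cwfm_Tm h (E, FMap (cwf_Ty W) \<Gamma> E \<pi> A)
          (FMap (cwf_Tm W) (E0, FMap (cwf_Ty W) \<Gamma> E0 \<pi>0 A) (E, FMap (cwf_Ty W) \<Gamma> E \<pi> A) u q0)
        = FMap (cwf_Tm V) (FOb (cwfm_fun h) E0, cwfm_Ty h E0 (FMap (cwf_Ty W) \<Gamma> E0 \<pi>0 A))
            (FOb (cwfm_fun h) E, cwfm_Ty h E (FMap (cwf_Ty W) \<Gamma> E \<pi> A))
            (FMap (cwfm_fun h) E E0 u) (cwfm_Tm h (E0, FMap (cwf_Ty W) \<Gamma> E0 \<pi>0 A) q0)"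
        by (rule cwfm_Tm_natural[OF W' h]) (simp_all add: uA psh_Map[OF precwf_Ty[OF W']])
      then show "FMap (cwf_Tm V)
          (FOb (cwfm_fun h) E0, FMap (cwf_Ty V) (FOb (cwfm_fun h) \<Gamma>) (FOb (cwfm_fun h) E0)
            (FMap (cwfm_fun h) E0 \<Gamma> \<pi>0) (cwfm_Ty h \<Gamma> A))
          (FOb (cwfm_fun h) E, FMap (cwf_Ty V) (FOb (cwfm_fun h) \<Gamma>) (FOb (cwfm_fun h) E)
            (FMap (cwfm_fun h) E \<Gamma> \<pi>) (cwfm_Ty h \<Gamma> A))
          (FMap (cwfm_fun h) E E0 u) (cwfm_Tm h (E0, FMap (cwf_Ty W) \<Gamma> E0 \<pi>0 A) q0)
        = cwfm_Tm h (E, FMap (cwf_Ty W) \<Gamma> E \<pi> A) q"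
        by (simp add: uv(6) cwfm_Ty_natural[OF W' h])
    qed simp_all
  qed
  then show "h \<in> cwf_premaps W V \<and> preserves_extensions W V h"
    using h unfolding preserves_extensions_def by blast
qed

lemma cwf_id_simps [simp]:
  "cwfm_fun (cwf_id W) = id_fun (cwf_cat W)"
  "\<lbrakk>\<Gamma> \<in> Ob (cwf_cat W); A \<in> FOb (cwf_Ty W) \<Gamma>\<rbrakk> \<Longrightarrow> cwfm_Ty (cwf_id W) \<Gamma> A = A"
  "\<lbrakk>\<Gamma> \<in> Ob (cwf_cat W); A \<in> FOb (cwf_Ty W) \<Gamma>; a \<in> FOb (cwf_Tm W) (\<Gamma>, A)\<rbrakk>
    \<Longrightarrow> cwfm_Tm (cwf_id W) (\<Gamma>, A) a = a"
  by (simp_all add: cwf_id_def)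

lemma cwf_comp_simps [simp]:
  "cwfm_fun (cwf_comp W k h) = comp_fun (cwf_cat W) (cwfm_fun k) (cwfm_fun h)"
  "\<lbrakk>\<Gamma> \<in> Ob (cwf_cat W); A \<in> FOb (cwf_Ty W) \<Gamma>\<rbrakk>
    \<Longrightarrow> cwfm_Ty (cwf_comp W k h) \<Gamma> A = cwfm_Ty k (FOb (cwfm_fun h) \<Gamma>) (cwfm_Ty h \<Gamma> A)"
  "\<lbrakk>\<Gamma> \<in> Ob (cwf_cat W); A \<in> FOb (cwf_Ty W) \<Gamma>; a \<in> FOb (cwf_Tm W) (\<Gamma>, A)\<rbrakk>
    \<Longrightarrow> cwfm_Tm (cwf_comp W k h) (\<Gamma>, A) a
      = cwfm_Tm k (FOb (cwfm_fun h) \<Gamma>, cwfm_Ty h \<Gamma> A) (cwfm_Tm h (\<Gamma>, A) a)"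
  by (simp_all add: cwf_comp_def compose_def)

lemma cwf_id_premaps:
  assumes W: "precwf W"
  shows "cwf_id W \<in> cwf_premaps W W"
proof -
  note [simp] = psh_simps[OF precwf_Ty[OF W]] precwf_Tm_simps[OF W]
  show ?thesis
    unfolding cwf_premaps_iff[OF W]
    by (auto simp: is_functor_id_fun precwf_category W psh_Hom_iff)
      (auto simp: cwf_id_def)
qed

lemma cwf_comp_premaps:
  assumes h: "h \<in> cwf_premaps W V" and k: "k \<in> cwf_premaps V U" and W: "precwf W" and V: "precwf V"
  shows "cwf_comp W k h \<in> cwf_premaps W U"
proof -
  note [simp] = psh_simps[OF precwf_Ty[OF W]] precwf_Tm_simps[OF W]
    functor_simps[OF cwf_premaps_functor[OF W h]] cwf_premaps_simps[OF W h] cwf_premaps_simps[OF V k]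
  show ?thesis
    unfolding cwf_premaps_iff[OF W]
    using is_functor_comp_fun[OF cwf_premaps_functor[OF W h] cwf_premaps_functor[OF V k]]
    by (auto simp: psh_Hom_iff) (auto simp: cwf_comp_def compose_def)
qed

lemma cwf_id_preserves_extensions:
  assumes W: "precwf W"
  shows "preserves_extensions W W (cwf_id W)"
  unfolding preserves_extensions_def
proof (intro allI impI)
  fix \<Gamma> A E \<pi> q assume E: "context_extension W \<Gamma> A E \<pi> q"
  note [simp] = context_extension_data[OF E] psh_Map[OF precwf_Ty[OF W]]
  show "context_extension W (FOb (cwfm_fun (cwf_id W)) \<Gamma>) (cwfm_Ty (cwf_id W) \<Gamma> A)
      (FOb (cwfm_fun (cwf_id W)) E) (FMap (cwfm_fun (cwf_id W)) E \<Gamma> \<pi>)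
      (cwfm_Tm (cwf_id W) (E, FMap (cwf_Ty W) \<Gamma> E \<pi> A) q)"
    by (simp add: E)
qed

lemma cwf_comp_preserves_extensions:
  assumes W: "precwf W" and h: "h \<in> cwf_premaps W V"
    and ph: "preserves_extensions W V h" and pk: "preserves_extensions V U k"
  shows "preserves_extensions W U (cwf_comp W k h)"
  unfolding preserves_extensions_def
proof (intro allI impI)
  fix \<Gamma> A E \<pi> q assume E: "context_extension W \<Gamma> A E \<pi> q"
  note [simp] = context_extension_data[OF E] psh_Map[OF precwf_Ty[OF W]]
    functor_simps[OF cwf_premaps_functor[OF W h]] cwf_premaps_simps[OF W h]
  show "context_extension U (FOb (cwfm_fun (cwf_comp W k h)) \<Gamma>) (cwfm_Ty (cwf_comp W k h) \<Gamma> A)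
      (FOb (cwfm_fun (cwf_comp W k h)) E) (FMap (cwfm_fun (cwf_comp W k h)) E \<Gamma> \<pi>)
      (cwfm_Tm (cwf_comp W k h) (E, FMap (cwf_Ty W) \<Gamma> E \<pi> A) q)"
    using pk[unfolded preserves_extensions_def, rule_format,
        OF ph[unfolded preserves_extensions_def, rule_format, OF E]]
    by simp
qed

lemma cwf_comp_cwf_id:
  assumes h: "h \<in> cwf_premaps W V" and W: "precwf W" and V: "precwf V"
  shows "cwf_comp W h (cwf_id W) = h" "cwf_comp W (cwf_id V) h = h"
proof -
  note [simp] = cwf_premaps_simps[OF W h] functor_simps[OF cwf_premaps_functor[OF W h]]
    comp_fun_id_fun[OF cwf_premaps_functor[OF W h]]
  show "cwf_comp W h (cwf_id W) = h"
    by (rule cwf_map_eqI[OF W cwf_comp_premaps[OF cwf_id_premaps[OF W] h W W] h]) simp_all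
  show "cwf_comp W (cwf_id V) h = h"
    by (rule cwf_map_eqI[OF W cwf_comp_premaps[OF h cwf_id_premaps[OF V] W V] h]) simp_all
qed

lemma cwf_comp_assoc:
  assumes h: "h \<in> cwf_premaps W V" and k: "k \<in> cwf_premaps V U" and l: "l \<in> cwf_premaps U T"
    and W: "precwf W" and V: "precwf V" and U: "precwf U"
  shows "cwf_comp W (cwf_comp V l k) h = cwf_comp W l (cwf_comp W k h)"
  by (rule cwf_map_eqI[OF W cwf_comp_premaps[OF h cwf_comp_premaps[OF k l V U] W V]
        cwf_comp_premaps[OF cwf_comp_premaps[OF h k W V] l W U]])
    (simp_all add: comp_fun_assoc[OF cwf_premaps_functor[OF W h] cwf_premaps_functor[OF V k]
        cwf_premaps_functor[OF U l]] cwf_premaps_simps[OF W h] functor_simps[OF cwf_premaps_functor[OF W h]])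

lemma cwf_transformations_iff:
  "\<alpha> \<in> cwf_transformations W V h k \<longleftrightarrow>
     \<alpha> \<in> nat_trans (cwf_cat W) (cwf_cat V) (cwfm_fun h) (cwfm_fun k) \<and>
     (\<forall>\<Gamma>\<in>Ob (cwf_cat W). \<forall>A\<in>FOb (cwf_Ty W) \<Gamma>.
        FMap (cwf_Ty V) (FOb (cwfm_fun k) \<Gamma>) (FOb (cwfm_fun h) \<Gamma>) (\<alpha> \<Gamma>) (cwfm_Ty k \<Gamma> A) = cwfm_Ty h \<Gamma> A) \<and>
     (\<forall>\<Gamma>\<in>Ob (cwf_cat W). \<forall>A\<in>FOb (cwf_Ty W) \<Gamma>. \<forall>a\<in>FOb (cwf_Tm W) (\<Gamma>, A).
        FMap (cwf_Tm V) (FOb (cwfm_fun k) \<Gamma>, cwfm_Ty k \<Gamma> A) (FOb (cwfm_fun h) \<Gamma>, cwfm_Ty h \<Gamma> A)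
          (\<alpha> \<Gamma>) (cwfm_Tm k (\<Gamma>, A) a) = cwfm_Tm h (\<Gamma>, A) a)"
  by (auto simp: cwf_transformations_def)

interpretation CwF: cat2_over_Cat "{W :: 'u cwf. is_cwf W}" cwf_cat weak_cwf_maps cwfm_fun
  cwf_transformations cwf_id cwf_comp
proof (unfold_locales; (unfold mem_Collect_eq)?)
  fix W V U T :: "'u cwf"
  show "cwf_id W \<in> weak_cwf_maps W W" if "is_cwf W"
    using that by (simp add: weak_cwf_maps_iff cwf_id_premaps cwf_id_preserves_extensions is_cwf_precwf)
  \<comment> \<open>A weak map may send a chosen extension to one that is not chosen, so closure
    under composition goes through preservation of all extensions.\<close>
  show "cwf_comp W k h \<in> weak_cwf_maps W U"
    if "is_cwf W" "is_cwf V" "is_cwf U" "h \<in> weak_cwf_maps W V" "k \<in> weak_cwf_maps V U"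
    for h k
    using that cwf_comp_premaps[of h W V k U] cwf_comp_preserves_extensions[of W h V U k]
    by (simp add: weak_cwf_maps_iff is_cwf_precwf)
  show "cwf_comp W h (cwf_id W) = h" "cwf_comp W (cwf_id V) h = h"
    if "is_cwf W" "is_cwf V" "h \<in> weak_cwf_maps W V" for h
    using that cwf_comp_cwf_id[of h W V] by (simp_all add: weak_cwf_maps_iff is_cwf_precwf)
  show "cwf_comp W (cwf_comp V l k) h = cwf_comp W l (cwf_comp W k h)"
    if "is_cwf W" "is_cwf V" "is_cwf U" "is_cwf T"
      "h \<in> weak_cwf_maps W V" "k \<in> weak_cwf_maps V U" "l \<in> weak_cwf_maps U T"
    for h k l
    using that cwf_comp_assoc[of h W V k U l T] by (simp add: weak_cwf_maps_iff is_cwf_precwf)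
  fix h h' h'' k k' \<alpha> \<beta>
  assume W0: "is_cwf W" and V0: "is_cwf V" and "h \<in> weak_cwf_maps W V"
  then have h: "h \<in> cwf_premaps W V" and W: "precwf W" and V: "precwf V"
    by (simp_all add: weak_cwf_maps_iff is_cwf_precwf)
  have F: "is_functor (cwf_cat W) (cwf_cat V) (cwfm_fun h)" by (rule cwf_premaps_functor[OF W h])
  then show "is_functor (cwf_cat W) (cwf_cat V) (cwfm_fun h)" .
  note [simp] = cwf_premaps_simps[OF W h] functor_simps[OF F]
    psh_simps[OF precwf_Ty[OF W]] precwf_Tm_simps[OF W]
    psh_simps[OF precwf_Ty[OF V]] precwf_Tm_simps[OF V]
  note V_cat = precwf_category[OF V]
  show "Ide (fun_cat (cwf_cat W) (cwf_cat V)) (cwfm_fun h) \<in> cwf_transformations W V h h"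
    using category_Ide[OF category_fun_cat[OF V_cat], of "cwfm_fun h" "cwf_cat W"] F
    by (simp add: cwf_transformations_iff)
  assume h'0: "h' \<in> weak_cwf_maps W V" and \<alpha>: "\<alpha> \<in> cwf_transformations W V h h'"
  then have h': "h' \<in> cwf_premaps W V"
    by (simp add: weak_cwf_maps_iff W0 V0)
  note F' = cwf_premaps_functor[OF W h']
  note [simp] = cwf_premaps_simps[OF W h'] functor_simps[OF F']
  show \<alpha>_nt: "\<alpha> \<in> nat_trans (cwf_cat W) (cwf_cat V) (cwfm_fun h) (cwfm_fun h')"
    using \<alpha> by (simp add: cwf_transformations_iff)
  have \<alpha>_Ty: "FMap (cwf_Ty V) (FOb (cwfm_fun h') \<Gamma>) (FOb (cwfm_fun h) \<Gamma>) (\<alpha> \<Gamma>) (cwfm_Ty h' \<Gamma> A) = cwfm_Ty h \<Gamma> A"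
    and \<alpha>_Tm: "a \<in> FOb (cwf_Tm W) (\<Gamma>, A) \<Longrightarrow>
      FMap (cwf_Tm V) (FOb (cwfm_fun h') \<Gamma>, cwfm_Ty h' \<Gamma> A) (FOb (cwfm_fun h) \<Gamma>, cwfm_Ty h \<Gamma> A)
        (\<alpha> \<Gamma>) (cwfm_Tm h' (\<Gamma>, A) a) = cwfm_Tm h (\<Gamma>, A) a"
    if "\<Gamma> \<in> Ob (cwf_cat W)" "A \<in> FOb (cwf_Ty W) \<Gamma>" for \<Gamma> A a
    using \<alpha> that by (simp_all add: cwf_transformations_iff)
  note [simp] = nat_trans_Hom[OF \<alpha>_nt] \<alpha>_Ty \<alpha>_Tm
  show "Comp (fun_cat (cwf_cat W) (cwf_cat V)) (cwfm_fun h) (cwfm_fun h') (cwfm_fun h'') \<beta> \<alpha>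
      \<in> cwf_transformations W V h h''"
    if h''0: "h'' \<in> weak_cwf_maps W V" and \<beta>: "\<beta> \<in> cwf_transformations W V h' h''"
  proof -
    have h'': "h'' \<in> cwf_premaps W V"
      using h''0 by (simp add: weak_cwf_maps_iff W0 V0)
    have \<beta>_nt: "\<beta> \<in> nat_trans (cwf_cat W) (cwf_cat V) (cwfm_fun h') (cwfm_fun h'')"
      using \<beta> by (simp add: cwf_transformations_iff)
    note [simp] = cwf_premaps_simps[OF W h''] functor_simps[OF cwf_premaps_functor[OF W h'']]
      nat_trans_Hom[OF \<beta>_nt]
    show ?thesis
      using category_Comp[OF category_fun_cat[OF V_cat], of "cwfm_fun h" "cwf_cat W" "cwfm_fun h'" "cwfm_fun h''" \<alpha> \<beta>]
        F F' cwf_premaps_functor[OF W h''] \<alpha>_nt \<beta>_nt \<beta>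
      by (simp add: cwf_transformations_iff)
  qed
  show "hcomp (cwf_cat W) (cwf_cat U) (cwfm_fun k) (cwfm_fun k') (cwfm_fun h) (cwfm_fun h') \<beta> \<alpha>
      \<in> cwf_transformations W U (cwf_comp W k h) (cwf_comp W k' h')"
    if U0: "is_cwf U" and k0: "k \<in> weak_cwf_maps V U" and k'0: "k' \<in> weak_cwf_maps V U"
      and \<beta>: "\<beta> \<in> cwf_transformations V U k k'"
  proof -
    have U: "precwf U" and k: "k \<in> cwf_premaps V U" and k': "k' \<in> cwf_premaps V U"
      using U0 k0 k'0 V0 by (simp_all add: weak_cwf_maps_iff is_cwf_precwf)
    note G = cwf_premaps_functor[OF V k] and G' = cwf_premaps_functor[OF V k']
    have \<beta>_nt: "\<beta> \<in> nat_trans (cwf_cat V) (cwf_cat U) (cwfm_fun k) (cwfm_fun k')"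
      using \<beta> by (simp add: cwf_transformations_iff)
    note [simp] = functor_simps[OF G] functor_simps[OF G'] nat_trans_Hom[OF \<beta>_nt]
      psh_simps[OF precwf_Ty[OF U]] precwf_Tm_simps[OF U]
      cwfm_Ty_in[OF V k] cwfm_Ty_in[OF V k'] cwfm_Tm_in[OF V k] cwfm_Tm_in[OF V k']
      cwfm_Ty_natural[OF V k, symmetric] cwfm_Tm_natural[OF V k, symmetric]
    show ?thesis
      using hcomp_nat_trans[OF F F' G G' \<alpha>_nt \<beta>_nt] \<beta>
      by (simp add: cwf_transformations_iff hcomp_def)
  qed
qed simp_all

lemma CwF_wk_eq: "CwF_wk = CwF.the_cat2"
  by (simp add: CwF_wk_def CwF.the_cat2_def cwf_hom_cat_def CwF.hom_cat_def fun_eq_iff)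

section \<open>The fibres of a natural model\<close>

definition fibre :: "('u, 'z) natmod_scheme \<Rightarrow> 'u \<Rightarrow> 'u \<Rightarrow> 'u set" where
  "fibre M \<Gamma> A = {a \<in> FOb (nm_Tm M) \<Gamma>. nm_p M \<Gamma> a = A}"

text \<open>The extension data are parameters, so that one construction serves structured models,
  which bring their own, and plain ones, for which extensions are picked by choice.\<close>

definition cwf_of_nm ::
  "('u, 'z) natmod_scheme \<Rightarrow> ('u \<Rightarrow> 'u \<Rightarrow> 'u) \<Rightarrow> ('u \<Rightarrow> 'u \<Rightarrow> 'u) \<Rightarrow> ('u \<Rightarrow> 'u \<Rightarrow> 'u) \<Rightarrow> 'u cwf" where
  "cwf_of_nm M ctx pr var = \<lparr>cwf_cat = nm_cat M, cwf_Ty = nm_Ty M,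
     cwf_Tm = mk_functor (op_cat (elements (nm_cat M) (nm_Ty M)))
       (\<lambda>(\<Gamma>, A). fibre M \<Gamma> A) (\<lambda>(\<Gamma>, A) (\<Delta>, B) f. \<lambda>a\<in>fibre M \<Gamma> A. FMap (nm_Tm M) \<Gamma> \<Delta> f a),
     cwf_ctx = ctx, cwf_pr = pr, cwf_var = var\<rparr>"

lemma cwf_of_nm_simps [simp]:
  "cwf_cat (cwf_of_nm M ctx pr var) = nm_cat M" "cwf_Ty (cwf_of_nm M ctx pr var) = nm_Ty M"
  "cwf_ctx (cwf_of_nm M ctx pr var) = ctx" "cwf_pr (cwf_of_nm M ctx pr var) = pr"
  "cwf_var (cwf_of_nm M ctx pr var) = var"
  by (simp_all add: cwf_of_nm_def)

lemma cwf_of_nm_Tm_Ob [simp]: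
  "\<lbrakk>\<Gamma> \<in> Ob (nm_cat M); A \<in> FOb (nm_Ty M) \<Gamma>\<rbrakk>
    \<Longrightarrow> FOb (cwf_Tm (cwf_of_nm M ctx pr var)) (\<Gamma>, A) = fibre M \<Gamma> A"
  by (simp add: cwf_of_nm_def)

lemma cwf_of_nm_Tm_Map [simp]:
  "\<lbrakk>\<Gamma> \<in> Ob (nm_cat M); A \<in> FOb (nm_Ty M) \<Gamma>; \<Delta> \<in> Ob (nm_cat M); B \<in> FOb (nm_Ty M) \<Delta>;
    f \<in> Hom (nm_cat M) \<Delta> \<Gamma>; FMap (nm_Ty M) \<Gamma> \<Delta> f A = B; a \<in> fibre M \<Gamma> A\<rbrakk>
    \<Longrightarrow> FMap (cwf_Tm (cwf_of_nm M ctx pr var)) (\<Gamma>, A) (\<Delta>, B) f a = FMap (nm_Tm M) \<Gamma> \<Delta> f a"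
  by (simp add: cwf_of_nm_def)

lemma fibre_iff: "a \<in> fibre M \<Gamma> A \<longleftrightarrow> a \<in> FOb (nm_Tm M) \<Gamma> \<and> nm_p M \<Gamma> a = A"
  by (simp add: fibre_def)

text \<open>Naturality of \<open>nm_p\<close> makes restriction along \<open>f\<close> carry the
  fibre over \<open>A\<close> into the fibre over the restriction of \<open>A\<close>; the presheaf
  laws are then inherited from \<open>nm_Tm M\<close>.\<close>

lemma precwf_cwf_of_nm:
  assumes M: "premodel M"
  shows "precwf (cwf_of_nm M ctx pr var)"
proof -
  note [simp] = psh_simps[OF premodel_Ty[OF M]] psh_simps[OF premodel_Tm[OF M]]
    psh_Hom_natural[OF premodel_p[OF M]] category_simps[OF premodel_category[OF M]]
  have "cwf_Tm (cwf_of_nm M ctx pr var) \<in> Ob (psh (elements (nm_cat M) (nm_Ty M)))"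
    unfolding cwf_of_nm_def cwf.simps
    by (rule mk_functor_elements_pshI[OF premodel_Ty[OF M]]) (auto simp: fibre_iff)
  then show ?thesis using M by (simp add: precwf_def premodel_def)
qed

text \<open>After \<open>representing_pullback_iff\<close> the two universal properties coincide:
  the hypothesis that \<open>a\<close> has the restriction of \<open>A\<close> as its type is
  membership of \<open>a\<close> in the corresponding fibre.\<close>

lemma context_extension_cwf_of_nm:
  assumes M: "premodel M"
  shows "context_extension (cwf_of_nm M ctx pr var) \<Gamma> A E \<pi> q \<longleftrightarrow> representing_pullback M \<Gamma> A E \<pi> q"
proof -
  note [simp] = psh_Map[OF premodel_Ty[OF M]]
  \<comment> \<open>When \<open>\<pi>\<close> after \<open>g\<close> is \<open>f\<close>, the two
    restricted types are related by \<open>g\<close>, and restriction in the fibre presheaf is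
    restriction in \<open>nm_Tm M\<close>. The other conjuncts supply this equation, so it is used
    inside the equivalence.\<close>
  have eq: "(g \<in> Hom (nm_cat M) \<Delta> E \<and> Comp (nm_cat M) \<Delta> E \<Gamma> \<pi> g = f \<and>
      FMap (cwf_Tm (cwf_of_nm M ctx pr var)) (E, FMap (nm_Ty M) \<Gamma> E \<pi> A) (\<Delta>, FMap (nm_Ty M) \<Gamma> \<Delta> f A) g q = a)
    \<longleftrightarrow> (g \<in> Hom (nm_cat M) \<Delta> E \<and> Comp (nm_cat M) \<Delta> E \<Gamma> \<pi> g = f \<and> FMap (nm_Tm M) E \<Delta> g q = a)"
    if "\<Gamma> \<in> Ob (nm_cat M)" "A \<in> FOb (nm_Ty M) \<Gamma>" "E \<in> Ob (nm_cat M)" "\<pi> \<in> Hom (nm_cat M) E \<Gamma>"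
      "q \<in> fibre M E (FMap (nm_Ty M) \<Gamma> E \<pi> A)" "\<Delta> \<in> Ob (nm_cat M)" "f \<in> Hom (nm_cat M) \<Delta> \<Gamma>" for \<Delta> f g a
    using that psh_Comp[OF premodel_Ty[OF M], of \<Gamma> E \<Delta> \<pi> g A] by auto
  have fibre: "(\<forall>a\<in>FOb (nm_Tm M) \<Delta>. nm_p M \<Delta> a = B \<longrightarrow> Q a) \<longleftrightarrow> (\<forall>a\<in>fibre M \<Delta> B. Q a)" for \<Delta> B Q
    by (auto simp: fibre_iff)
  show ?thesis
    unfolding representing_pullback_iff[OF M] fibre context_extension_def Let_def
    by (simp add: eq fibre_iff[of q] cong: conj_cong ball_cong)
qed

lemma is_cwf_cwf_of_nm:
  assumes "premodel M"
    and "\<And>\<Gamma> A. \<lbrakk>\<Gamma> \<in> Ob (nm_cat M); A \<in> FOb (nm_Ty M) \<Gamma>\<rbrakk>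
      \<Longrightarrow> representing_pullback M \<Gamma> A (ctx \<Gamma> A) (pr \<Gamma> A) (var \<Gamma> A)"
  shows "is_cwf (cwf_of_nm M ctx pr var)"
  using assms by (simp add: is_cwf_iff precwf_cwf_of_nm context_extension_cwf_of_nm)

section \<open>Fibrewise maps: the comparison on 1-cells and 2-cells\<close>

definition cwf_map_of :: "('u, 'z) natmod_scheme \<Rightarrow> 'u nm_map \<Rightarrow> 'u cwf_map" where
  "cwf_map_of M h = \<lparr>cwfm_fun = nmm_fun h, cwfm_Ty = nmm_Ty h,
     cwfm_Tm = (\<lambda>(\<Gamma>, A)\<in>Ob (elements (nm_cat M) (nm_Ty M)). \<lambda>a\<in>fibre M \<Gamma> A. nmm_Tm h \<Gamma> a)\<rparr>"

text \<open>The fibres partition the terms over \<open>\<Gamma>\<close>, so maps on the fibres glue;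
  \<open>nm_p\<close> finds the fibre of a given term.\<close>

definition nm_map_of :: "('u, 'z) natmod_scheme \<Rightarrow> 'u cwf_map \<Rightarrow> 'u nm_map" where
  "nm_map_of M k = \<lparr>nmm_fun = cwfm_fun k, nmm_Ty = cwfm_Ty k,
     nmm_Tm = (\<lambda>\<Gamma>\<in>Ob (nm_cat M). \<lambda>a\<in>FOb (nm_Tm M) \<Gamma>. cwfm_Tm k (\<Gamma>, nm_p M \<Gamma> a) a)\<rparr>"

lemma cwf_map_of_simps [simp]:
  "cwfm_fun (cwf_map_of M h) = nmm_fun h" "cwfm_Ty (cwf_map_of M h) = nmm_Ty h"
  "\<lbrakk>\<Gamma> \<in> Ob (nm_cat M); A \<in> FOb (nm_Ty M) \<Gamma>; a \<in> fibre M \<Gamma> A\<rbrakk>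
    \<Longrightarrow> cwfm_Tm (cwf_map_of M h) (\<Gamma>, A) a = nmm_Tm h \<Gamma> a"
  by (simp_all add: cwf_map_of_def)

lemma nm_map_of_simps [simp]:
  "nmm_fun (nm_map_of M k) = cwfm_fun k" "nmm_Ty (nm_map_of M k) = cwfm_Ty k"
  "\<lbrakk>\<Gamma> \<in> Ob (nm_cat M); a \<in> FOb (nm_Tm M) \<Gamma>\<rbrakk>
    \<Longrightarrow> nmm_Tm (nm_map_of M k) \<Gamma> a = cwfm_Tm k (\<Gamma>, nm_p M \<Gamma> a) a"
  by (simp_all add: nm_map_of_def)

lemma cwf_map_of_premaps:
  assumes M: "premodel M" and N: "premodel N" and h: "h \<in> pseudo_maps M N"
  shows "cwf_map_of M h \<in> cwf_premaps (cwf_of_nm M c r v) (cwf_of_nm N c' r' v')"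
proof -
  note [simp] = psh_simps[OF premodel_Ty[OF M]] psh_simps[OF premodel_Tm[OF M]]
    psh_Hom_natural[OF premodel_p[OF M]] psh_Map[OF premodel_Ty[OF N]]
    functor_simps[OF pseudo_maps_functor[OF h]] pseudo_maps_simps[OF h]
  show ?thesis
    unfolding cwf_premaps_iff[OF precwf_cwf_of_nm[OF M]]
    using pseudo_maps_functor[OF h] pseudo_maps_Ty[OF h]
    by (auto simp: fibre_iff) (auto simp: cwf_map_of_def fibre_iff)
qed

lemma cwf_map_of_preserves_extensions:
  assumes M: "premodel M" and N: "premodel N" and h: "h \<in> pseudo_maps M N"
  shows "preserves_extensions (cwf_of_nm M c r v) (cwf_of_nm N c' r' v') (cwf_map_of M h)"
proof -
  have "cwfm_Tm (cwf_map_of M h) (E, FMap (nm_Ty M) \<Gamma> E \<pi> A) q = nmm_Tm h E q"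
    if "representing_pullback M \<Gamma> A E \<pi> q" for \<Gamma> A E \<pi> q
    using that unfolding representing_pullback_iff[OF M]
    by (simp add: psh_Map[OF premodel_Ty[OF M]] fibre_iff)
  then show ?thesis
    using pseudo_maps_representing[OF h]
    by (simp add: preserves_extensions_def context_extension_cwf_of_nm M N)
qed

text \<open>That \<open>k\<close> carries fibres into fibres is precisely the commutativity of the
  square with \<open>nm_p\<close>. Naturality transfers because restriction in a fibre presheaf is
  restriction of terms.\<close>

lemma nm_map_of_pseudo_maps:
  fixes M N :: "('u, 'z) natmod_scheme"
  assumes M: "premodel M" and N: "premodel N"
    and k: "k \<in> cwf_premaps (cwf_of_nm M c r v) (cwf_of_nm N c' r' v')"
    and pk: "preserves_extensions (cwf_of_nm M c r v) (cwf_of_nm N c' r' v') k"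
  shows "nm_map_of M k \<in> pseudo_maps M N"
proof -
  note M' = precwf_cwf_of_nm[OF M, of c r v]
  note [simp] = psh_simps[OF premodel_Ty[OF M]] psh_simps[OF premodel_Tm[OF M]]
    psh_Hom_natural[OF premodel_p[OF M]] psh_Hom_in[OF premodel_p[OF M]]
    functor_simps[OF cwf_premaps_functor[OF M' k, simplified]]
  have Ty_in [simp]: "cwfm_Ty k \<Gamma> A \<in> FOb (nm_Ty N) (FOb (cwfm_fun k) \<Gamma>)"
    if "\<Gamma> \<in> Ob (nm_cat M)" "A \<in> FOb (nm_Ty M) \<Gamma>" for \<Gamma> A
    using cwfm_Ty_in[OF M' k] that by simp
  have Ty_natural: "FMap (nm_Ty N) (FOb (cwfm_fun k) \<Gamma>) (FOb (cwfm_fun k) \<Delta>) (FMap (cwfm_fun k) \<Delta> \<Gamma> f)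
      (cwfm_Ty k \<Gamma> A) = cwfm_Ty k \<Delta> (FMap (nm_Ty M) \<Gamma> \<Delta> f A)"
    if "\<Gamma> \<in> Ob (nm_cat M)" "\<Delta> \<in> Ob (nm_cat M)" "f \<in> Hom (nm_cat M) \<Delta> \<Gamma>" "A \<in> FOb (nm_Ty M) \<Gamma>" for \<Gamma> \<Delta> f A
    using cwfm_Ty_natural[OF M' k, of \<Gamma> \<Delta> f A] that by simp
  have Tm_in: "cwfm_Tm k (\<Gamma>, nm_p M \<Gamma> a) a \<in> fibre N (FOb (cwfm_fun k) \<Gamma>) (cwfm_Ty k \<Gamma> (nm_p M \<Gamma> a))"
    if "\<Gamma> \<in> Ob (nm_cat M)" "a \<in> FOb (nm_Tm M) \<Gamma>" for \<Gamma> a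
    using cwfm_Tm_in[OF M' k, of \<Gamma> "nm_p M \<Gamma> a" a] that by (simp add: fibre_iff)
  have Tm_natural: "cwfm_Tm k (\<Delta>, FMap (nm_Ty M) \<Gamma> \<Delta> f (nm_p M \<Gamma> a)) (FMap (nm_Tm M) \<Gamma> \<Delta> f a)
      = FMap (nm_Tm N) (FOb (cwfm_fun k) \<Gamma>) (FOb (cwfm_fun k) \<Delta>) (FMap (cwfm_fun k) \<Delta> \<Gamma> f)
          (cwfm_Tm k (\<Gamma>, nm_p M \<Gamma> a) a)"
    if "\<Gamma> \<in> Ob (nm_cat M)" "\<Delta> \<in> Ob (nm_cat M)" "f \<in> Hom (nm_cat M) \<Delta> \<Gamma>" "a \<in> FOb (nm_Tm M) \<Gamma>" for \<Gamma> \<Delta> f a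
  proof -
    let ?A = "nm_p M \<Gamma> a" and ?B = "FMap (nm_Ty M) \<Gamma> \<Delta> f (nm_p M \<Gamma> a)"
    have A: "?A \<in> FOb (nm_Ty M) \<Gamma>" "?B \<in> FOb (nm_Ty M) \<Delta>" "a \<in> fibre M \<Gamma> ?A"
      using that by (simp_all add: fibre_iff)
    have "cwfm_Tm k (\<Delta>, ?B) (FMap (cwf_Tm (cwf_of_nm M c r v)) (\<Gamma>, ?A) (\<Delta>, ?B) f a)
      = FMap (cwf_Tm (cwf_of_nm N c' r' v')) (FOb (cwfm_fun k) \<Gamma>, cwfm_Ty k \<Gamma> ?A)
          (FOb (cwfm_fun k) \<Delta>, cwfm_Ty k \<Delta> ?B) (FMap (cwfm_fun k) \<Delta> \<Gamma> f) (cwfm_Tm k (\<Gamma>, ?A) a)"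
      by (rule cwfm_Tm_natural[OF M' k]) (use that A in simp_all)
    moreover have "FMap (cwf_Tm (cwf_of_nm M c r v)) (\<Gamma>, ?A) (\<Delta>, ?B) f a = FMap (nm_Tm M) \<Gamma> \<Delta> f a"
      by (rule cwf_of_nm_Tm_Map) (use that A in simp_all)
    moreover have "FMap (cwf_Tm (cwf_of_nm N c' r' v')) (FOb (cwfm_fun k) \<Gamma>, cwfm_Ty k \<Gamma> ?A)
          (FOb (cwfm_fun k) \<Delta>, cwfm_Ty k \<Delta> ?B) (FMap (cwfm_fun k) \<Delta> \<Gamma> f) (cwfm_Tm k (\<Gamma>, ?A) a)
        = FMap (nm_Tm N) (FOb (cwfm_fun k) \<Gamma>) (FOb (cwfm_fun k) \<Delta>) (FMap (cwfm_fun k) \<Delta> \<Gamma> f)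
            (cwfm_Tm k (\<Gamma>, ?A) a)"
      by (rule cwf_of_nm_Tm_Map) (use that A Tm_in[of \<Gamma> a] in \<open>simp_all add: Ty_natural\<close>)
    ultimately show ?thesis by simp
  qed
  \<comment> \<open>The type of the generic term \<open>q\<close> is the restriction of
    \<open>A\<close> along \<open>\<pi>\<close>, so \<open>nm_map_of\<close> evaluates it in the
    very fibre that \<open>preserves_extensions\<close> refers to.\<close>
  have preserves: "representing_pullback N (FOb (cwfm_fun k) \<Gamma>) (cwfm_Ty k \<Gamma> A) (FOb (cwfm_fun k) E)
      (FMap (cwfm_fun k) E \<Gamma> \<pi>) (nmm_Tm (nm_map_of M k) E q)"
    if E: "representing_pullback M \<Gamma> A E \<pi> q" for \<Gamma> A E \<pi> q
  proof -
    have "E \<in> Ob (nm_cat M)" "q \<in> FOb (nm_Tm M) E" "nm_p M E q = FMap (nm_Ty M) \<Gamma> E \<pi> A"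
      using E by (simp_all add: representing_pullback_iff[OF M])
    then show ?thesis
      using pk[unfolded preserves_extensions_def context_extension_cwf_of_nm[OF M]
          context_extension_cwf_of_nm[OF N], rule_format, OF E]
      by simp
  qed
  show ?thesis
    unfolding pseudo_maps_iff
  proof (intro conjI ballI allI impI)
    show "is_functor (nm_cat M) (nm_cat N) (nmm_fun (nm_map_of M k))"
      "nmm_Ty (nm_map_of M k)
        \<in> Hom (psh (nm_cat M)) (nm_Ty M) (pull_psh (nm_cat M) (nmm_fun (nm_map_of M k)) (nm_Ty N))"
      using cwf_premaps_functor[OF M' k] cwf_premaps_Ty[OF M' k] by simp_all
    show "nmm_Tm (nm_map_of M k)
        \<in> Hom (psh (nm_cat M)) (nm_Tm M) (pull_psh (nm_cat M) (nmm_fun (nm_map_of M k)) (nm_Tm N))"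
      using Tm_in by (auto simp: psh_Hom_iff Tm_natural fibre_iff nm_map_of_def)
    show "nm_p N (FOb (nmm_fun (nm_map_of M k)) \<Gamma>) (nmm_Tm (nm_map_of M k) \<Gamma> a)
        = nmm_Ty (nm_map_of M k) \<Gamma> (nm_p M \<Gamma> a)" if "\<Gamma> \<in> Ob (nm_cat M)" "a \<in> FOb (nm_Tm M) \<Gamma>" for \<Gamma> a
      using Tm_in[OF that] that by (simp add: fibre_iff)
  qed (simp add: preserves)
qed

lemma nm_map_of_cwf_map_of:
  assumes M: "premodel M" and h: "h \<in> pseudo_maps M N"
  shows "nm_map_of M (cwf_map_of M h) = h"
proof -
  have "(\<lambda>\<Gamma>\<in>Ob (nm_cat M). \<lambda>a\<in>FOb (nm_Tm M) \<Gamma>. cwfm_Tm (cwf_map_of M h) (\<Gamma>, nm_p M \<Gamma> a) a) = nmm_Tm h"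
    by (rule psh_Hom_restrict_eqI[OF pseudo_maps_Tm[OF h]])
      (simp add: fibre_iff psh_Hom_in[OF premodel_p[OF M]])
  then show ?thesis by (simp add: nm_map_of_def)
qed

lemma cwf_map_of_nm_map_of:
  fixes M N :: "('u, 'z) natmod_scheme"
  assumes M: "premodel M" and N: "premodel N"
    and k: "k \<in> cwf_premaps (cwf_of_nm M c r v) (cwf_of_nm N c' r' v')"
    and pk: "preserves_extensions (cwf_of_nm M c r v) (cwf_of_nm N c' r' v') k"
  shows "cwf_map_of M (nm_map_of M k) = k"
  by (rule cwf_map_eqI[OF precwf_cwf_of_nm[OF M] cwf_map_of_premaps[OF M N nm_map_of_pseudo_maps[OF M N k pk]] k])
    (auto simp: fibre_iff)

lemma cwf_map_of_nm_id:
  assumes M: "premodel M"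
  shows "cwf_map_of M (nm_id M) = cwf_id (cwf_of_nm M c r v)"
  by (rule cwf_map_eqI[OF precwf_cwf_of_nm[OF M] cwf_map_of_premaps[OF M M nm_id_pseudo_maps[OF M]]
        cwf_id_premaps[OF precwf_cwf_of_nm[OF M]]])
    (auto simp: fibre_iff)

lemma cwf_map_of_nm_comp:
  assumes M: "premodel M" and N: "premodel N" and L: "premodel L"
    and h: "h \<in> pseudo_maps M N" and k: "k \<in> pseudo_maps N L"
  shows "cwf_map_of M (nm_comp M k h) = cwf_comp (cwf_of_nm M c r v) (cwf_map_of N k) (cwf_map_of M h)"
proof (rule cwf_map_eqI[OF precwf_cwf_of_nm[OF M]])
  show "cwf_map_of M (nm_comp M k h) \<in> cwf_premaps (cwf_of_nm M c r v) (cwf_of_nm L c r v)"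
    by (rule cwf_map_of_premaps[OF M L nm_comp_pseudo_maps[OF h k M]])
  show "cwf_comp (cwf_of_nm M c r v) (cwf_map_of N k) (cwf_map_of M h)
      \<in> cwf_premaps (cwf_of_nm M c r v) (cwf_of_nm L c r v)"
    by (rule cwf_comp_premaps[OF cwf_map_of_premaps[OF M N h] cwf_map_of_premaps[OF N L k]
          precwf_cwf_of_nm[OF M] precwf_cwf_of_nm[OF N]])
qed (auto simp: fibre_iff pseudo_maps_simps[OF h] functor_simps[OF pseudo_maps_functor[OF h]])

text \<open>One condition on terms ranges over all terms, the other over the terms of each fibre.
  They agree because every term lies in the fibre over its type.\<close>

lemma cwf_transformations_cwf_map_of:
  assumes M: "premodel M" and N: "premodel N" and h: "h \<in> pseudo_maps M N" and k: "k \<in> pseudo_maps M N"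
  shows "cwf_transformations (cwf_of_nm M c r v) (cwf_of_nm N c' r' v') (cwf_map_of M h) (cwf_map_of M k)
    = nm_transformations M N h k"
proof -
  note [simp] = functor_simps[OF pseudo_maps_functor[OF h]] functor_simps[OF pseudo_maps_functor[OF k]]
    pseudo_maps_simps[OF h] pseudo_maps_simps[OF k] psh_Hom_in[OF premodel_p[OF M]]
  have "\<alpha> \<in> cwf_transformations (cwf_of_nm M c r v) (cwf_of_nm N c' r' v') (cwf_map_of M h) (cwf_map_of M k)
      \<longleftrightarrow> \<alpha> \<in> nm_transformations M N h k" for \<alpha>
  \<comment> \<open>The condition on types is settled first: it makes
    \<open>\<alpha> \<Gamma>\<close> an arrow of the category of elements, so that restriction along
    it in the fibre presheaf can be computed.\<close>
  proof (cases "\<alpha> \<in> nat_trans (nm_cat M) (nm_cat N) (nmm_fun h) (nmm_fun k) \<and>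
     (\<forall>\<Gamma>\<in>Ob (nm_cat M). \<forall>A\<in>FOb (nm_Ty M) \<Gamma>.
        FMap (nm_Ty N) (FOb (nmm_fun k) \<Gamma>) (FOb (nmm_fun h) \<Gamma>) (\<alpha> \<Gamma>) (nmm_Ty k \<Gamma> A) = nmm_Ty h \<Gamma> A)")
    case True
    then have \<alpha>: "\<alpha> \<in> nat_trans (nm_cat M) (nm_cat N) (nmm_fun h) (nmm_fun k)" by simp
    have "(\<forall>A\<in>FOb (nm_Ty M) \<Gamma>. \<forall>a\<in>FOb (cwf_Tm (cwf_of_nm M c r v)) (\<Gamma>, A).
        FMap (cwf_Tm (cwf_of_nm N c' r' v')) (FOb (nmm_fun k) \<Gamma>, nmm_Ty k \<Gamma> A) (FOb (nmm_fun h) \<Gamma>, nmm_Ty h \<Gamma> A)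
          (\<alpha> \<Gamma>) (cwfm_Tm (cwf_map_of M k) (\<Gamma>, A) a) = cwfm_Tm (cwf_map_of M h) (\<Gamma>, A) a) \<longleftrightarrow>
      (\<forall>A\<in>FOb (nm_Ty M) \<Gamma>. \<forall>a\<in>fibre M \<Gamma> A.
        FMap (nm_Tm N) (FOb (nmm_fun k) \<Gamma>) (FOb (nmm_fun h) \<Gamma>) (\<alpha> \<Gamma>) (nmm_Tm k \<Gamma> a) = nmm_Tm h \<Gamma> a)"
      if "\<Gamma> \<in> Ob (nm_cat M)" for \<Gamma>
    proof (intro ball_cong refl)
      fix A assume A: "A \<in> FOb (nm_Ty M) \<Gamma>"
      then have Tm: "FOb (cwf_Tm (cwf_of_nm M c r v)) (\<Gamma>, A) = fibre M \<Gamma> A"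
        using that by simp
      show "FOb (cwf_Tm (cwf_of_nm M c r v)) (\<Gamma>, A) = fibre M \<Gamma> A" by (rule Tm)
      fix a assume a: "a \<in> fibre M \<Gamma> A"
      then have "nmm_Tm k \<Gamma> a \<in> fibre N (FOb (nmm_fun k) \<Gamma>) (nmm_Ty k \<Gamma> A)"
        using that by (auto simp: fibre_iff)
      then show "FMap (cwf_Tm (cwf_of_nm N c' r' v')) (FOb (nmm_fun k) \<Gamma>, nmm_Ty k \<Gamma> A)
          (FOb (nmm_fun h) \<Gamma>, nmm_Ty h \<Gamma> A) (\<alpha> \<Gamma>) (cwfm_Tm (cwf_map_of M k) (\<Gamma>, A) a)
          = cwfm_Tm (cwf_map_of M h) (\<Gamma>, A) a \<longleftrightarrow>
        FMap (nm_Tm N) (FOb (nmm_fun k) \<Gamma>) (FOb (nmm_fun h) \<Gamma>) (\<alpha> \<Gamma>) (nmm_Tm k \<Gamma> a) = nmm_Tm h \<Gamma> a"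
        using that True A a nat_trans_Hom[OF \<alpha> that] by simp
    qed
    moreover have "(\<forall>A\<in>FOb (nm_Ty M) \<Gamma>. \<forall>a\<in>fibre M \<Gamma> A. Q a) \<longleftrightarrow> (\<forall>a\<in>FOb (nm_Tm M) \<Gamma>. Q a)"
      if "\<Gamma> \<in> Ob (nm_cat M)" for \<Gamma> Q
      using psh_Hom_in[OF premodel_p[OF M] that] unfolding fibre_def by blast
    ultimately show ?thesis
      using True unfolding cwf_transformations_iff nm_transformations_iff by simp
  qed (auto simp: cwf_transformations_iff nm_transformations_iff)
  then show ?thesis by blast
qed

section \<open>Natural models from categories with families\<close>

text \<open>The shape of the isomorphisms between a CwF and the fibres of its total space, which
  change only the names of terms.\<close>

definition relabelling :: "'u cwf \<Rightarrow> ('u \<Rightarrow> 'u \<Rightarrow> 'u \<Rightarrow> 'u) \<Rightarrow> 'u cwf_map" where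
  "relabelling V \<phi> = \<lparr>cwfm_fun = id_fun (cwf_cat V), cwfm_Ty = Ide (psh (cwf_cat V)) (cwf_Ty V),
     cwfm_Tm = (\<lambda>(\<Gamma>, A)\<in>Ob (elements (cwf_cat V) (cwf_Ty V)). \<lambda>a\<in>FOb (cwf_Tm V) (\<Gamma>, A). \<phi> \<Gamma> A a)\<rparr>"

lemma relabelling_simps [simp]:
  "cwfm_fun (relabelling V \<phi>) = id_fun (cwf_cat V)"
  "\<lbrakk>\<Gamma> \<in> Ob (cwf_cat V); A \<in> FOb (cwf_Ty V) \<Gamma>\<rbrakk> \<Longrightarrow> cwfm_Ty (relabelling V \<phi>) \<Gamma> A = A"
  "\<lbrakk>\<Gamma> \<in> Ob (cwf_cat V); A \<in> FOb (cwf_Ty V) \<Gamma>; a \<in> FOb (cwf_Tm V) (\<Gamma>, A)\<rbrakk>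
    \<Longrightarrow> cwfm_Tm (relabelling V \<phi>) (\<Gamma>, A) a = \<phi> \<Gamma> A a"
  by (simp_all add: relabelling_def)

text \<open>An isomorphism of the data apart from the chosen extensions, on which no condition is
  placed. Hence it can serve both the strict and the weak comparison.\<close>

locale cwf_relabelling =
  fixes V W :: "'u cwf" and \<phi> :: "'u \<Rightarrow> 'u \<Rightarrow> 'u \<Rightarrow> 'u"
  assumes V: "precwf V" and W: "precwf W"
    and cat_eq: "cwf_cat W = cwf_cat V" and Ty_eq: "cwf_Ty W = cwf_Ty V"
    and bij: "\<lbrakk>\<Gamma> \<in> Ob (cwf_cat V); A \<in> FOb (cwf_Ty V) \<Gamma>\<rbrakk>
      \<Longrightarrow> bij_betw (\<phi> \<Gamma> A) (FOb (cwf_Tm V) (\<Gamma>, A)) (FOb (cwf_Tm W) (\<Gamma>, A))"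
    and natural: "\<lbrakk>\<Gamma> \<in> Ob (cwf_cat V); \<Delta> \<in> Ob (cwf_cat V); f \<in> Hom (cwf_cat V) \<Delta> \<Gamma>;
        A \<in> FOb (cwf_Ty V) \<Gamma>; B = FMap (cwf_Ty V) \<Gamma> \<Delta> f A; a \<in> FOb (cwf_Tm V) (\<Gamma>, A)\<rbrakk>
      \<Longrightarrow> \<phi> \<Delta> B (FMap (cwf_Tm V) (\<Gamma>, A) (\<Delta>, B) f a) = FMap (cwf_Tm W) (\<Gamma>, A) (\<Delta>, B) f (\<phi> \<Gamma> A a)"
begin

lemma in_W: "\<lbrakk>\<Gamma> \<in> Ob (cwf_cat V); A \<in> FOb (cwf_Ty V) \<Gamma>; a \<in> FOb (cwf_Tm V) (\<Gamma>, A)\<rbrakk>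
    \<Longrightarrow> \<phi> \<Gamma> A a \<in> FOb (cwf_Tm W) (\<Gamma>, A)"
  using bij by (auto simp: bij_betw_def)

lemma relabelling_premaps: "relabelling V \<phi> \<in> cwf_premaps V W"
proof -
  note [simp] = psh_simps[OF precwf_Ty[OF V]] precwf_Tm_simps[OF V] natural in_W
  show ?thesis
    unfolding cwf_premaps_iff[OF V]
    by (auto simp: is_functor_id_fun precwf_category V psh_Hom_iff cat_eq Ty_eq)
      (auto simp: relabelling_def)
qed

text \<open>The universal property in \<open>W\<close> at a term \<open>a\<close> is that in
  \<open>V\<close> at the preimage \<open>b\<close> of \<open>a\<close>: naturality moves
  \<open>\<phi>\<close> past the restriction of \<open>q\<close>, and injectivity removes
  it.\<close>

lemma relabelling_preserves_extensions: "preserves_extensions V W (relabelling V \<phi>)"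
proof -
  have "context_extension W \<Gamma> A E \<pi> (\<phi> E (FMap (cwf_Ty V) \<Gamma> E \<pi> A) q)"
    if E: "context_extension V \<Gamma> A E \<pi> q" for \<Gamma> A E \<pi> q
  proof (rule context_extensionI; unfold cat_eq Ty_eq)
    note [simp] = context_extension_data[OF E] psh_Map[OF precwf_Ty[OF V]]
    show "\<phi> E (FMap (cwf_Ty V) \<Gamma> E \<pi> A) q \<in> FOb (cwf_Tm W) (E, FMap (cwf_Ty V) \<Gamma> E \<pi> A)"
      by (simp add: in_W)
    fix \<Delta> f a
    assume f: "\<Delta> \<in> Ob (cwf_cat V)" "f \<in> Hom (cwf_cat V) \<Delta> \<Gamma>"
      and a: "a \<in> FOb (cwf_Tm W) (\<Delta>, FMap (cwf_Ty V) \<Gamma> \<Delta> f A)"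
    have \<Delta>_bij: "bij_betw (\<phi> \<Delta> (FMap (cwf_Ty V) \<Gamma> \<Delta> f A))
        (FOb (cwf_Tm V) (\<Delta>, FMap (cwf_Ty V) \<Gamma> \<Delta> f A)) (FOb (cwf_Tm W) (\<Delta>, FMap (cwf_Ty V) \<Gamma> \<Delta> f A))"
      using f by (simp add: bij)
    obtain b where b: "b \<in> FOb (cwf_Tm V) (\<Delta>, FMap (cwf_Ty V) \<Gamma> \<Delta> f A)"
        "\<phi> \<Delta> (FMap (cwf_Ty V) \<Gamma> \<Delta> f A) b = a"
      using a bij_betw_imp_surj_on[OF \<Delta>_bij] by (metis imageE)
    have iff: "FMap (cwf_Tm W) (E, FMap (cwf_Ty V) \<Gamma> E \<pi> A) (\<Delta>, FMap (cwf_Ty V) \<Gamma> \<Delta> f A) g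
          (\<phi> E (FMap (cwf_Ty V) \<Gamma> E \<pi> A) q) = a \<longleftrightarrow>
        FMap (cwf_Tm V) (E, FMap (cwf_Ty V) \<Gamma> E \<pi> A) (\<Delta>, FMap (cwf_Ty V) \<Gamma> \<Delta> f A) g q = b"
      if g: "g \<in> Hom (cwf_cat V) \<Delta> E" "Comp (cwf_cat V) \<Delta> E \<Gamma> \<pi> g = f" for g
    proof -
      have B: "FMap (cwf_Ty V) \<Gamma> \<Delta> f A = FMap (cwf_Ty V) E \<Delta> g (FMap (cwf_Ty V) \<Gamma> E \<pi> A)"
        using psh_Comp[OF precwf_Ty[OF V], of \<Gamma> E \<Delta> \<pi> g A] f g by simp
      have X: "FMap (cwf_Tm V) (E, FMap (cwf_Ty V) \<Gamma> E \<pi> A) (\<Delta>, FMap (cwf_Ty V) \<Gamma> \<Delta> f A) g q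
          \<in> FOb (cwf_Tm V) (\<Delta>, FMap (cwf_Ty V) \<Gamma> \<Delta> f A)"
        by (rule precwf_Tm_simps(1)[OF V _ _ _ _ B]) (use f g in simp_all)
      have nat: "\<phi> \<Delta> (FMap (cwf_Ty V) \<Gamma> \<Delta> f A)
          (FMap (cwf_Tm V) (E, FMap (cwf_Ty V) \<Gamma> E \<pi> A) (\<Delta>, FMap (cwf_Ty V) \<Gamma> \<Delta> f A) g q)
        = FMap (cwf_Tm W) (E, FMap (cwf_Ty V) \<Gamma> E \<pi> A) (\<Delta>, FMap (cwf_Ty V) \<Gamma> \<Delta> f A) g
            (\<phi> E (FMap (cwf_Ty V) \<Gamma> E \<pi> A) q)"
        by (rule natural[OF _ _ _ _ B]) (use f g in simp_all)
      show ?thesis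
        using inj_on_eq_iff[OF bij_betw_imp_inj_on[OF \<Delta>_bij] X b(1)] by (simp only: nat b(2))
    qed
    obtain g where g: "g \<in> Hom (cwf_cat V) \<Delta> E" "Comp (cwf_cat V) \<Delta> E \<Gamma> \<pi> g = f"
      "FMap (cwf_Tm V) (E, FMap (cwf_Ty V) \<Gamma> E \<pi> A) (\<Delta>, FMap (cwf_Ty V) \<Gamma> \<Delta> f A) g q = b"
      and g_unique: "\<And>g'. \<lbrakk>g' \<in> Hom (cwf_cat V) \<Delta> E; Comp (cwf_cat V) \<Delta> E \<Gamma> \<pi> g' = f;
        FMap (cwf_Tm V) (E, FMap (cwf_Ty V) \<Gamma> E \<pi> A) (\<Delta>, FMap (cwf_Ty V) \<Gamma> \<Delta> f A) g' q = b\<rbrakk> \<Longrightarrow> g' = g"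
      using context_extension_universal[OF E f b(1)] by blast
    show "\<exists>!g. g \<in> Hom (cwf_cat V) \<Delta> E \<and> Comp (cwf_cat V) \<Delta> E \<Gamma> \<pi> g = f \<and>
        FMap (cwf_Tm W) (E, FMap (cwf_Ty V) \<Gamma> E \<pi> A) (\<Delta>, FMap (cwf_Ty V) \<Gamma> \<Delta> f A) g
          (\<phi> E (FMap (cwf_Ty V) \<Gamma> E \<pi> A) q) = a"
    proof (rule ex1I[of _ g])
      fix g' assume g': "g' \<in> Hom (cwf_cat V) \<Delta> E \<and> Comp (cwf_cat V) \<Delta> E \<Gamma> \<pi> g' = f \<and>
        FMap (cwf_Tm W) (E, FMap (cwf_Ty V) \<Gamma> E \<pi> A) (\<Delta>, FMap (cwf_Ty V) \<Gamma> \<Delta> f A) g'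
          (\<phi> E (FMap (cwf_Ty V) \<Gamma> E \<pi> A) q) = a"
      then show "g' = g" using iff[of g'] by (intro g_unique) simp_all
    qed (simp add: g iff)
  qed (use context_extension_data[OF E] in simp_all)
  note ext = this
  show ?thesis
    unfolding preserves_extensions_def
  proof (intro allI impI)
    fix \<Gamma> A E \<pi> q assume E: "context_extension V \<Gamma> A E \<pi> q"
    note [simp] = context_extension_data[OF E] psh_Map[OF precwf_Ty[OF V]]
    show "context_extension W (FOb (cwfm_fun (relabelling V \<phi>)) \<Gamma>) (cwfm_Ty (relabelling V \<phi>) \<Gamma> A)
        (FOb (cwfm_fun (relabelling V \<phi>)) E) (FMap (cwfm_fun (relabelling V \<phi>)) E \<Gamma> \<pi>)
        (cwfm_Tm (relabelling V \<phi>) (E, FMap (cwf_Ty V) \<Gamma> E \<pi> A) q)"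
      by (simp add: ext[OF E])
  qed
qed

text \<open>The composite in the other order is the same statement with the roles of
  \<open>V\<close> and \<open>W\<close> exchanged.\<close>

lemma relabelling_inverse:
  assumes \<psi>: "cwf_relabelling W V \<psi>"
    and \<psi>\<phi>: "\<And>\<Gamma> A a. \<lbrakk>\<Gamma> \<in> Ob (cwf_cat V); A \<in> FOb (cwf_Ty V) \<Gamma>; a \<in> FOb (cwf_Tm V) (\<Gamma>, A)\<rbrakk>
      \<Longrightarrow> \<psi> \<Gamma> A (\<phi> \<Gamma> A a) = a"
  shows "cwf_comp V (relabelling W \<psi>) (relabelling V \<phi>) = cwf_id V"
proof (rule cwf_map_eqI[OF V])
  interpret \<psi>: cwf_relabelling W V \<psi> by (rule \<psi>)
  show "cwf_comp V (relabelling W \<psi>) (relabelling V \<phi>) \<in> cwf_premaps V V"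
    by (rule cwf_comp_premaps[OF relabelling_premaps \<psi>.relabelling_premaps V W])
  show "cwf_id V \<in> cwf_premaps V V" by (rule cwf_id_premaps[OF V])
qed (simp_all add: cat_eq Ty_eq comp_fun_id_fun[OF is_functor_id_fun] precwf_category V in_W \<psi>\<phi>)

end

text \<open>The terms over \<open>\<Gamma>\<close> are the pairs \<open>(A, a)\<close> with \<open>a \<in> Tm(\<Gamma>, A)\<close>, encoded by an injection
  \<open>enc\<close> as elements of the universe. The last argument holds additional record fields.\<close>

definition total_terms :: "('u \<times> 'u \<Rightarrow> 'u) \<Rightarrow> 'u cwf \<Rightarrow> 'u \<Rightarrow> 'u set" where
  "total_terms enc W \<Gamma> = enc ` (SIGMA A:FOb (cwf_Ty W) \<Gamma>. FOb (cwf_Tm W) (\<Gamma>, A))"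

definition nm_of_cwf :: "('u \<times> 'u \<Rightarrow> 'u) \<Rightarrow> 'u cwf \<Rightarrow> 'z \<Rightarrow> ('u, 'z) natmod_scheme" where
  "nm_of_cwf enc W z = \<lparr>nm_cat = cwf_cat W, nm_Ty = cwf_Ty W,
     nm_Tm = mk_functor (op_cat (cwf_cat W)) (total_terms enc W)
       (\<lambda>\<Gamma> \<Delta> f. \<lambda>x\<in>total_terms enc W \<Gamma>. case inv enc x of (A, a) \<Rightarrow>
          enc (FMap (cwf_Ty W) \<Gamma> \<Delta> f A,
            FMap (cwf_Tm W) (\<Gamma>, A) (\<Delta>, FMap (cwf_Ty W) \<Gamma> \<Delta> f A) f a)),
     nm_p = (\<lambda>\<Gamma>\<in>Ob (cwf_cat W). \<lambda>x\<in>total_terms enc W \<Gamma>. fst (inv enc x)), \<dots> = z\<rparr>"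

section \<open>The natural model of total spaces and its fibres\<close>

lemma nm_of_cwf_simps [simp]:
  "nm_cat (nm_of_cwf enc W z) = cwf_cat W" "nm_Ty (nm_of_cwf enc W z) = cwf_Ty W"
  "natmod.more (nm_of_cwf enc W z) = z"
  by (simp_all add: nm_of_cwf_def)

context
  fixes enc :: "'u \<times> 'u \<Rightarrow> 'u" and W :: "'u cwf" and z :: 'z
  assumes enc: "inj enc" and W: "precwf W"
begin

lemma total_terms_enc [simp]: "enc (A, a) \<in> total_terms enc W \<Gamma>
    \<longleftrightarrow> A \<in> FOb (cwf_Ty W) \<Gamma> \<and> a \<in> FOb (cwf_Tm W) (\<Gamma>, A)"
  unfolding total_terms_def inj_image_mem_iff[OF enc] by simp

lemma total_termsE:
  assumes "x \<in> total_terms enc W \<Gamma>"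
  obtains A a where "x = enc (A, a)" "A \<in> FOb (cwf_Ty W) \<Gamma>" "a \<in> FOb (cwf_Tm W) (\<Gamma>, A)"
  using assms by (auto simp: total_terms_def)

lemma nm_of_cwf_Tm_Ob [simp]:
  "\<Gamma> \<in> Ob (cwf_cat W) \<Longrightarrow> FOb (nm_Tm (nm_of_cwf enc W z)) \<Gamma> = total_terms enc W \<Gamma>"
  by (simp add: nm_of_cwf_def)

lemma nm_of_cwf_Tm_Map [simp]:
  "\<lbrakk>\<Gamma> \<in> Ob (cwf_cat W); \<Delta> \<in> Ob (cwf_cat W); f \<in> Hom (cwf_cat W) \<Delta> \<Gamma>;
    A \<in> FOb (cwf_Ty W) \<Gamma>; a \<in> FOb (cwf_Tm W) (\<Gamma>, A)\<rbrakk>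
    \<Longrightarrow> FMap (nm_Tm (nm_of_cwf enc W z)) \<Gamma> \<Delta> f (enc (A, a))
      = enc (FMap (cwf_Ty W) \<Gamma> \<Delta> f A, FMap (cwf_Tm W) (\<Gamma>, A) (\<Delta>, FMap (cwf_Ty W) \<Gamma> \<Delta> f A) f a)"
  by (simp add: nm_of_cwf_def inv_f_f[OF enc])

lemma nm_of_cwf_p [simp]:
  "\<lbrakk>\<Gamma> \<in> Ob (cwf_cat W); A \<in> FOb (cwf_Ty W) \<Gamma>; a \<in> FOb (cwf_Tm W) (\<Gamma>, A)\<rbrakk>
    \<Longrightarrow> nm_p (nm_of_cwf enc W z) \<Gamma> (enc (A, a)) = A"
  by (simp add: nm_of_cwf_def inv_f_f[OF enc])

lemma premodel_nm_of_cwf: "premodel (nm_of_cwf enc W z)"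
proof -
  note [simp] = psh_simps[OF precwf_Ty[OF W]] precwf_Tm_simps[OF W]
    category_simps[OF precwf_category[OF W]]
  have "nm_Tm (nm_of_cwf enc W z) \<in> Ob (psh (cwf_cat W))"
    unfolding nm_of_cwf_def natmod.simps
    by (rule mk_functor_pshI)
      (auto simp: precwf_category W inv_f_f[OF enc] inj_eq[OF enc] elim!: total_termsE)
  moreover have "nm_p (nm_of_cwf enc W z) \<in> Hom (psh (cwf_cat W)) (nm_Tm (nm_of_cwf enc W z)) (cwf_Ty W)"
    unfolding psh_Hom_iff
    by (auto elim!: total_termsE) (auto simp: nm_of_cwf_def)
  ultimately show ?thesis
    using W by (simp add: premodel_def precwf_def)
qed

lemma fibre_nm_of_cwf:
  assumes "\<Gamma> \<in> Ob (cwf_cat W)" "A \<in> FOb (cwf_Ty W) \<Gamma>"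
  shows "fibre (nm_of_cwf enc W z) \<Gamma> A = (\<lambda>a. enc (A, a)) ` FOb (cwf_Tm W) (\<Gamma>, A)"
  using assms by (auto simp: fibre_def total_terms_def)

text \<open>The fibre over \<open>A\<close> in the total space consists of the codes of pairs with
  first component \<open>A\<close>, so tagging with \<open>A\<close> is a bijection onto it. The
  data \<open>c\<close>, \<open>r\<close>, \<open>v\<close> are arbitrary: in one use they come from
  \<open>W\<close>, in the other from a choice.\<close>

lemma relabelling_enc:
  "cwf_relabelling W (cwf_of_nm (nm_of_cwf enc W z) c r v) (\<lambda>\<Gamma> A a. enc (A, a))"
proof unfold_locales
  show "precwf (cwf_of_nm (nm_of_cwf enc W z) c r v)"
    by (rule precwf_cwf_of_nm[OF premodel_nm_of_cwf])
  show "bij_betw (\<lambda>a. enc (A, a)) (FOb (cwf_Tm W) (\<Gamma>, A))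
      (FOb (cwf_Tm (cwf_of_nm (nm_of_cwf enc W z) c r v)) (\<Gamma>, A))"
    if "\<Gamma> \<in> Ob (cwf_cat W)" "A \<in> FOb (cwf_Ty W) \<Gamma>" for \<Gamma> A
    using that by (auto simp: fibre_nm_of_cwf inj_eq[OF enc] intro!: bij_betw_imageI inj_onI)
  show "enc (B, FMap (cwf_Tm W) (\<Gamma>, A) (\<Delta>, B) f a)
      = FMap (cwf_Tm (cwf_of_nm (nm_of_cwf enc W z) c r v)) (\<Gamma>, A) (\<Delta>, B) f (enc (A, a))"
    if "\<Gamma> \<in> Ob (cwf_cat W)" "\<Delta> \<in> Ob (cwf_cat W)" "f \<in> Hom (cwf_cat W) \<Delta> \<Gamma>" "A \<in> FOb (cwf_Ty W) \<Gamma>"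
      "B = FMap (cwf_Ty W) \<Gamma> \<Delta> f A" "a \<in> FOb (cwf_Tm W) (\<Gamma>, A)" for \<Gamma> \<Delta> f A B a
    using that by (simp add: fibre_iff psh_Map[OF precwf_Ty[OF W]])
qed (simp_all add: W)

lemma relabelling_dec:
  "cwf_relabelling (cwf_of_nm (nm_of_cwf enc W z) c r v) W (\<lambda>\<Gamma> A x. snd (inv enc x))"
proof unfold_locales
  show "precwf (cwf_of_nm (nm_of_cwf enc W z) c r v)"
    by (rule precwf_cwf_of_nm[OF premodel_nm_of_cwf])
  show "bij_betw (\<lambda>x. snd (inv enc x))
      (FOb (cwf_Tm (cwf_of_nm (nm_of_cwf enc W z) c r v)) (\<Gamma>, A)) (FOb (cwf_Tm W) (\<Gamma>, A))"
    if "\<Gamma> \<in> Ob (cwf_cat (cwf_of_nm (nm_of_cwf enc W z) c r v))"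
      "A \<in> FOb (cwf_Ty (cwf_of_nm (nm_of_cwf enc W z) c r v)) \<Gamma>" for \<Gamma> A
    using that by (intro bij_betw_byWitness[where f' = "\<lambda>a. enc (A, a)"])
      (auto simp: fibre_nm_of_cwf inv_f_f[OF enc])
  show "snd (inv enc (FMap (cwf_Tm (cwf_of_nm (nm_of_cwf enc W z) c r v)) (\<Gamma>, A) (\<Delta>, B) f x))
      = FMap (cwf_Tm W) (\<Gamma>, A) (\<Delta>, B) f (snd (inv enc x))"
    if *: "\<Gamma> \<in> Ob (cwf_cat (cwf_of_nm (nm_of_cwf enc W z) c r v))"
      "\<Delta> \<in> Ob (cwf_cat (cwf_of_nm (nm_of_cwf enc W z) c r v))"
      "f \<in> Hom (cwf_cat (cwf_of_nm (nm_of_cwf enc W z) c r v)) \<Delta> \<Gamma>"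
      "A \<in> FOb (cwf_Ty (cwf_of_nm (nm_of_cwf enc W z) c r v)) \<Gamma>"
      "B = FMap (cwf_Ty (cwf_of_nm (nm_of_cwf enc W z) c r v)) \<Gamma> \<Delta> f A"
      "x \<in> FOb (cwf_Tm (cwf_of_nm (nm_of_cwf enc W z) c r v)) (\<Gamma>, A)" for \<Gamma> \<Delta> f A B x
  proof -
    obtain a where "x = enc (A, a)" "a \<in> FOb (cwf_Tm W) (\<Gamma>, A)"
      using * by (auto simp: fibre_nm_of_cwf)
    then show ?thesis
      using * by (simp add: fibre_iff psh_Map[OF precwf_Ty[OF W]] inv_f_f[OF enc])
  qed
qed (simp_all add: W)

lemma relabelling_enc_dec:
  "cwf_comp W (relabelling (cwf_of_nm (nm_of_cwf enc W z) c r v) (\<lambda>\<Gamma> A x. snd (inv enc x)))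
     (relabelling W (\<lambda>\<Gamma> A a. enc (A, a))) = cwf_id W"
  by (rule cwf_relabelling.relabelling_inverse[OF relabelling_enc relabelling_dec])
    (simp add: inv_f_f[OF enc])

lemma relabelling_dec_enc:
  "cwf_comp (cwf_of_nm (nm_of_cwf enc W z) c r v) (relabelling W (\<lambda>\<Gamma> A a. enc (A, a)))
     (relabelling (cwf_of_nm (nm_of_cwf enc W z) c r v) (\<lambda>\<Gamma> A x. snd (inv enc x)))
     = cwf_id (cwf_of_nm (nm_of_cwf enc W z) c r v)"
  by (rule cwf_relabelling.relabelling_inverse[OF relabelling_dec relabelling_enc])
    (auto simp: fibre_nm_of_cwf inv_f_f[OF enc])

text \<open>Tagging preserves extensions, and extensions for the fibres are representing pullbacks.
  The generic term is tagged with its own type, the restriction of \<open>A\<close> along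
  \<open>\<pi>\<close>.\<close>

lemma representing_pullback_nm_of_cwf:
  assumes E: "context_extension W \<Gamma> A E \<pi> q"
  shows "representing_pullback (nm_of_cwf enc W z) \<Gamma> A E \<pi> (enc (FMap (cwf_Ty W) \<Gamma> E \<pi> A, q))"
proof -
  note * = cwf_relabelling.relabelling_preserves_extensions[OF relabelling_enc,
      unfolded preserves_extensions_def context_extension_cwf_of_nm[OF premodel_nm_of_cwf],
      rule_format, OF E]
  show ?thesis
    using * context_extension_data[OF E] by (simp add: psh_Map[OF precwf_Ty[OF W]])
qed

end

section \<open>The equivalences\<close>

lemma strict_cwf_maps_iff:
  "h \<in> strict_cwf_maps W V \<longleftrightarrow> h \<in> cwf_premaps W V \<and>
    (\<forall>\<Gamma>\<in>Ob (cwf_cat W). \<forall>A\<in>FOb (cwf_Ty W) \<Gamma>.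
       FOb (cwfm_fun h) (cwf_ctx W \<Gamma> A) = cwf_ctx V (FOb (cwfm_fun h) \<Gamma>) (cwfm_Ty h \<Gamma> A) \<and>
       FMap (cwfm_fun h) (cwf_ctx W \<Gamma> A) \<Gamma> (cwf_pr W \<Gamma> A)
         = cwf_pr V (FOb (cwfm_fun h) \<Gamma>) (cwfm_Ty h \<Gamma> A) \<and>
       cwfm_Tm h (cwf_ctx W \<Gamma> A, FMap (cwf_Ty W) \<Gamma> (cwf_ctx W \<Gamma> A) (cwf_pr W \<Gamma> A) A) (cwf_var W \<Gamma> A)
         = cwf_var V (FOb (cwfm_fun h) \<Gamma>) (cwfm_Ty h \<Gamma> A))"
  by (simp add: strict_cwf_maps_def Let_def)

lemma strict_nm_maps_iff:
  "h \<in> strict_nm_maps M N \<longleftrightarrow> h \<in> pseudo_maps M N \<and>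
    (\<forall>\<Gamma>\<in>Ob (nm_cat M). \<forall>A\<in>FOb (nm_Ty M) \<Gamma>.
       FOb (nmm_fun h) (nm_ctx M \<Gamma> A) = nm_ctx N (FOb (nmm_fun h) \<Gamma>) (nmm_Ty h \<Gamma> A) \<and>
       FMap (nmm_fun h) (nm_ctx M \<Gamma> A) \<Gamma> (nm_pr M \<Gamma> A) = nm_pr N (FOb (nmm_fun h) \<Gamma>) (nmm_Ty h \<Gamma> A) \<and>
       nmm_Tm h (nm_ctx M \<Gamma> A) (nm_var M \<Gamma> A) = nm_var N (FOb (nmm_fun h) \<Gamma>) (nmm_Ty h \<Gamma> A))"
  by (simp add: strict_nm_maps_def Let_def)

lemma is_cwf_chosen:
  assumes "is_cwf W" "\<Gamma> \<in> Ob (cwf_cat W)" "A \<in> FOb (cwf_Ty W) \<Gamma>"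
  shows "context_extension W \<Gamma> A (cwf_ctx W \<Gamma> A) (cwf_pr W \<Gamma> A) (cwf_var W \<Gamma> A)"
  using assms by (simp add: is_cwf_iff)

lemma structured_natural_model_chosen:
  assumes "structured_natural_model M" "\<Gamma> \<in> Ob (nm_cat M)" "A \<in> FOb (nm_Ty M) \<Gamma>"
  shows "representing_pullback M \<Gamma> A (nm_ctx M \<Gamma> A) (nm_pr M \<Gamma> A) (nm_var M \<Gamma> A)"
  using assms by (simp add: structured_natural_model_def)

text \<open>The image of a chosen extension is again a chosen one, and being a CwF gives
  \<open>V\<close> the universal property of those.\<close>

lemma strict_cwf_maps_weak:
  assumes W: "is_cwf W" and V: "is_cwf V" and h: "h \<in> strict_cwf_maps W V"
  shows "h \<in> weak_cwf_maps W V"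
proof -
  have h': "h \<in> cwf_premaps W V" using h by (simp add: strict_cwf_maps_iff)
  show ?thesis
    using h is_cwf_chosen[OF V functor_Ob[OF cwf_premaps_functor[OF is_cwf_precwf[OF W] h']]
        cwfm_Ty_in[OF is_cwf_precwf[OF W] h']]
    by (simp add: weak_cwf_maps_def strict_cwf_maps_iff Let_def)
qed

section \<open>The categories of strict maps\<close>

lemma CwF_str1_simps [simp]:
  "Ob CwF_str1 = {W. is_cwf W}" "Hom CwF_str1 = strict_cwf_maps" "Ide CwF_str1 = cwf_id"
  "Comp CwF_str1 W V U k h = cwf_comp W k h"
  by (simp_all add: CwF_str1_def)

lemma NatMod_str1_simps [simp]:
  "Ob NatMod_str1 = {M. structured_natural_model M}" "Hom NatMod_str1 = strict_nm_maps"
  "Ide NatMod_str1 = nm_id" "Comp NatMod_str1 M N L k h = nm_comp M k h"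
  by (simp_all add: NatMod_str1_def)

lemma category_CwF_str1: "category CwF_str1"
proof (rule categoryI; unfold CwF_str1_simps mem_Collect_eq)
  fix W V U T :: "'u cwf"
  show "cwf_id W \<in> strict_cwf_maps W W" if W: "is_cwf W"
    unfolding strict_cwf_maps_iff
  proof (intro conjI ballI cwf_id_premaps[OF is_cwf_precwf[OF W]])
    fix \<Gamma> A assume \<Gamma>: "\<Gamma> \<in> Ob (cwf_cat W)" "A \<in> FOb (cwf_Ty W) \<Gamma>"
    note [simp] = \<Gamma> context_extension_data[OF is_cwf_chosen[OF W \<Gamma>]] psh_Map[OF precwf_Ty[OF is_cwf_precwf[OF W]]]
    show "FOb (cwfm_fun (cwf_id W)) (cwf_ctx W \<Gamma> A)
        = cwf_ctx W (FOb (cwfm_fun (cwf_id W)) \<Gamma>) (cwfm_Ty (cwf_id W) \<Gamma> A)"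
      "FMap (cwfm_fun (cwf_id W)) (cwf_ctx W \<Gamma> A) \<Gamma> (cwf_pr W \<Gamma> A)
        = cwf_pr W (FOb (cwfm_fun (cwf_id W)) \<Gamma>) (cwfm_Ty (cwf_id W) \<Gamma> A)"
      "cwfm_Tm (cwf_id W) (cwf_ctx W \<Gamma> A, FMap (cwf_Ty W) \<Gamma> (cwf_ctx W \<Gamma> A) (cwf_pr W \<Gamma> A) A) (cwf_var W \<Gamma> A)
        = cwf_var W (FOb (cwfm_fun (cwf_id W)) \<Gamma>) (cwfm_Ty (cwf_id W) \<Gamma> A)"
      by simp_all
  qed
  fix h k l
  assume W: "is_cwf W" and V: "is_cwf V" and h_strict: "h \<in> strict_cwf_maps W V"
  then have h: "h \<in> cwf_premaps W V" by (simp add: strict_cwf_maps_iff)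
  note W' = is_cwf_precwf[OF W] and V' = is_cwf_precwf[OF V]
  show "cwf_comp W h (cwf_id W) = h" "cwf_comp W (cwf_id V) h = h"
    by (rule cwf_comp_cwf_id[OF h W' V'])+
  assume U: "is_cwf U" and k_strict: "k \<in> strict_cwf_maps V U"
  then have k: "k \<in> cwf_premaps V U" by (simp add: strict_cwf_maps_iff)
  show "cwf_comp W k h \<in> strict_cwf_maps W U"
    unfolding strict_cwf_maps_iff
  proof (intro conjI ballI cwf_comp_premaps[OF h k W' V'])
    fix \<Gamma> A assume \<Gamma>: "\<Gamma> \<in> Ob (cwf_cat W)" "A \<in> FOb (cwf_Ty W) \<Gamma>"
    note F = cwf_premaps_functor[OF W' h]
    have h\<Gamma>: "FOb (cwfm_fun h) \<Gamma> \<in> Ob (cwf_cat V)"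
      "cwfm_Ty h \<Gamma> A \<in> FOb (cwf_Ty V) (FOb (cwfm_fun h) \<Gamma>)"
      using \<Gamma> functor_Ob[OF F] cwfm_Ty_in[OF W' h] by auto
    note [simp] = \<Gamma> h\<Gamma> context_extension_data[OF is_cwf_chosen[OF W \<Gamma>]]
      context_extension_data[OF is_cwf_chosen[OF V h\<Gamma>]] psh_Map[OF precwf_Ty[OF W']]
      cwfm_Ty_natural[OF W' h]
    have [simp]:
      "FOb (cwfm_fun h) (cwf_ctx W \<Gamma> A) = cwf_ctx V (FOb (cwfm_fun h) \<Gamma>) (cwfm_Ty h \<Gamma> A)"
      "FMap (cwfm_fun h) (cwf_ctx W \<Gamma> A) \<Gamma> (cwf_pr W \<Gamma> A) = cwf_pr V (FOb (cwfm_fun h) \<Gamma>) (cwfm_Ty h \<Gamma> A)"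
      "cwfm_Tm h (cwf_ctx W \<Gamma> A, FMap (cwf_Ty W) \<Gamma> (cwf_ctx W \<Gamma> A) (cwf_pr W \<Gamma> A) A) (cwf_var W \<Gamma> A)
         = cwf_var V (FOb (cwfm_fun h) \<Gamma>) (cwfm_Ty h \<Gamma> A)"
      using h_strict \<Gamma> by (simp_all add: strict_cwf_maps_iff)
    show "FOb (cwfm_fun (cwf_comp W k h)) (cwf_ctx W \<Gamma> A)
        = cwf_ctx U (FOb (cwfm_fun (cwf_comp W k h)) \<Gamma>) (cwfm_Ty (cwf_comp W k h) \<Gamma> A)"
      "FMap (cwfm_fun (cwf_comp W k h)) (cwf_ctx W \<Gamma> A) \<Gamma> (cwf_pr W \<Gamma> A)
        = cwf_pr U (FOb (cwfm_fun (cwf_comp W k h)) \<Gamma>) (cwfm_Ty (cwf_comp W k h) \<Gamma> A)"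
      "cwfm_Tm (cwf_comp W k h) (cwf_ctx W \<Gamma> A, FMap (cwf_Ty W) \<Gamma> (cwf_ctx W \<Gamma> A) (cwf_pr W \<Gamma> A) A) (cwf_var W \<Gamma> A)
        = cwf_var U (FOb (cwfm_fun (cwf_comp W k h)) \<Gamma>) (cwfm_Ty (cwf_comp W k h) \<Gamma> A)"
      using k_strict by (simp_all add: strict_cwf_maps_iff)
  qed
  show "cwf_comp W (cwf_comp V l k) h = cwf_comp W l (cwf_comp W k h)"
    if "is_cwf T" "l \<in> strict_cwf_maps U T"
  proof -
    have l: "l \<in> cwf_premaps U T" using that by (simp add: strict_cwf_maps_iff)
    show ?thesis by (rule cwf_comp_assoc[OF h k l W' V' is_cwf_precwf[OF U]])
  qed
qed

lemma structured_natural_model_premodel: "structured_natural_model M \<Longrightarrow> premodel M"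
  by (simp add: structured_natural_model_def natural_model_premodel)

lemma representing_pullback_data:
  assumes "premodel M" "representing_pullback M \<Gamma> A E \<pi> q"
  shows "\<Gamma> \<in> Ob (nm_cat M)" "A \<in> FOb (nm_Ty M) \<Gamma>" "E \<in> Ob (nm_cat M)" "\<pi> \<in> Hom (nm_cat M) E \<Gamma>"
    "q \<in> FOb (nm_Tm M) E" "nm_p M E q = FMap (nm_Ty M) \<Gamma> E \<pi> A"
  using assms(2) unfolding representing_pullback_iff[OF assms(1)] by blast+

lemma category_NatMod_str1: "category NatMod_str1"
proof (rule categoryI; unfold NatMod_str1_simps mem_Collect_eq)
  fix M N L K :: "'u snatmod"
  show "nm_id M \<in> strict_nm_maps M M" if M: "structured_natural_model M"
    using nm_id_pseudo_maps[OF structured_natural_model_premodel[OF M]]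
      representing_pullback_data[OF structured_natural_model_premodel[OF M] structured_natural_model_chosen[OF M]]
    by (simp add: strict_nm_maps_iff)
  fix h k l
  assume M: "structured_natural_model M" and N: "structured_natural_model N"
    and h_strict: "h \<in> strict_nm_maps M N"
  then have h: "h \<in> pseudo_maps M N" by (simp add: strict_nm_maps_iff)
  note M' = structured_natural_model_premodel[OF M] and N' = structured_natural_model_premodel[OF N]
  show "nm_comp M h (nm_id M) = h" "nm_comp M (nm_id N) h = h"
    by (rule nm_comp_nm_id[OF h M' N'])+
  assume L: "structured_natural_model L" and k_strict: "k \<in> strict_nm_maps N L"
  then have k: "k \<in> pseudo_maps N L" by (simp add: strict_nm_maps_iff)
  show "nm_comp M k h \<in> strict_nm_maps M L"
    unfolding strict_nm_maps_iff
  proof (intro conjI ballI nm_comp_pseudo_maps[OF h k M'])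
    fix \<Gamma> A assume \<Gamma>: "\<Gamma> \<in> Ob (nm_cat M)" "A \<in> FOb (nm_Ty M) \<Gamma>"
    note [simp] = \<Gamma> representing_pullback_data[OF M' structured_natural_model_chosen[OF M \<Gamma>]]
      functor_Ob[OF pseudo_maps_functor[OF h]] nmm_Ty_in[OF h]
    have [simp]:
      "FOb (nmm_fun h) (nm_ctx M \<Gamma> A) = nm_ctx N (FOb (nmm_fun h) \<Gamma>) (nmm_Ty h \<Gamma> A)"
      "FMap (nmm_fun h) (nm_ctx M \<Gamma> A) \<Gamma> (nm_pr M \<Gamma> A) = nm_pr N (FOb (nmm_fun h) \<Gamma>) (nmm_Ty h \<Gamma> A)"
      "nmm_Tm h (nm_ctx M \<Gamma> A) (nm_var M \<Gamma> A) = nm_var N (FOb (nmm_fun h) \<Gamma>) (nmm_Ty h \<Gamma> A)"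
      using h_strict \<Gamma> by (simp_all add: strict_nm_maps_iff)
    show "FOb (nmm_fun (nm_comp M k h)) (nm_ctx M \<Gamma> A)
        = nm_ctx L (FOb (nmm_fun (nm_comp M k h)) \<Gamma>) (nmm_Ty (nm_comp M k h) \<Gamma> A)"
      "FMap (nmm_fun (nm_comp M k h)) (nm_ctx M \<Gamma> A) \<Gamma> (nm_pr M \<Gamma> A)
        = nm_pr L (FOb (nmm_fun (nm_comp M k h)) \<Gamma>) (nmm_Ty (nm_comp M k h) \<Gamma> A)"
      "nmm_Tm (nm_comp M k h) (nm_ctx M \<Gamma> A) (nm_var M \<Gamma> A)
        = nm_var L (FOb (nmm_fun (nm_comp M k h)) \<Gamma>) (nmm_Ty (nm_comp M k h) \<Gamma> A)"
      using k_strict by (simp_all add: strict_nm_maps_iff)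
  qed
  show "nm_comp M (nm_comp N l k) h = nm_comp M l (nm_comp M k h)"
    if "structured_natural_model K" "l \<in> strict_nm_maps L K"
  proof -
    have l: "l \<in> pseudo_maps L K" using that by (simp add: strict_nm_maps_iff)
    show ?thesis by (rule nm_comp_assoc[OF h k l M' N'])
  qed
qed

section \<open>The comparison on strict maps\<close>

abbreviation cwf_of_snm :: "'u snatmod \<Rightarrow> 'u cwf" where
  "cwf_of_snm M \<equiv> cwf_of_nm M (nm_ctx M) (nm_pr M) (nm_var M)"

lemma is_cwf_cwf_of_snm: "structured_natural_model M \<Longrightarrow> is_cwf (cwf_of_snm M)"
  by (simp add: is_cwf_cwf_of_nm structured_natural_model_premodel structured_natural_model_chosen)

text \<open>The two strictness conditions coincide once the generic term is seen to lie in the fibre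
  over the restricted type, where \<open>cwf_map_of M h\<close> acts as
  \<open>nmm_Tm h\<close>.\<close>

lemma cwf_map_of_strict_iff:
  assumes M: "structured_natural_model M" and N: "structured_natural_model N" and h: "h \<in> pseudo_maps M N"
  shows "cwf_map_of M h \<in> strict_cwf_maps (cwf_of_snm M) (cwf_of_snm N) \<longleftrightarrow> h \<in> strict_nm_maps M N"
proof -
  note M' = structured_natural_model_premodel[OF M] and N' = structured_natural_model_premodel[OF N]
  have "cwfm_Tm (cwf_map_of M h) (nm_ctx M \<Gamma> A, FMap (nm_Ty M) \<Gamma> (nm_ctx M \<Gamma> A) (nm_pr M \<Gamma> A) A) (nm_var M \<Gamma> A)
      = nmm_Tm h (nm_ctx M \<Gamma> A) (nm_var M \<Gamma> A)" if "\<Gamma> \<in> Ob (nm_cat M)" "A \<in> FOb (nm_Ty M) \<Gamma>" for \<Gamma> A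
    using representing_pullback_data[OF M' structured_natural_model_chosen[OF M that]]
    by (simp add: fibre_iff psh_Map[OF premodel_Ty[OF M']])
  then show ?thesis
    using h cwf_map_of_premaps[OF M' N' h] by (simp add: strict_cwf_maps_iff strict_nm_maps_iff)
qed

text \<open>\<open>nm_map_of M\<close> is the inverse. Any extension data will do, since a weak map
  between CwFs preserves all extensions, whichever were chosen.\<close>

lemma bij_betw_cwf_map_of:
  assumes M: "premodel M" and N: "premodel N"
    and ctx: "is_cwf (cwf_of_nm M c r v)" "is_cwf (cwf_of_nm N c' r' v')"
  shows "bij_betw (cwf_map_of M) (pseudo_maps M N) (weak_cwf_maps (cwf_of_nm M c r v) (cwf_of_nm N c' r' v'))"
  by (rule bij_betw_byWitness[where f' = "nm_map_of M"])
    (auto simp: weak_cwf_maps_iff[OF ctx] nm_map_of_cwf_map_of[OF M] cwf_map_of_nm_map_of[OF M N]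
      cwf_map_of_premaps[OF M N] cwf_map_of_preserves_extensions[OF M N] nm_map_of_pseudo_maps[OF M N])

text \<open>Restricts the bijection onto weak maps: a strict map is weak, hence comes from a pseudo
  map, which is strict because \<open>cwf_map_of\<close> reflects strictness.\<close>

lemma bij_betw_cwf_map_of_strict:
  assumes M: "structured_natural_model M" and N: "structured_natural_model N"
  shows "bij_betw (cwf_map_of M) (strict_nm_maps M N) (strict_cwf_maps (cwf_of_snm M) (cwf_of_snm N))"
proof -
  note bij = bij_betw_cwf_map_of[OF structured_natural_model_premodel[OF M]
      structured_natural_model_premodel[OF N] is_cwf_cwf_of_snm[OF M] is_cwf_cwf_of_snm[OF N]]
  have sub: "strict_nm_maps M N \<subseteq> pseudo_maps M N" by (auto simp: strict_nm_maps_iff)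
  have "cwf_map_of M ` strict_nm_maps M N = strict_cwf_maps (cwf_of_snm M) (cwf_of_snm N)"
  proof (intro equalityI subsetI)
    fix k assume k: "k \<in> strict_cwf_maps (cwf_of_snm M) (cwf_of_snm N)"
    then have "k \<in> cwf_map_of M ` pseudo_maps M N"
      using strict_cwf_maps_weak[OF is_cwf_cwf_of_snm[OF M] is_cwf_cwf_of_snm[OF N]]
        bij_betw_imp_surj_on[OF bij] by simp
    then obtain h where "h \<in> pseudo_maps M N" "k = cwf_map_of M h" by (rule imageE)
    then show "k \<in> cwf_map_of M ` strict_nm_maps M N"
      using k cwf_map_of_strict_iff[OF M N] by blast
  next
    fix k assume "k \<in> cwf_map_of M ` strict_nm_maps M N"
    then obtain h where "h \<in> strict_nm_maps M N" "k = cwf_map_of M h" by (rule imageE)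
    then show "k \<in> strict_cwf_maps (cwf_of_snm M) (cwf_of_snm N)"
      using cwf_map_of_strict_iff[OF M N] sub by blast
  qed
  then show ?thesis
    using inj_on_subset[OF bij_betw_imp_inj_on[OF bij] sub] by (simp add: bij_betw_def)
qed

text \<open>Taking over the contexts and projections of \<open>W\<close>, and tagging its generic
  terms like all terms of the total space, makes the comparison with \<open>W\<close> strict. The
  record fragment is the last argument of \<open>nm_of_cwf\<close>.\<close>

definition snm_of_cwf :: "('u \<times> 'u \<Rightarrow> 'u) \<Rightarrow> 'u cwf \<Rightarrow> 'u snatmod" where
  "snm_of_cwf enc W = nm_of_cwf enc W \<lparr>nm_ctx = cwf_ctx W, nm_pr = cwf_pr W,
     nm_var = (\<lambda>\<Gamma> A. enc (FMap (cwf_Ty W) \<Gamma> (cwf_ctx W \<Gamma> A) (cwf_pr W \<Gamma> A) A, cwf_var W \<Gamma> A))\<rparr>"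

lemma snm_of_cwf_simps [simp]:
  "nm_cat (snm_of_cwf enc W) = cwf_cat W" "nm_Ty (snm_of_cwf enc W) = cwf_Ty W"
  "nm_ctx (snm_of_cwf enc W) = cwf_ctx W" "nm_pr (snm_of_cwf enc W) = cwf_pr W"
  "nm_var (snm_of_cwf enc W)
    = (\<lambda>\<Gamma> A. enc (FMap (cwf_Ty W) \<Gamma> (cwf_ctx W \<Gamma> A) (cwf_pr W \<Gamma> A) A, cwf_var W \<Gamma> A))"
  by (simp_all add: snm_of_cwf_def nm_of_cwf_def)

lemma natural_model_nm_of_cwf:
  assumes enc: "inj enc" and W: "is_cwf W"
  shows "natural_model (nm_of_cwf enc W z)"
  unfolding natural_model_iff[OF premodel_nm_of_cwf[OF enc is_cwf_precwf[OF W]]] nm_of_cwf_simps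
  by (intro ballI exI, rule representing_pullback_nm_of_cwf[OF enc is_cwf_precwf[OF W] is_cwf_chosen[OF W]])

lemma structured_natural_model_snm_of_cwf:
  assumes enc: "inj enc" and W: "is_cwf W"
  shows "structured_natural_model (snm_of_cwf enc W)"
  unfolding structured_natural_model_def snm_of_cwf_simps unfolding snm_of_cwf_def
  by (intro conjI ballI natural_model_nm_of_cwf[OF enc W]
      representing_pullback_nm_of_cwf[OF enc is_cwf_precwf[OF W] is_cwf_chosen[OF W]])

text \<open>Tagging and untagging are mutually inverse, and both are strict because the extension
  data of \<open>snm_of_cwf enc W\<close> are those of \<open>W\<close> up to the tag on the generic
  term.\<close>

lemma isomorphic_snm_of_cwf:
  assumes enc: "inj enc" and W: "is_cwf W"
  shows "isomorphic CwF_str1 (cwf_of_snm (snm_of_cwf enc W)) W"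
proof -
  let ?V = "cwf_of_snm (snm_of_cwf enc W)"
  note W' = is_cwf_precwf[OF W]
  have V: "is_cwf ?V"
    by (rule is_cwf_cwf_of_snm[OF structured_natural_model_snm_of_cwf[OF enc W]])
  have enc_rel: "cwf_relabelling W ?V (\<lambda>\<Gamma> A a. enc (A, a))"
    and dec_rel: "cwf_relabelling ?V W (\<lambda>\<Gamma> A x. snd (inv enc x))"
    and enc_dec: "cwf_comp W (relabelling ?V (\<lambda>\<Gamma> A x. snd (inv enc x)))
      (relabelling W (\<lambda>\<Gamma> A a. enc (A, a))) = cwf_id W"
    and dec_enc: "cwf_comp ?V (relabelling W (\<lambda>\<Gamma> A a. enc (A, a)))
      (relabelling ?V (\<lambda>\<Gamma> A x. snd (inv enc x))) = cwf_id ?V"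
    unfolding snm_of_cwf_def
    by (rule relabelling_enc[OF enc W'] relabelling_dec[OF enc W'] relabelling_enc_dec[OF enc W']
        relabelling_dec_enc[OF enc W'])+
  have "relabelling W (\<lambda>\<Gamma> A a. enc (A, a)) \<in> strict_cwf_maps W ?V"
    using cwf_relabelling.relabelling_premaps[OF enc_rel] context_extension_data[OF is_cwf_chosen[OF W]]
    by (simp add: strict_cwf_maps_iff psh_Map[OF precwf_Ty[OF W']])
  moreover have "relabelling ?V (\<lambda>\<Gamma> A x. snd (inv enc x)) \<in> strict_cwf_maps ?V W"
    unfolding strict_cwf_maps_iff
  proof (intro conjI ballI cwf_relabelling.relabelling_premaps[OF dec_rel])
    fix \<Gamma> A assume \<Gamma>: "\<Gamma> \<in> Ob (cwf_cat ?V)" "A \<in> FOb (cwf_Ty ?V) \<Gamma>"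
    note [simp] = \<Gamma>[simplified] context_extension_data(3,4)[OF is_cwf_chosen[OF V \<Gamma>], simplified]
      psh_Map[OF precwf_Ty[OF W']]
    have var: "cwf_var ?V \<Gamma> A \<in> FOb (cwf_Tm ?V) (cwf_ctx W \<Gamma> A, FMap (cwf_Ty W) \<Gamma> (cwf_ctx W \<Gamma> A) (cwf_pr W \<Gamma> A) A)"
      using context_extension_data(5)[OF is_cwf_chosen[OF V \<Gamma>]] by simp
    show "FOb (cwfm_fun (relabelling ?V (\<lambda>\<Gamma> A x. snd (inv enc x)))) (cwf_ctx ?V \<Gamma> A)
        = cwf_ctx W (FOb (cwfm_fun (relabelling ?V (\<lambda>\<Gamma> A x. snd (inv enc x)))) \<Gamma>)
            (cwfm_Ty (relabelling ?V (\<lambda>\<Gamma> A x. snd (inv enc x))) \<Gamma> A)"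
      "FMap (cwfm_fun (relabelling ?V (\<lambda>\<Gamma> A x. snd (inv enc x)))) (cwf_ctx ?V \<Gamma> A) \<Gamma> (cwf_pr ?V \<Gamma> A)
        = cwf_pr W (FOb (cwfm_fun (relabelling ?V (\<lambda>\<Gamma> A x. snd (inv enc x)))) \<Gamma>)
            (cwfm_Ty (relabelling ?V (\<lambda>\<Gamma> A x. snd (inv enc x))) \<Gamma> A)"
      "cwfm_Tm (relabelling ?V (\<lambda>\<Gamma> A x. snd (inv enc x)))
          (cwf_ctx ?V \<Gamma> A, FMap (cwf_Ty ?V) \<Gamma> (cwf_ctx ?V \<Gamma> A) (cwf_pr ?V \<Gamma> A) A) (cwf_var ?V \<Gamma> A)
        = cwf_var W (FOb (cwfm_fun (relabelling ?V (\<lambda>\<Gamma> A x. snd (inv enc x)))) \<Gamma>)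
            (cwfm_Ty (relabelling ?V (\<lambda>\<Gamma> A x. snd (inv enc x))) \<Gamma> A)"
      using var by (simp_all add: inv_f_f[OF enc])
  qed
  ultimately have "is_iso CwF_str1 ?V W (relabelling ?V (\<lambda>\<Gamma> A x. snd (inv enc x)))"
    using enc_dec dec_enc by (intro is_isoI) simp_all
  then show ?thesis
    using V W by (auto simp: isomorphic_def)
qed

text \<open>Turns the existence of representing pullbacks into a function; its values are meaningful
  at contexts and types of a natural model.\<close>

definition chosen_extension :: "'u natmod \<Rightarrow> 'u \<Rightarrow> 'u \<Rightarrow> 'u \<times> 'u \<times> 'u" where
  "chosen_extension M \<Gamma> A = (SOME (E, \<pi>, q). representing_pullback M \<Gamma> A E \<pi> q)"

abbreviation cwf_of_natmod :: "'u natmod \<Rightarrow> 'u cwf" where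
  "cwf_of_natmod M \<equiv> cwf_of_nm M (\<lambda>\<Gamma> A. fst (chosen_extension M \<Gamma> A))
     (\<lambda>\<Gamma> A. fst (snd (chosen_extension M \<Gamma> A))) (\<lambda>\<Gamma> A. snd (snd (chosen_extension M \<Gamma> A)))"

lemma is_cwf_cwf_of_natmod:
  assumes M: "natural_model M"
  shows "is_cwf (cwf_of_natmod M)"
proof (rule is_cwf_cwf_of_nm[OF natural_model_premodel[OF M]])
  fix \<Gamma> A assume "\<Gamma> \<in> Ob (nm_cat M)" "A \<in> FOb (nm_Ty M) \<Gamma>"
  then have "\<exists>t. case t of (E, \<pi>, q) \<Rightarrow> representing_pullback M \<Gamma> A E \<pi> q"
    using M natural_model_iff[OF natural_model_premodel[OF M]] by auto
  from someI_ex[OF this] show "representing_pullback M \<Gamma> A (fst (chosen_extension M \<Gamma> A))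
      (fst (snd (chosen_extension M \<Gamma> A))) (snd (snd (chosen_extension M \<Gamma> A)))"
    unfolding chosen_extension_def by (simp add: case_prod_unfold)
qed

section \<open>Assembling the two equivalences\<close>

lemma equivalent_NatMod_str1_CwF_str1:
  assumes enc: "inj (enc :: 'u \<times> 'u \<Rightarrow> 'u)"
  shows "equivalent_cats (NatMod_str1 :: ('u snatmod, 'u nm_map) cat) (CwF_str1 :: ('u cwf, 'u cwf_map) cat)"
proof -
  define \<Phi> where "\<Phi> = mk_functor (NatMod_str1 :: ('u snatmod, 'u nm_map) cat) cwf_of_snm (\<lambda>M N. cwf_map_of M)"
  have strict: "h \<in> pseudo_maps M N" if "h \<in> strict_nm_maps M N" for M N :: "'u snatmod" and h
    using that by (simp add: strict_nm_maps_iff)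
  have map_in: "cwf_map_of M h \<in> strict_cwf_maps (cwf_of_snm M) (cwf_of_snm N)"
    if "structured_natural_model M" "structured_natural_model N" "h \<in> strict_nm_maps M N"
    for M N :: "'u snatmod" and h
    using that cwf_map_of_strict_iff strict by blast
  have "is_functor NatMod_str1 CwF_str1 \<Phi>"
    unfolding \<Phi>_def
  proof (rule is_functor_mk_functorI[OF category_NatMod_str1 category_CwF_str1])
    fix M N L :: "'u snatmod" and h k
    assume *: "M \<in> Ob NatMod_str1" "N \<in> Ob NatMod_str1" "L \<in> Ob NatMod_str1"
      "h \<in> Hom NatMod_str1 M N" "k \<in> Hom NatMod_str1 N L"
    have "cwf_map_of M (nm_comp M k h) = cwf_comp (cwf_of_snm M) (cwf_map_of N k) (cwf_map_of M h)"
      by (rule cwf_map_of_nm_comp[where L = L])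
        (use * in \<open>simp_all add: structured_natural_model_premodel strict\<close>)
    then show "cwf_map_of M (Comp NatMod_str1 M N L k h)
        = Comp CwF_str1 (cwf_of_snm M) (cwf_of_snm N) (cwf_of_snm L) (cwf_map_of N k) (cwf_map_of M h)"
      by simp
  qed (simp_all add: is_cwf_cwf_of_snm map_in cwf_map_of_nm_id
      structured_natural_model_premodel)
  then have "is_equivalence NatMod_str1 CwF_str1 \<Phi>"
  proof (rule fully_faithful_essentially_surjective_is_equivalence)
    fix M N :: "'u snatmod" assume "M \<in> Ob NatMod_str1" "N \<in> Ob NatMod_str1"
    then have MN: "structured_natural_model M" "structured_natural_model N" by simp_all
    have "FMap \<Phi> M N h = cwf_map_of M h" if "h \<in> strict_nm_maps M N" for h
      using MN that by (simp add: \<Phi>_def)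
    then have "bij_betw (FMap \<Phi> M N) (strict_nm_maps M N) (strict_cwf_maps (cwf_of_snm M) (cwf_of_snm N))"
      using bij_betw_cwf_map_of_strict[OF MN] bij_betw_cong[of "strict_nm_maps M N" "FMap \<Phi> M N"]
      by blast
    then show "bij_betw (FMap \<Phi> M N) (Hom NatMod_str1 M N) (Hom CwF_str1 (FOb \<Phi> M) (FOb \<Phi> N))"
      using MN by (simp add: \<Phi>_def)
  next
    fix W :: "'u cwf" assume "W \<in> Ob CwF_str1"
    then have W: "is_cwf W" by simp
    have "snm_of_cwf enc W \<in> Ob NatMod_str1"
      by (simp add: structured_natural_model_snm_of_cwf enc W)
    moreover from this have "FOb \<Phi> (snm_of_cwf enc W) = cwf_of_snm (snm_of_cwf enc W)"
      unfolding \<Phi>_def by (rule mk_functor_Ob)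
    ultimately show "\<exists>M\<in>Ob NatMod_str1. isomorphic CwF_str1 (FOb \<Phi> M) W"
      using isomorphic_snm_of_cwf[OF enc W] by metis
  qed
  then show ?thesis unfolding equivalent_cats_def by blast
qed

lemma equivalent_NatMod_ps_CwF_wk:
  assumes enc: "inj (enc :: 'u \<times> 'u \<Rightarrow> 'u)"
  shows "equivalent_2cats (NatMod_ps :: ('u natmod, 'u nm_map, 'u \<Rightarrow> 'u) cat2) (CwF_wk :: ('u cwf, 'u cwf_map, 'u \<Rightarrow> 'u) cat2)"
  unfolding NatMod_ps_eq CwF_wk_eq
proof (rule equivalent_2cats_over_Cat[OF NatMod.cat2_over_Cat_axioms CwF.cat2_over_Cat_axioms,
      where ?F0.0 = cwf_of_natmod and ?F1.0 = cwf_map_of]; (unfold mem_Collect_eq)?)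
  fix W :: "'u cwf" assume W: "is_cwf W"
  note W' = is_cwf_precwf[OF W]
  \<comment> \<open>The record extension is trivial, so \<open>M\<close> keeps none of the chosen
    extensions of \<open>W\<close>. Those of \<open>?V\<close> are picked anew, and the relabellings
    are accordingly shown to be weak maps.\<close>
  define M where "M = nm_of_cwf enc W ()"
  have M: "natural_model M" unfolding M_def by (rule natural_model_nm_of_cwf[OF enc W])
  let ?V = "cwf_of_natmod M"
  have V: "is_cwf ?V" by (rule is_cwf_cwf_of_natmod[OF M])
  have enc_rel: "cwf_relabelling W ?V (\<lambda>\<Gamma> A a. enc (A, a))"
    and dec_rel: "cwf_relabelling ?V W (\<lambda>\<Gamma> A x. snd (inv enc x))"
    and inverse: "cwf_comp W (relabelling ?V (\<lambda>\<Gamma> A x. snd (inv enc x)))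
      (relabelling W (\<lambda>\<Gamma> A a. enc (A, a))) = cwf_id W"
      "cwf_comp ?V (relabelling W (\<lambda>\<Gamma> A a. enc (A, a)))
      (relabelling ?V (\<lambda>\<Gamma> A x. snd (inv enc x))) = cwf_id ?V"
    unfolding M_def
    by (rule relabelling_enc[OF enc W'] relabelling_dec[OF enc W'] relabelling_enc_dec[OF enc W']
        relabelling_dec_enc[OF enc W'])+
  have "relabelling W (\<lambda>\<Gamma> A a. enc (A, a)) \<in> weak_cwf_maps W ?V"
    using cwf_relabelling.relabelling_premaps[OF enc_rel]
      cwf_relabelling.relabelling_preserves_extensions[OF enc_rel]
    by (simp add: weak_cwf_maps_iff[OF W V])
  moreover have "relabelling ?V (\<lambda>\<Gamma> A x. snd (inv enc x)) \<in> weak_cwf_maps ?V W"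
    using cwf_relabelling.relabelling_premaps[OF dec_rel]
      cwf_relabelling.relabelling_preserves_extensions[OF dec_rel]
    by (simp add: weak_cwf_maps_iff[OF V W])
  ultimately show "\<exists>M\<in>{M. natural_model M}. \<exists>f\<in>weak_cwf_maps (cwf_of_natmod M) W.
      \<exists>g\<in>weak_cwf_maps W (cwf_of_natmod M).
        cwf_comp (cwf_of_natmod M) g f = cwf_id (cwf_of_natmod M) \<and> cwf_comp W f g = cwf_id W"
    using M inverse by blast
next
  fix M N L :: "'u natmod" and h k
  assume "natural_model M" "natural_model N" "natural_model L" "h \<in> pseudo_maps M N" "k \<in> pseudo_maps N L"
  then show "cwf_map_of M (nm_comp M k h) = cwf_comp (cwf_of_natmod M) (cwf_map_of N k) (cwf_map_of M h)"
    by (intro cwf_map_of_nm_comp[where L = L] natural_model_premodel)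
qed (simp_all add: is_cwf_cwf_of_natmod bij_betw_cwf_map_of cwf_transformations_cwf_map_of
    cwf_map_of_nm_id natural_model_premodel)

theorem proposition43:
  assumes "infinite (UNIV :: 'u set)"
  shows "equivalent_cats
           (NatMod_str1 :: ('u snatmod, 'u nm_map) cat)
           (CwF_str1 :: ('u cwf, 'u cwf_map) cat) \<and>
         equivalent_2cats
           (NatMod_ps :: ('u natmod, 'u nm_map, 'u \<Rightarrow> 'u) cat2)
           (CwF_wk :: ('u cwf, 'u cwf_map, 'u \<Rightarrow> 'u) cat2)"
proof -
  \<comment> \<open>An infinite cardinal equals its square, which yields a pairing function on the
    universe.\<close>
  obtain enc :: "'u \<times> 'u \<Rightarrow> 'u" where "bij_betw enc (UNIV \<times> UNIV) UNIV"
    using card_of_Times_same_infinite[OF assms] unfolding card_of_ordIso[symmetric] by blast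
  then have "inj enc" by (simp add: bij_betw_def)
  then show ?thesis
    using equivalent_NatMod_str1_CwF_str1 equivalent_NatMod_ps_CwF_wk by blast
qed

end
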